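(* Let $Q$ be the infinitesimal generator of an ergodic regular-jump Markov chain $\{(X(t),J(t));t\ge 0\}$ on $\mathbb F$ with stationary distribution $\pi$, and assume that for each $n\in\mathbb N$ the LC-block-augmented truncation ${}_{(n)}Q$ has a unique closed communicating class in $\mathbb F_n$; let ${}_{(n)}\pi$ be its stationary distribution. Suppose: (i) there exist $b>0$, $K\in\mathbb Z_+$ and column vectors $v\ge 0$, $f\ge e$ on $\mathbb F$ with $Qv\le -f+b\,1_{\mathbb F_K}$, and the subvector $(v(k,i))_{(k,i)\in\overline{\mathbb F}_0}$ is positive and level-wise nondecreasing; (ii) there exist $b^\sharp>0$, $K^\sharp\in\mathbb Z_+$ and column vectors $v^\sharp\ge0$, $f^\sharp\ge e$ on $\mathbb F$ such that the subvector $(v^\sharp(k,i))_{(k,i)\in\overline{\mathbb F}_0}$ is level-wise nondecreasing and $Qv^\sharp\le -f^\sharp+b^\sharp 1_{\mathbb F_{K^\sharp}}$; (iii) there exist a column vector $a=(a(i))_{i\in\mathbb S_1}>0$ and two nondecreasing log-subadditive functions $V,T:[0,\infty)\to[1,\infty)$ such that $v(k)=V(k)a$ for all $k\in\mathbb N$, $\lim_{x\to\infty}T(x)=\infty$, $$\sup_{(k,i)\in\mathbb F}\frac{T(k)V(k)}{f^\sharp(k,i)}<\infty,\qquad \sup_{k,\ell\in\mathbb Z_+}T(\ell)\left\|\sum_{m=\ell+1}^\infty Q(k;k+m)V(m)a\right\|_\infty<\infty.$$ Let $\beta>0$ and, for $n\in\mathbb N$, let $$E(n)=2\sum_{k=0}^n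 {}_{(n)}\pi(k)\sum_{m=n+1}^\infty Q(k;m)\left\{v(m)+v(n)+2\left(\pi v+\frac{2b}{\beta\,\overline\phi_K^{(\beta)}}\right)e\right\},$$ $$E^+(n)=4\sum_{k=0}^n {}_{(n)}\pi(k)\sum_{m=n+1}^\infty Q(k;m)\left\{v(m)+\left(\pi v+\frac{2b}{\beta\,\overline\phi_K^{(\beta)}}\right)e\right\}.$$ Then for all $n\in\mathbb N$: $|\pi-{}_{(n)}\pi|\,g\le\frac{\pi g+1}{2}E(n)$ for all $0\le g\le f$; $\ \sup_{e\le g\le f}\frac{|\pi-{}_{(n)}\pi|\,g}{\pi g}\le E(n)$; and $$E(n)\le E^+(n)\le\frac{4r_0^\sharp r_1^\sharp b^\sharp}{T(n)}\left[1+\frac{\underline a^{-1}}{V(n+1)}\left(\pi v+\frac{2b}{\beta\,\overline\phi_K^{(\beta)}}\right)\right],$$ where $\underline a=\min_{i\in\mathbb S_1}a(i)$ and $r_0^\sharp,r_1^\sharp$ are any positive numbers with $$r_0^\sharp\ge\sup_{(k,i)\in\mathbb F}\frac{T(k)V(k)}{f^\sharp(k,i)},\qquad r_1^\sharp\ge\sup_{k,\ell\in\mathbb Z_+}T(\ell)\left\|\sum_{m=\ell+1}^\infty Q(k;k+m)V(m)a\right\|_\infty.$$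
   Context: Notation: $\mathbb Z_+=\{0,1,2,\dots\}$, $\mathbb N=\{1,2,\dots\}$. For $k\in\mathbb Z_+$, $\mathbb S_k=\{0,1,\dots,S_k\}$ with $S_k\in\mathbb Z_+$, and $S_k=S_1$ for all $k\in\mathbb N$. Levels: $\mathbb L_k=\{k\}\times\mathbb S_k$; $\mathbb F=\bigcup_{k\ge0}\mathbb L_k$, $\mathbb F_n=\bigcup_{k=0}^n\mathbb L_k$, $\overline{\mathbb F}_n=\mathbb F\setminus\mathbb F_n$. For a vector $x=(x(k,i))_{(k,i)\in\mathbb F}$, $x(k)=(x(k,i))_{i\in\mathbb S_k}$ is its subvector for level $k$. The subvector of $x$ on $\overline{\mathbb F}_0$ is level-wise nondecreasing if $x(k)\le x(k+1)$ for all $k\in\mathbb N$. $e$ is a column vector of ones of appropriate size, $1_{\mathbb C}$ is the column indicator vector of $\mathbb C\subseteq\mathbb F$; inequalities and absolute values $|\cdot|$ of vectors and matrices are entrywise; $\|\cdot\|_\infty$ is the uniform norm. A function $F:[0,\infty)\to[1,\infty)$ is log-subadditive if $F(x+y)\le F(x)F(y)$ for all $x,y\ge0$. $\{(X(t),J(t))\}$ is a continuous-time regular-jump (non-explosive) Markov chain with state space $\mathbb F$, transition matrix function $P^{(t)}=(p^{(t)}(k,i;\ell,j))$ and stable, conservative infinitesimal generator $Q=(q(k,i;\ell,j))$ with blocks $Q(k;\ell)=(q(k,i;\ell,j))_{i\in\mathbb S_k,\,j\in\mathbb S_\ell}$. Ergodic means irreducible and positive recurrent; $\pi$ is the unique stationary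 distribution (row vector, $\pi Q=0$, $\pi e=1$). For $n\in\mathbb N$, the last-column-block-augmented (LC-block-augmented) truncation ${}_{(n)}Q$ of $Q$ is the conservative $q$-matrix on $\mathbb F$ with blocks $${}_{(n)}Q(k;\ell)=\begin{cases}Q(k;\ell),&k\in\mathbb Z_+,\ 0\le\ell\le n-1,\\ Q(k;n)+\sum_{m>n,\,m\ne k}Q(k;m),&k\in\mathbb Z_+,\ \ell=n,\\ Q(k;k),&k=\ell\ge n+1,\\ O,&\text{otherwise.}\end{cases}$$ ${}_{(n)}\pi=({}_{(n)}\pi(k,i))_{(k,i)\in\mathbb F}$ is its unique stationary distribution (row vector); ${}_{(n)}\pi(k)=0$ for $k\ge n+1$. For $\beta>0$: $\Phi^{(\beta)}=(\phi^{(\beta)}(k,i;\ell,j))=\int_0^\infty\beta e^{-\beta t}P^{(t)}\,dt$ (entrywise positive by ergodicity), and $\overline\phi_K^{(\beta)}=\sup_{(\ell,j)\in\mathbb F}\min_{(k,i)\in\mathbb F_K}\phi^{(\beta)}(k,i;\ell,j)>0$. *)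

theory Defs
  imports "HOL-Probability.Probability"
begin

type_synonym state = "nat \<times> nat"

text \<open>
  \<open>S k\<close> is the largest phase of level \<open>k\<close>. Vectors and matrices on the state space are
  total functions on \<open>nat \<times> nat\<close>; only their values on \<open>states S\<close> are ever used.
\<close>

definition states :: "(nat \<Rightarrow> nat) \<Rightarrow> state set" where
  "states S = {(k, i). i \<le> S k}"

definition states_upto :: "(nat \<Rightarrow> nat) \<Rightarrow> nat \<Rightarrow> state set" where
  "states_upto S n = {(k, i). k \<le> n \<and> i \<le> S k}"

definition levelwise_nondecreasing :: "(nat \<Rightarrow> nat) \<Rightarrow> (state \<Rightarrow> real) \<Rightarrow> bool" where
  "levelwise_nondecreasing S v \<longleftrightarrow> (\<forall>k\<ge>1. \<forall>i\<le>S k. v (k, i) \<le> v (k + 1, i))"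

text \<open>
  A chain is given by a process \<open>Z\<close> and the family of laws \<open>M x\<close>, where \<open>M x\<close> is the law
  of the chain started at \<open>x\<close>.
\<close>

definition transition_function ::
    "(state \<Rightarrow> 'w measure) \<Rightarrow> (real \<Rightarrow> 'w \<Rightarrow> state) \<Rightarrow> real \<Rightarrow> state \<Rightarrow> state \<Rightarrow> real" where
  "transition_function M Z t x y = \<P>(w in M x. Z t w = y)"

text \<open>
  Homogeneous Markov property: \<open>h\<close> lists finitely many (time, state) pairs from the past of \<open>s\<close>.
\<close>

definition markov_chain ::
    "state set \<Rightarrow> (state \<Rightarrow> 'w measure) \<Rightarrow> (real \<Rightarrow> 'w \<Rightarrow> state) \<Rightarrow> bool" where
  "markov_chain F M Z \<longleftrightarrow>
     (\<forall>x\<in>F. prob_space (M x)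
        \<and> (\<forall>t\<ge>0. Z t \<in> measurable (M x) (count_space F))
        \<and> (AE w in M x. Z 0 w = x)
        \<and> (\<forall>s\<ge>0. \<forall>t\<ge>0. \<forall>y\<in>F. \<forall>z\<in>F. \<forall>h :: (real \<times> state) list.
             (\<forall>(u, c)\<in>set h. 0 \<le> u \<and> u \<le> s) \<longrightarrow>
             \<P>(w in M x. Z s w = y \<and> (\<forall>(u, c)\<in>set h. Z u w = c)) > 0 \<longrightarrow>
             \<P>(w in M x. Z (s + t) w = z \<bar> Z s w = y \<and> (\<forall>(u, c)\<in>set h. Z u w = c))
               = transition_function M Z t y z))"

text \<open>
  Regular jump paths: almost surely right-continuous (for the discrete topology of
  \<open>nat \<times> nat\<close>) with finitely many discontinuities in bounded time, i.e. no explosion.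
\<close>

definition regular_jump_path :: "(real \<Rightarrow> state) \<Rightarrow> bool" where
  "regular_jump_path z \<longleftrightarrow>
     (\<forall>t\<ge>0. continuous (at_right t) z) \<and>
     (\<forall>c\<ge>0. finite {t \<in> {0..c}. \<not> continuous (at t within {0..}) z})"

definition regular_jump_markov_chain ::
    "state set \<Rightarrow> (state \<Rightarrow> 'w measure) \<Rightarrow> (real \<Rightarrow> 'w \<Rightarrow> state) \<Rightarrow> bool" where
  "regular_jump_markov_chain F M Z \<longleftrightarrow>
     markov_chain F M Z \<and> (\<forall>x\<in>F. AE w in M x. regular_jump_path (\<lambda>t. Z t w))"

text \<open>Stability (finite rates) is built into the real-valued limit.\<close>

definition is_generator ::
    "state set \<Rightarrow> (real \<Rightarrow> state \<Rightarrow> state \<Rightarrow> real) \<Rightarrow> (state \<Rightarrow> state \<Rightarrow> real) \<Rightarrow> bool" where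
  "is_generator F P Q \<longleftrightarrow>
     (\<forall>x\<in>F. \<forall>y\<in>F. ((\<lambda>h. (P h x y - (if x = y then 1 else 0)) / h) \<longlongrightarrow> Q x y) (at_right 0))"

definition conservative :: "state set \<Rightarrow> (state \<Rightarrow> state \<Rightarrow> real) \<Rightarrow> bool" where
  "conservative F Q \<longleftrightarrow> (\<forall>x\<in>F. (Q x has_sum 0) F)"

definition irreducible_chain :: "state set \<Rightarrow> (real \<Rightarrow> state \<Rightarrow> state \<Rightarrow> real) \<Rightarrow> bool" where
  "irreducible_chain F P \<longleftrightarrow> (\<forall>x\<in>F. \<forall>y\<in>F. \<exists>t>0. P t x y > 0)"

text \<open>First time at which a path is in \<open>x\<close> after having left \<open>x\<close>; infinite if there is none.\<close>

definition return_time :: "state \<Rightarrow> (real \<Rightarrow> state) \<Rightarrow> ennreal" where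
  "return_time x z = Inf {ennreal t |t. 0 < t \<and> z t = x \<and> (\<exists>s. 0 < s \<and> s < t \<and> z s \<noteq> x)}"

definition positive_recurrent ::
    "state set \<Rightarrow> (state \<Rightarrow> 'w measure) \<Rightarrow> (real \<Rightarrow> 'w \<Rightarrow> state) \<Rightarrow> bool" where
  "positive_recurrent F M Z \<longleftrightarrow>
     (\<forall>x\<in>F. (\<integral>\<^sup>+ w. return_time x (\<lambda>t. Z t w) \<partial>M x) < \<infinity>)"

definition ergodic ::
    "state set \<Rightarrow> (state \<Rightarrow> 'w measure) \<Rightarrow> (real \<Rightarrow> 'w \<Rightarrow> state) \<Rightarrow> bool" where
  "ergodic F M Z \<longleftrightarrow>
     irreducible_chain F (transition_function M Z) \<and> positive_recurrent F M Z"

definition stationary_distribution ::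
    "state set \<Rightarrow> (state \<Rightarrow> state \<Rightarrow> real) \<Rightarrow> (state \<Rightarrow> real) \<Rightarrow> bool" where
  "stationary_distribution F A p \<longleftrightarrow>
     (\<forall>x\<in>F. 0 \<le> p x) \<and> (p has_sum 1) F \<and> (\<forall>y\<in>F. ((\<lambda>x. p x * A x y) has_sum 0) F)"

definition resolvent ::
    "real \<Rightarrow> (real \<Rightarrow> state \<Rightarrow> state \<Rightarrow> real) \<Rightarrow> state \<Rightarrow> state \<Rightarrow> real" where
  "resolvent \<beta> P x y = (LBINT t:{0..}. \<beta> * exp (- \<beta> * t) * P t x y)"

definition phi_bar ::
    "(nat \<Rightarrow> nat) \<Rightarrow> real \<Rightarrow> (real \<Rightarrow> state \<Rightarrow> state \<Rightarrow> real) \<Rightarrow> nat \<Rightarrow> real" where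
  "phi_bar S \<beta> P K = (SUP y\<in>states S. Min ((\<lambda>x. resolvent \<beta> P x y) ` states_upto S K))"

definition lc_truncation ::
    "nat \<Rightarrow> (state \<Rightarrow> state \<Rightarrow> real) \<Rightarrow> state \<Rightarrow> state \<Rightarrow> real" where
  "lc_truncation n Q = (\<lambda>(k, i) (l, j).
     if l < n then Q (k, i) (l, j)
     else if l = n then
       Q (k, i) (n, j) + (\<Sum>\<^sub>\<infinity>m\<in>{m. n < m \<and> m \<noteq> k}. Q (k, i) (m, j))
     else if k = l then Q (k, i) (l, j)
     else 0)"

definition accessible :: "state set \<Rightarrow> (state \<Rightarrow> state \<Rightarrow> real) \<Rightarrow> state \<Rightarrow> state \<Rightarrow> bool" where
  "accessible F A x y \<longleftrightarrow> (x, y) \<in> {(x, y). x \<in> F \<and> y \<in> F \<and> x \<noteq> y \<and> A x y > 0}\<^sup>*"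

definition communicating_class :: "state set \<Rightarrow> (state \<Rightarrow> state \<Rightarrow> real) \<Rightarrow> state set \<Rightarrow> bool" where
  "communicating_class F A C \<longleftrightarrow>
     (\<exists>x\<in>F. C = {y \<in> F. accessible F A x y \<and> accessible F A y x})"

definition closed_class :: "state set \<Rightarrow> (state \<Rightarrow> state \<Rightarrow> real) \<Rightarrow> state set \<Rightarrow> bool" where
  "closed_class F A C \<longleftrightarrow> (\<forall>x\<in>C. \<forall>y\<in>F. accessible F A x y \<longrightarrow> y \<in> C)"

text \<open>\<open>A v \<le> - f + b 1\<^sub>C\<close>, including the convergence of the series defining \<open>A v\<close>.\<close>

definition drift_condition ::
    "state set \<Rightarrow> (state \<Rightarrow> state \<Rightarrow> real) \<Rightarrow> (state \<Rightarrow> real) \<Rightarrow> (state \<Rightarrow> real) \<Rightarrow> real \<Rightarrow> state set \<Rightarrow> bool"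
  where
  "drift_condition F A v f b C \<longleftrightarrow>
     (\<forall>x\<in>F. (\<lambda>y. A x y * v y) summable_on F \<and>
             (\<Sum>\<^sub>\<infinity>y\<in>F. A x y * v y) \<le> - f x + b * indicator C x)"

definition nondecreasing_log_subadditive :: "(real \<Rightarrow> real) \<Rightarrow> bool" where
  "nondecreasing_log_subadditive G \<longleftrightarrow>
     (\<forall>x\<ge>0. G x \<ge> 1) \<and> mono_on {0..} G \<and> (\<forall>x\<ge>0. \<forall>y\<ge>0. G (x + y) \<le> G x * G y)"

text \<open>
  The quantities below are series of nonnegative terms, taken in \<^typ>\<open>ennreal\<close> so that they always
  have a value. Only off-diagonal entries of \<open>Q\<close> occur, so no negative number is truncated.
\<close>

definition row_times_col :: "state set \<Rightarrow> (state \<Rightarrow> real) \<Rightarrow> (state \<Rightarrow> real) \<Rightarrow> ennreal" where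
  "row_times_col F p g = (\<Sum>\<^sub>\<infinity>x\<in>F. ennreal (p x) * ennreal (g x))"

definition block_times ::
    "(nat \<Rightarrow> nat) \<Rightarrow> (state \<Rightarrow> state \<Rightarrow> real) \<Rightarrow> nat \<Rightarrow> nat \<Rightarrow> (nat \<Rightarrow> ennreal) \<Rightarrow> nat \<Rightarrow> ennreal" where
  "block_times S Q k l u i = (\<Sum>j\<le>S l. ennreal (Q (k, i) (l, j)) * u j)"

definition r0_sup ::
    "(nat \<Rightarrow> nat) \<Rightarrow> (real \<Rightarrow> real) \<Rightarrow> (real \<Rightarrow> real) \<Rightarrow> (state \<Rightarrow> real) \<Rightarrow> ennreal" where
  "r0_sup S T V f = (SUP (k, i)\<in>states S. ennreal (T (real k) * V (real k) / f (k, i)))"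

text \<open>The vector whose uniform norm is taken is nonnegative, so the norm is its largest entry.\<close>

definition r1_sup ::
    "(nat \<Rightarrow> nat) \<Rightarrow> (state \<Rightarrow> state \<Rightarrow> real) \<Rightarrow> (real \<Rightarrow> real) \<Rightarrow> (real \<Rightarrow> real) \<Rightarrow> (nat \<Rightarrow> real) \<Rightarrow> ennreal"
  where
  "r1_sup S Q T V a =
     (SUP (k, l)\<in>UNIV. ennreal (T (real l)) *
        (MAX i\<in>{..S k}.
           \<Sum>\<^sub>\<infinity>m\<in>{l + 1..}. block_times S Q k (k + m) (\<lambda>j. ennreal (V (real m) * a j)) i))"

text \<open>\<open>\<pi> v + 2 b / (\<beta> \<phi>)\<close>, with \<open>\<phi>\<close> standing for \<open>phi_bar S \<beta> P K\<close>.\<close>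

definition err_const ::
    "state set \<Rightarrow> (state \<Rightarrow> real) \<Rightarrow> (state \<Rightarrow> real) \<Rightarrow> real \<Rightarrow> real \<Rightarrow> real \<Rightarrow> ennreal" where
  "err_const F \<pi> v b \<beta> \<phi> = row_times_col F \<pi> v + ennreal (2 * b / (\<beta> * \<phi>))"

definition err ::
    "(nat \<Rightarrow> nat) \<Rightarrow> (state \<Rightarrow> state \<Rightarrow> real) \<Rightarrow> (state \<Rightarrow> real) \<Rightarrow> ennreal \<Rightarrow> (state \<Rightarrow> real) \<Rightarrow> nat \<Rightarrow> ennreal"
  where
  "err S Q v c p n =
     2 * (\<Sum>k\<le>n. \<Sum>i\<le>S k. ennreal (p (k, i)) *
       (\<Sum>\<^sub>\<infinity>m\<in>{n + 1..}.
          block_times S Q k m (\<lambda>j. ennreal (v (m, j)) + ennreal (v (n, j)) + 2 * c) i))"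

definition err_plus ::
    "(nat \<Rightarrow> nat) \<Rightarrow> (state \<Rightarrow> state \<Rightarrow> real) \<Rightarrow> (state \<Rightarrow> real) \<Rightarrow> ennreal \<Rightarrow> (state \<Rightarrow> real) \<Rightarrow> nat \<Rightarrow> ennreal"
  where
  "err_plus S Q v c p n =
     4 * (\<Sum>k\<le>n. \<Sum>i\<le>S k. ennreal (p (k, i)) *
       (\<Sum>\<^sub>\<infinity>m\<in>{n + 1..}. block_times S Q k m (\<lambda>j. ennreal (v (m, j)) + c) i))"

end

theory Submission
  imports Defs
begin

text \<open>
  Both error bounds come from a solution $h$ of the Poisson equation $Q h = \pi \tilde g - \tilde g$, where
  $\tilde g$ is $g$ with the sign of ${}_{(n)}\pi - \pi$, so that $|\pi - {}_{(n)}\pi|\, g =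
  {}_{(n)}\pi \tilde g - \pi \tilde g = - \, {}_{(n)}\pi \, Q h$.
  On the first $n + 1$ levels the truncated generator applied to $h$ is $Q$ applied to $h \circ \rho$, where
  $\rho$ moves every state above level $n$ down to level $n$ in the same phase (\<open>capped_has_sum\<close>). As
  ${}_{(n)}\pi$ lives on these levels (\<open>stationary_above_zero\<close>) and annihilates its own generator,
  the error is ${}_{(n)}\pi \, Q (h \circ \rho - h)$, which only involves jumps from below to above level $n$
  (\<open>perturbation_bound\<close>). Everything then rests on the estimate
  $|h| \le (1 + \pi g) (v + 2 b / (\beta \overline\phi_K))$.

  For this estimate fix a state $y$ at which at least half of the supremum is attained in $\overline\phi_K$ and let
  $u(x) = \phi^{(\beta)}(x; y)$. The resolvent equation $Q u = \beta (u - 1_y)$ (\<open>resolvent_equation\<close>)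
  shows that adding $c' (1 - u)$ to $v$, with $c' = 2 b / (\beta \overline\phi_K)$, cancels the term
  $b \, 1_{\mathbb F_K}$ of the drift condition at every state but $y$. The sum $w$ satisfies
  $v \le w \le v + c'$ and $Q w \le - f$ off $y$, and therefore dominates the cost $H_g$ accumulated before $y$
  is hit, for every $0 \le g \le f$ (\<open>hitting_cost_le\<close>). The function
  $h = H_{\tilde g^+} - H_{\tilde g^-} - (\pi \tilde g) H_e$ of
  \<open>poisson_solution\<close>, bounded by $(1 + \pi g) w$, solves the equation off $y$. It does so at
  $y$ as well because $\pi g = \pi(y) (g(y) + \sum_z Q(y; z) H_g(z))$ (\<open>kac_formula\<close>).

  Kac's formula needs $y$ to be hit almost surely by the minimal chain with rates $Q$. This is obtained
  analytically (\<open>absorption\<close>): the hitting cost is built from the embedded jump chain, and a maximum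
  principle applies because $\ln T(k) + (B + 1) w$ is a function with finite sublevel sets on which $Q$ is
  negative off $y$. That $Q$ applied to the logarithm of $T$ is bounded by a constant $B$ follows from the tail
  condition on the upward jumps, by summation by parts (\<open>log_drift_le\<close>).

  The last bound follows from log-subadditivity. A jump from level $k \le n$ to a level beyond $n$ goes up by
  more than $n - k$ levels, and $V(m) \le V(k) V(m - k)$, $T(n) \le T(k) T(n - k)$ reduce its contribution to
  $T(k) V(k) r_1 / T(n)$; the average of $T V \le r_0 f^\sharp$ under ${}_{(n)}\pi$ is controlled by the second
  drift condition, which the truncation inherits because $v^\sharp$ is level-wise nondecreasing
  (\<open>truncated_drift\<close>).
\<close>

section \<open>Sums of nonnegative families as integrals\<close>

text \<open>
  The bridge to the integral, where Tonelli's theorem and monotone convergence are available.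
\<close>

lemma nn_integral_count_space_eq_infsum:
  fixes f :: "'a :: countable \<Rightarrow> ennreal"
  shows "(\<integral>\<^sup>+x. f x \<partial>count_space A) = infsum f A"
proof (rule antisym)
  define B where "B n = {x\<in>A. to_nat x < n}" for n :: nat
  have fin: "finite (B n)" and sub: "B n \<subseteq> A" for n
    using finite_imageD[of to_nat "B n"] finite_subset[of "to_nat ` B n" "{..<n}"]
    by (auto simp: B_def inj_on_def)
  have inc: "incseq (\<lambda>n x. f x * indicator (B n) x)"
    by (auto simp: incseq_def le_fun_def B_def split: split_indicator)
  have sum: "(\<integral>\<^sup>+x. f x * indicator (B n) x \<partial>count_space A) = (\<Sum>x\<in>B n. f x)" for n
    using fin sub by (subst nn_integral_count_space'[of "B n"]) (auto split: split_indicator intro!: sum.cong)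
  have "f x = (SUP n. f x * indicator (B n) x)" if "x \<in> A" for x
  proof (rule antisym)
    have "f x * indicator (B (Suc (to_nat x))) x \<le> (SUP n. f x * indicator (B n) x)"
      by (rule SUP_upper) simp
    then show "f x \<le> (SUP n. f x * indicator (B n) x)"
      using that by (simp add: B_def)
  qed (auto intro!: SUP_least split: split_indicator)
  then have "(\<integral>\<^sup>+x. f x \<partial>count_space A) = (\<integral>\<^sup>+x. (SUP n. f x * indicator (B n) x) \<partial>count_space A)"
    by (intro nn_integral_cong) auto
  also have "\<dots> = (SUP n. \<integral>\<^sup>+x. f x * indicator (B n) x \<partial>count_space A)"
    using inc by (intro nn_integral_monotone_convergence_SUP) auto
  also have "\<dots> = (SUP n. \<Sum>x\<in>B n. f x)"
    by (simp add: sum)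
  also have "\<dots> \<le> (SUP E\<in>{E. finite E \<and> E \<subseteq> A}. sum f E)"
    using fin sub by (intro SUP_mono) auto
  also have "\<dots> = infsum f A"
    by (simp add: nonneg_infsum_complete)
  finally show "(\<integral>\<^sup>+x. f x \<partial>count_space A) \<le> infsum f A" .
next
  have "sum f E \<le> (\<integral>\<^sup>+x. f x \<partial>count_space A)" if "finite E" "E \<subseteq> A" for E
  proof -
    have "sum f E = (\<integral>\<^sup>+x. f x * indicator E x \<partial>count_space A)"
      using that by (subst nn_integral_count_space'[of E]) (auto split: split_indicator intro!: sum.cong)
    also have "\<dots> \<le> (\<integral>\<^sup>+x. f x \<partial>count_space A)"
      by (intro nn_integral_mono) (auto split: split_indicator)
    finally show ?thesis .
  qed
  then show "infsum f A \<le> (\<integral>\<^sup>+x. f x \<partial>count_space A)"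
    by (simp add: nonneg_infsum_complete SUP_le_iff)
qed

lemma has_sum_iff_nn_integral:
  fixes f :: "'a :: countable \<Rightarrow> real"
  assumes f: "\<And>x. x \<in> A \<Longrightarrow> 0 \<le> f x" and s: "0 \<le> s"
  shows "(f has_sum s) A \<longleftrightarrow> (\<integral>\<^sup>+x. ennreal (f x) \<partial>count_space A) = ennreal s"
proof -
  have sup: "(\<integral>\<^sup>+x. ennreal (f x) \<partial>count_space A)
      = (SUP E\<in>{E. finite E \<and> E \<subseteq> A}. ennreal (sum f E))"
    using f by (auto simp: nn_integral_count_space_eq_infsum nonneg_infsum_complete subset_iff intro!: SUP_cong sum_ennreal)
  show ?thesis
  proof
    assume "(f has_sum s) A"
    then show "(\<integral>\<^sup>+x. ennreal (f x) \<partial>count_space A) = ennreal s"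
      using infsum_nonneg_is_SUPREMUM_ennreal[of f A] f sup
      by (auto simp: has_sum_imp_summable infsumI)
  next
    assume int: "(\<integral>\<^sup>+x. ennreal (f x) \<partial>count_space A) = ennreal s"
    have "sum f E \<le> s" if "finite E" "E \<subseteq> A" for E
    proof -
      have "ennreal (sum f E) \<le> ennreal s"
        using that unfolding int[symmetric] sup by (intro SUP_upper) auto
      then show ?thesis using s by (simp add: ennreal_le_iff)
    qed
    then have sm: "f summable_on A"
      using f by (intro nonneg_bdd_above_summable_on bdd_aboveI2[where M=s]) auto
    have "ennreal (infsum f A) = ennreal s"
      using infsum_nonneg_is_SUPREMUM_ennreal[OF sm] f sup int by simp
    then have "infsum f A = s"
      using s f by (simp add: infsum_nonneg)
    then show "(f has_sum s) A" using sm by auto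
  qed
qed

section \<open>The resolvent of a Markov semigroup\<close>

lemma set_integral_linear_combination:
  fixes g :: "'i \<Rightarrow> 'a \<Rightarrow> real"
  assumes "\<And>i. i \<in> I \<Longrightarrow> set_integrable M A (g i)"
  shows "set_integrable M A (\<lambda>t. \<Sum>i\<in>I. c i * g i t)"
    and "(LINT t:A|M. (\<Sum>i\<in>I. c i * g i t)) = (\<Sum>i\<in>I. c i * (LINT t:A|M. g i t))"
proof -
  have eq: "indicator A t *\<^sub>R (\<Sum>i\<in>I. c i * g i t) = (\<Sum>i\<in>I. c i * (indicator A t *\<^sub>R g i t))" for t
    by (simp add: sum_distrib_left mult.left_commute)
  have int: "integrable M (\<lambda>t. c i * (indicator A t *\<^sub>R g i t))" if "i \<in> I" for i
    using assms[OF that] unfolding set_integrable_def by (intro integrable_mult_right)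
  show "set_integrable M A (\<lambda>t. \<Sum>i\<in>I. c i * g i t)"
    unfolding set_integrable_def eq using int by (intro Bochner_Integration.integrable_sum)
  show "(LINT t:A|M. (\<Sum>i\<in>I. c i * g i t)) = (\<Sum>i\<in>I. c i * (LINT t:A|M. g i t))"
    unfolding set_lebesgue_integral_def eq using int by (subst Bochner_Integration.integral_sum) simp_all
qed

locale generated_semigroup =
  fixes F :: "state set" and P :: "real \<Rightarrow> state \<Rightarrow> state \<Rightarrow> real" and Q :: "state \<Rightarrow> state \<Rightarrow> real"
  assumes P_nonneg: "\<lbrakk>0 \<le> t; x \<in> F; y \<in> F\<rbrakk> \<Longrightarrow> 0 \<le> P t x y"
    and P_total: "\<lbrakk>0 \<le> t; x \<in> F\<rbrakk> \<Longrightarrow> (P t x has_sum 1) F"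
    and chapman_kolmogorov: "\<lbrakk>0 \<le> s; 0 \<le> t; x \<in> F; z \<in> F\<rbrakk>
      \<Longrightarrow> ((\<lambda>y. P s x y * P t y z) has_sum P (s + t) x z) F"
    and generator: "is_generator F P Q"
    and conservative: "conservative F Q"
    and irreducible: "irreducible_chain F P"
begin

lemma generator_tendsto:
  assumes "x \<in> F" "y \<in> F"
  shows "((\<lambda>h. (P h x y - of_bool (x = y)) / h) \<longlongrightarrow> Q x y) (at_right 0)"
  using generator assms by (simp add: is_generator_def of_bool_def)

lemma rate_nonneg:
  assumes "x \<in> F" "y \<in> F" "x \<noteq> y"
  shows "0 \<le> Q x y"
  using generator_tendsto[OF assms(1,2)]
proof (rule tendsto_lowerbound)
  show "\<forall>\<^sub>F h in at_right 0. 0 \<le> (P h x y - of_bool (x = y)) / h"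
    using P_nonneg assms by (auto simp: eventually_at_right_field intro!: exI[of _ 1])
qed simp

lemma P_le_1:
  assumes "0 \<le> t" "x \<in> F" "y \<in> F"
  shows "P t x y \<le> 1"
proof -
  have "sum (P t x) {y} \<le> 1"
    using assms P_nonneg by (intro finite_sum_le_has_sum[OF P_total]) auto
  then show ?thesis by simp
qed

lemma P_tendsto_0:
  assumes "x \<in> F" "y \<in> F"
  shows "((\<lambda>h. P h x y) \<longlongrightarrow> of_bool (x = y)) (at_right 0)"
proof -
  have "((\<lambda>h. h * ((P h x y - of_bool (x = y)) / h) + of_bool (x = y)) \<longlongrightarrow> 0 * Q x y + of_bool (x = y)) (at_right 0)"
    by (intro tendsto_intros generator_tendsto assms)
  moreover have "\<forall>\<^sub>F h in at_right 0. h * ((P h x y - of_bool (x = y)) / h) + of_bool (x = y) = P h x y"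
    by (auto simp: eventually_at_right_field intro!: exI[of _ 1])
  ultimately show ?thesis by (simp add: tendsto_cong)
qed

text \<open>
  The second inequality is the first for the complementary event. Having lower bounds over finite sets for a
  function and for its complement lets the interchange of limits in \<open>resolvent_equation\<close> be done
  without any domination.
\<close>

lemma finite_sum_le_P_shift:
  assumes "0 \<le> h" "0 \<le> t" "x \<in> F" "y \<in> F" "finite A" "A \<subseteq> F"
  shows "(\<Sum>z\<in>A. P h x z * P t z y) \<le> P (h + t) x y"
    and "(\<Sum>z\<in>A. P h x z * (1 - P t z y)) \<le> 1 - P (h + t) x y"
proof -
  show "(\<Sum>z\<in>A. P h x z * P t z y) \<le> P (h + t) x y"
    using assms P_nonneg by (intro finite_sum_le_has_sum[OF chapman_kolmogorov]) auto
  have "((\<lambda>z. P h x z + - (P h x z * P t z y)) has_sum 1 + - P (h + t) x y) F"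
    using assms by (intro has_sum_add P_total) (auto simp: has_sum_uminus intro: chapman_kolmogorov)
  then have "((\<lambda>z. P h x z * (1 - P t z y)) has_sum 1 - P (h + t) x y) F"
    by (simp add: algebra_simps)
  then show "(\<Sum>z\<in>A. P h x z * (1 - P t z y)) \<le> 1 - P (h + t) x y"
    using assms by (rule_tac finite_sum_le_has_sum) (auto intro!: mult_nonneg_nonneg P_nonneg P_le_1 simp: le_diff_eq)
qed

lemma P_increment_le:
  assumes "0 \<le> h" "0 \<le> t" "x \<in> F" "y \<in> F"
  shows "\<bar>P (t + h) x y - P t x y\<bar> \<le> 1 - P h x x"
proof -
  have p: "0 \<le> P t x y" "P t x y \<le> 1" "P h x x \<le> 1"
    using assms P_nonneg P_le_1 by auto
  have "P h x x * P t x y \<le> P (t + h) x y" "P h x x * (1 - P t x y) \<le> 1 - P (t + h) x y"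
    using finite_sum_le_P_shift[of h t x y "{x}"] assms by (simp_all add: add.commute)
  moreover have "P t x y * (1 - P h x x) \<le> 1 - P h x x" "(1 - P t x y) * (1 - P h x x) \<le> 1 - P h x x"
    using p by (auto intro!: mult_left_le_one_le)
  ultimately show ?thesis by (auto simp: algebra_simps)
qed

lemma P_continuous:
  assumes "x \<in> F" "y \<in> F"
  shows "continuous_on {0..} (\<lambda>t. P t x y)"
  unfolding continuous_on_iff
proof (intro ballI allI impI)
  fix t e :: real assume t: "t \<in> {0..}" and e: "0 < e"
  have "\<forall>\<^sub>F h in at_right 0. dist (P h x x) 1 < e"
    using P_tendsto_0[of x x] assms e by (auto simp: tendsto_iff)
  then obtain d where d: "d > 0" "\<And>h. 0 < h \<Longrightarrow> h < d \<Longrightarrow> dist (P h x x) 1 < e"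
    by (auto simp: eventually_at_right_field)
  have "dist (P s x y) (P t x y) < e" if s: "s \<in> {0..}" "dist s t < d" for s
  proof (cases "s = t")
    case False
    define m where "m = min s t"
    define h where "h = \<bar>s - t\<bar>"
    have "\<bar>P (m + h) x y - P m x y\<bar> \<le> 1 - P h x x"
      using s t assms by (intro P_increment_le) (auto simp: m_def h_def)
    moreover have "1 - P h x x < e"
      using d(2)[of h] s False by (auto simp: h_def dist_real_def abs_if split: if_splits)
    moreover have "\<bar>P (m + h) x y - P m x y\<bar> = \<bar>P s x y - P t x y\<bar>"
      by (cases "s \<le> t") (auto simp: m_def h_def)
    ultimately show ?thesis by (simp add: dist_real_def)
  qed (use e in auto)
  then show "\<exists>d>0. \<forall>s\<in>{0..}. dist s t < d \<longrightarrow> dist (P s x y) (P t x y) < e"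
    using d(1) by blast
qed

lemma P_0:
  assumes "x \<in> F" "y \<in> F"
  shows "P 0 x y = of_bool (x = y)"
proof -
  have "((\<lambda>t. P t x y) \<longlongrightarrow> P 0 x y) (at 0 within {0..})"
    using P_continuous[OF assms] by (auto simp: continuous_on_def)
  then have "((\<lambda>t. P t x y) \<longlongrightarrow> P 0 x y) (at_right 0)"
    by (rule tendsto_within_subset) auto
  with P_tendsto_0[OF assms] show ?thesis
    by (intro tendsto_unique[of "at_right (0::real)"]) auto
qed

end

locale discounted_semigroup = generated_semigroup +
  fixes \<beta> :: real and y :: state
  assumes \<beta>: "0 < \<beta>" and y: "y \<in> F"
begin

abbreviation "u x \<equiv> resolvent \<beta> P x y"

lemma discount_integral:
  "set_integrable lborel {0..} (\<lambda>t. \<beta> * exp (- \<beta> * t))" "(LBINT t:{0..}. \<beta> * exp (- \<beta> * t)) = 1"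
proof -
  interpret D: prob_space "density lborel (exponential_density \<beta>)"
    using \<beta> by (rule prob_space_exponential_density)
  have "(\<integral>\<^sup>+t. ennreal (exponential_density \<beta> t) \<partial>lborel) = 1"
    using D.emeasure_space_1 by (simp add: emeasure_density)
  moreover have "exponential_density \<beta> t = indicator {0..} t *\<^sub>R (\<beta> * exp (- \<beta> * t))" for t
    by (simp add: exponential_density_def mult.commute split: split_indicator)
  ultimately have "has_bochner_integral lborel (\<lambda>t. indicator {0..} t *\<^sub>R (\<beta> * exp (- \<beta> * t))) 1"
    using \<beta> by (intro has_bochner_integral_nn_integral) (auto split: split_indicator)
  then show "set_integrable lborel {0..} (\<lambda>t. \<beta> * exp (- \<beta> * t))" "(LBINT t:{0..}. \<beta> * exp (- \<beta> * t)) = 1"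
    unfolding set_integrable_def set_lebesgue_integral_def has_bochner_integral_iff by blast+
qed

lemma set_integrable_discounted:
  fixes g :: "real \<Rightarrow> real"
  assumes "set_borel_measurable lborel {0..} g" "\<And>t. 0 \<le> t \<Longrightarrow> \<bar>g t\<bar> \<le> 1"
  shows "set_integrable lborel {0..} (\<lambda>t. \<beta> * exp (- \<beta> * t) * g t)"
proof (rule set_integrable_bound[OF discount_integral(1)])
  have "(\<lambda>t. \<beta> * exp (- \<beta> * t) * (indicator {0..} t *\<^sub>R g t)) \<in> borel_measurable lborel"
    using assms(1) unfolding set_borel_measurable_def by measurable
  then show "set_borel_measurable lborel {0..} (\<lambda>t. \<beta> * exp (- \<beta> * t) * g t)"
    unfolding set_borel_measurable_def by (simp add: ac_simps)
  show "AE t in lborel. t \<in> {0..} \<longrightarrow> norm (\<beta> * exp (- \<beta> * t) * g t) \<le> norm (\<beta> * exp (- \<beta> * t))"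
    using assms(2) \<beta> by (auto simp: abs_mult mult_le_cancel_left1 intro!: AE_I2)
qed

lemma P_shift_measurable:
  assumes "0 \<le> h" "x \<in> F"
  shows "set_borel_measurable lborel {0..} (\<lambda>t. P (h + t) x y)"
proof -
  have "continuous_on {0..} ((\<lambda>t. P t x y) \<circ> (\<lambda>t. h + t))"
    using assms y by (intro continuous_on_compose continuous_intros continuous_on_subset[OF P_continuous]) auto
  then show ?thesis
    using borel_measurable_continuous_on_indicator[of "{0..}" "\<lambda>t. P (h + t) x y"]
    by (simp add: set_borel_measurable_def o_def)
qed

lemma P_discounted_integrable:
  assumes "0 \<le> h" "x \<in> F"
  shows "set_integrable lborel {0..} (\<lambda>t. \<beta> * exp (- \<beta> * t) * P (h + t) x y)"
  using assms y P_nonneg P_le_1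
  by (intro set_integrable_discounted P_shift_measurable) (auto simp: abs_le_iff intro: order_trans[of _ 0])

lemma resolvent_nonneg: "x \<in> F \<Longrightarrow> 0 \<le> u x"
  unfolding resolvent_def set_lebesgue_integral_def
  using \<beta> y P_nonneg by (intro integral_nonneg_AE AE_I2) (auto split: split_indicator)

lemma resolvent_le_1: "x \<in> F \<Longrightarrow> u x \<le> 1"
proof -
  assume x: "x \<in> F"
  have "u x \<le> (LBINT t:{0..}. \<beta> * exp (- \<beta> * t))"
    unfolding resolvent_def
    using P_discounted_integrable[of 0 x] x y \<beta> P_le_1
    by (intro set_integral_mono discount_integral) (auto intro!: mult_left_le)
  then show "u x \<le> 1" by (simp only: discount_integral(2))
qed

lemma resolvent_pos:
  assumes x: "x \<in> F"
  shows "0 < u x"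
proof -
  obtain t where t: "t > 0" "P t x y > 0"
    using irreducible x y by (auto simp: irreducible_chain_def)
  have "isCont (\<lambda>t. P t x y) t"
    using P_continuous[OF x y] t by (intro continuous_on_interior[of "{0..}"]) auto
  then have "\<forall>\<^sub>F s in at t. P t x y / 2 < P s x y"
    using t by (intro order_tendstoD[of _ "P t x y"]) (auto simp: isCont_def)
  then obtain d where d: "d > 0" "\<And>s. s \<noteq> t \<Longrightarrow> dist s t < d \<Longrightarrow> P t x y / 2 < P s x y"
    by (auto simp: eventually_at)
  have low: "P t x y / 2 \<le> P s x y" if "s \<in> {t..t + d / 2}" for s
    using d(2)[of s] that t d(1) by (cases "s = t") (auto simp: dist_real_def)
  \<comment> \<open>Smallest value of the weight on the interval, times a lower bound for the transition probability.\<close>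
  define c where "c = \<beta> * exp (- \<beta> * (t + d / 2)) * (P t x y / 2)"
  have c: "0 < c" using t \<beta> by (simp add: c_def)
  have "0 < (LBINT s:{t..t + d / 2}. c)"
    using d c by (simp add: set_lebesgue_integral_def)
  also have "\<dots> \<le> u x"
    unfolding resolvent_def set_lebesgue_integral_def
  proof (rule integral_mono)
    show "integrable lborel (\<lambda>s. indicator {t..t + d / 2} s *\<^sub>R c)"
      by (intro integrable_scaleR_left integrable_real_indicator) (auto simp: emeasure_lborel_Icc_eq)
    show "integrable lborel (\<lambda>s. indicator {0..} s *\<^sub>R (\<beta> * exp (- \<beta> * s) * P s x y))"
      using P_discounted_integrable[of 0 x] x by (simp add: set_integrable_def)
    fix s
    have "c \<le> \<beta> * exp (- \<beta> * s) * P s x y" if "s \<in> {t..t + d / 2}"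
      unfolding c_def using that low[OF that] \<beta> t by (intro mult_mono) auto
    then show "indicator {t..t + d / 2} s *\<^sub>R c \<le> indicator {0..} s *\<^sub>R (\<beta> * exp (- \<beta> * s) * P s x y)"
      using t \<beta> x y P_nonneg[of s x y] by (auto split: split_indicator)
  qed
  finally show ?thesis .
qed

definition shifted :: "real \<Rightarrow> state \<Rightarrow> real" where
  "shifted h x = (LBINT t:{0..}. \<beta> * exp (- \<beta> * t) * P (h + t) x y)"

text \<open>
  The memoryless property of the exponential weight, $\int_0^\infty \beta e^{-\beta t} P^{(h + t)} dt =
  e^{\beta h} \int_h^\infty \beta e^{-\beta s} P^{(s)} ds$.
\<close>

lemma shifted_eq:
  assumes h: "0 \<le> h" and x: "x \<in> F"
  shows "shifted h x = exp (\<beta> * h) * (u x - integral {0..h} (\<lambda>s. \<beta> * exp (- \<beta> * s) * P s x y))"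
proof -
  let ?f = "\<lambda>s. \<beta> * exp (- \<beta> * s) * P s x y"
  have int: "set_integrable lborel {0..} ?f"
    using P_discounted_integrable[of 0 x] x by simp
  have un: "{0..h} \<union> {h..} = {0..}"
    using h by auto
  have e: "exp (\<beta> * h) * exp (- (\<beta> * (h + t))) = exp (- (\<beta> * t))" for t
    by (simp add: exp_add[symmetric] algebra_simps)
  have "shifted h x = (\<integral>t. indicator {h..} (h + 1 * t) *\<^sub>R (exp (\<beta> * h) * ?f (h + 1 * t)) \<partial>lborel)"
    unfolding shifted_def set_lebesgue_integral_def
    by (intro Bochner_Integration.integral_cong)
      (simp_all add: e split: split_indicator)
  also have "\<dots> = (LBINT s:{h..}. exp (\<beta> * h) * ?f s)"
    unfolding set_lebesgue_integral_def
    by (subst lborel_integral_real_affine[where c = 1 and t = h]) auto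
  also have "\<dots> = exp (\<beta> * h) * (LBINT s:{h..}. ?f s)"
    by simp
  also have "(LBINT s:{0..h} \<union> {h..}. ?f s) = (LBINT s:{0..h}. ?f s) + (LBINT s:{h..}. ?f s)"
  proof (rule set_integral_Un_AE)
    show "AE s in lborel. \<not> (s \<in> {0..h} \<and> s \<in> {h..})"
      using AE_lborel_singleton[of h] by eventually_elim auto
  qed (use h set_integrable_subset[OF int, of "{0..h}"] set_integrable_subset[OF int, of "{h..}"] in auto)
  then have "(LBINT s:{h..}. ?f s) = u x - (LBINT s:{0..h}. ?f s)"
    using un by (simp add: resolvent_def)
  also have "(LBINT s:{0..h}. ?f s) = integral {0..h} ?f"
    by (intro set_borel_integral_eq_integral set_integrable_subset[OF int]) auto
  finally show ?thesis .
qed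

lemma shifted_tendsto:
  assumes x: "x \<in> F"
  shows "((\<lambda>h. (shifted h x - u x) / h) \<longlongrightarrow> \<beta> * (u x - of_bool (x = y))) (at_right 0)"
proof -
  let ?f = "\<lambda>s. \<beta> * exp (- \<beta> * s) * P s x y"
  let ?D = "\<lambda>h. integral {0..h} ?f"
  have "(?D has_real_derivative ?f 0) (at 0 within {0..1})"
    by (intro integral_has_real_derivative continuous_intros continuous_on_subset[OF P_continuous[OF x y]]) auto
  then have "((\<lambda>h. ?D h / h) \<longlongrightarrow> ?f 0) (at 0 within {0..1})"
    by (simp add: has_field_derivative_iff)
  then have D: "((\<lambda>h. ?D h / h) \<longlongrightarrow> \<beta> * of_bool (x = y)) (at_right 0)"
    using P_0[OF x y] by (simp add: at_within_Icc_at_right)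
  have "((\<lambda>h. exp (\<beta> * h)) has_real_derivative \<beta>) (at 0 within {0..1})"
    by (auto intro!: derivative_eq_intros)
  then have e: "((\<lambda>h. (exp (\<beta> * h) - 1) / h) \<longlongrightarrow> \<beta>) (at_right 0)"
    by (simp add: has_field_derivative_iff at_within_Icc_at_right)
  have "((\<lambda>h. (exp (\<beta> * h) - 1) / h * u x - exp (\<beta> * h) * (?D h / h))
      \<longlongrightarrow> \<beta> * u x - exp (\<beta> * 0) * (\<beta> * of_bool (x = y))) (at_right 0)"
    by (intro tendsto_intros e D)
  moreover have "\<forall>\<^sub>F h in at_right 0. (exp (\<beta> * h) - 1) / h * u x - exp (\<beta> * h) * (?D h / h) = (shifted h x - u x) / h"
    using x by (auto simp: eventually_at_right_field shifted_eq field_simps intro!: exI[of _ 1])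
  ultimately show ?thesis
    by (simp add: tendsto_cong algebra_simps)
qed

lemma finite_sum_le_shifted:
  assumes "0 \<le> h" "x \<in> F" "finite A" "A \<subseteq> F"
  shows "(\<Sum>z\<in>A. P h x z * u z) \<le> shifted h x"
    and "(\<Sum>z\<in>A. P h x z * (1 - u z)) \<le> 1 - shifted h x"
proof -
  have int: "set_integrable lborel {0..} (\<lambda>t. \<beta> * exp (- \<beta> * t) * P t z y)" if "z \<in> F" for z
    using P_discounted_integrable[of 0 z] that by simp
  have sub: "z \<in> F" if "z \<in> A" for z using that assms by auto
  have "(\<Sum>z\<in>A. P h x z * u z) = (LBINT t:{0..}. (\<Sum>z\<in>A. P h x z * (\<beta> * exp (- \<beta> * t) * P t z y)))"
    unfolding resolvent_def
    using sub by (intro set_integral_linear_combination(2)[symmetric] int) auto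
  also have "\<dots> \<le> shifted h x"
    unfolding shifted_def
  proof (rule set_integral_mono)
    show "set_integrable lborel {0..} (\<lambda>t. \<Sum>z\<in>A. P h x z * (\<beta> * exp (- \<beta> * t) * P t z y))"
      using sub by (intro set_integral_linear_combination(1) int) auto
    show "set_integrable lborel {0..} (\<lambda>t. \<beta> * exp (- \<beta> * t) * P (h + t) x y)"
      using assms by (intro P_discounted_integrable)
    fix t :: real assume "t \<in> {0..}"
    then have "\<beta> * exp (- \<beta> * t) * (\<Sum>z\<in>A. P h x z * P t z y) \<le> \<beta> * exp (- \<beta> * t) * P (h + t) x y"
      using \<beta> assms y by (intro mult_left_mono finite_sum_le_P_shift) auto
    then show "(\<Sum>z\<in>A. P h x z * (\<beta> * exp (- \<beta> * t) * P t z y)) \<le> \<beta> * exp (- \<beta> * t) * P (h + t) x y"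
      by (simp add: sum_distrib_left mult_ac)
  qed
  finally show "(\<Sum>z\<in>A. P h x z * u z) \<le> shifted h x" .
  let ?e = "\<lambda>t. \<beta> * exp (- \<beta> * t)"
  have int1: "set_integrable lborel {0..} (\<lambda>t. ?e t - ?e t * P t z y)" if "z \<in> F" for z
    using int[OF that] discount_integral by (intro set_integral_diff)
  have "1 - u z = (LBINT t:{0..}. ?e t - ?e t * P t z y)" if "z \<in> F" for z
    unfolding resolvent_def using int[OF that] discount_integral by (subst set_integral_diff) auto
  then have "(\<Sum>z\<in>A. P h x z * (1 - u z)) = (\<Sum>z\<in>A. P h x z * (LBINT t:{0..}. ?e t - ?e t * P t z y))"
    using sub by auto
  also have "\<dots> = (LBINT t:{0..}. (\<Sum>z\<in>A. P h x z * (?e t - ?e t * P t z y)))"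
    using sub by (intro set_integral_linear_combination(2)[symmetric] int1) auto
  also have "\<dots> \<le> (LBINT t:{0..}. ?e t - ?e t * P (h + t) x y)"
  proof (rule set_integral_mono)
    show "set_integrable lborel {0..} (\<lambda>t. \<Sum>z\<in>A. P h x z * (?e t - ?e t * P t z y))"
      using sub by (intro set_integral_linear_combination(1) int1) auto
    show "set_integrable lborel {0..} (\<lambda>t. ?e t - ?e t * P (h + t) x y)"
      using assms by (intro set_integral_diff discount_integral P_discounted_integrable)
    fix t :: real assume "t \<in> {0..}"
    then have "?e t * (\<Sum>z\<in>A. P h x z * (1 - P t z y)) \<le> ?e t * (1 - P (h + t) x y)"
      using \<beta> assms y by (intro mult_left_mono finite_sum_le_P_shift) auto
    then show "(\<Sum>z\<in>A. P h x z * (?e t - ?e t * P t z y)) \<le> ?e t - ?e t * P (h + t) x y"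
      by (simp add: sum_distrib_left algebra_simps)
  qed
  also have "\<dots> = 1 - shifted h x"
    unfolding shifted_def using assms discount_integral P_discounted_integrable
    by (subst set_integral_diff) auto
  finally show "(\<Sum>z\<in>A. P h x z * (1 - u z)) \<le> 1 - shifted h x" .
qed

lemma generator_sum_tendsto:
  assumes "finite A" "A \<subseteq> F" "x \<in> A"
  shows "((\<lambda>h. ((\<Sum>z\<in>A. P h x z * g z) - g x) / h) \<longlongrightarrow> (\<Sum>z\<in>A. Q x z * g z)) (at_right 0)"
proof -
  have "((\<lambda>h. \<Sum>z\<in>A. (P h x z - of_bool (x = z)) / h * g z) \<longlongrightarrow> (\<Sum>z\<in>A. Q x z * g z)) (at_right 0)"
    using assms by (intro tendsto_intros generator_tendsto) auto
  also have "(\<lambda>h. \<Sum>z\<in>A. (P h x z - of_bool (x = z)) / h * g z) = (\<lambda>h. ((\<Sum>z\<in>A. P h x z * g z) - g x) / h)"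
  proof
    fix h
    have "(\<Sum>z\<in>A. of_bool (x = z) * g z) = g x"
      using assms by (simp add: sum.delta of_bool_def if_distrib[of "\<lambda>c. c * _"] cong: if_cong)
    then show "(\<Sum>z\<in>A. (P h x z - of_bool (x = z)) / h * g z) = ((\<Sum>z\<in>A. P h x z * g z) - g x) / h"
      by (simp add: sum_divide_distrib[symmetric] sum_subtractf[symmetric] algebra_simps flip: sum_divide_distrib)
        (simp add: sum_divide_distrib diff_divide_distrib sum_subtractf)
  qed
  finally show ?thesis .
qed

text \<open>
  Dividing the increment of \<open>shifted\<close> by $h$ and letting $h \to 0$ bounds every finite partial sum of
  $Q u$ that contains the diagonal term by $\beta (u - 1_y)$, and likewise every partial sum of $Q (1 - u)$ by
  $- \beta (u - 1_y)$. Since the rows of $Q$ add up to zero, the two bounds on the full sums meet.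
\<close>

lemma resolvent_equation:
  assumes x: "x \<in> F"
  shows "((\<lambda>z. Q x z * u z) has_sum \<beta> * (u x - of_bool (x = y))) F"
proof -
  let ?c = "\<beta> * (u x - of_bool (x = y))"
  have below: "(\<Sum>z\<in>A. Q x z * u z) \<le> ?c" and above: "(\<Sum>z\<in>A. Q x z * (1 - u z)) \<le> - ?c"
    if A: "finite A" "A \<subseteq> F" "x \<in> A" for A
  proof -
    show "(\<Sum>z\<in>A. Q x z * u z) \<le> ?c"
      using shifted_tendsto[OF x] generator_sum_tendsto[OF A, of u]
    proof (rule tendsto_le[rotated])
      show "\<forall>\<^sub>F h in at_right 0. ((\<Sum>z\<in>A. P h x z * u z) - u x) / h \<le> (shifted h x - u x) / h"
        using finite_sum_le_shifted(1)[of _ x A] A x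
        by (auto simp: eventually_at_right_field intro!: exI[of _ 1] divide_right_mono)
    qed simp
    show "(\<Sum>z\<in>A. Q x z * (1 - u z)) \<le> - ?c"
      using tendsto_minus[OF shifted_tendsto[OF x]] generator_sum_tendsto[OF A, of "\<lambda>z. 1 - u z"]
    proof (rule tendsto_le[rotated])
      show "\<forall>\<^sub>F h in at_right 0. ((\<Sum>z\<in>A. P h x z * (1 - u z)) - (1 - u x)) / h \<le> - ((shifted h x - u x) / h)"
        using eventually_at_right_less[of 0]
      proof eventually_elim
        case (elim h)
        then have "(\<Sum>z\<in>A. P h x z * (1 - u z)) - (1 - u x) \<le> - (shifted h x - u x)"
          using finite_sum_le_shifted(2)[of h x A] A x by simp
        then show ?case
          unfolding minus_divide_left using elim by (intro divide_right_mono) auto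
      qed
    qed simp
  qed
  have total: "(Q x has_sum 0) F"
    using conservative x by (simp add: conservative_def)
  then have "(\<lambda>z. norm (Q x z)) summable_on F"
    using summable_on_iff_abs_summable_on_real has_sum_imp_summable by blast
  then have "(\<lambda>z. norm (Q x z * u z)) summable_on F"
    by (rule Infinite_Sum.abs_summable_on_comparison_test)
      (use resolvent_nonneg resolvent_le_1 in \<open>auto simp: abs_mult intro!: mult_left_le\<close>)
  then have S: "((\<lambda>z. Q x z * u z) has_sum (\<Sum>\<^sub>\<infinity>z\<in>F. Q x z * u z)) F" (is "(_ has_sum ?S) _")
    by (rule has_sum_infsum[OF Infinite_Sum.abs_summable_summable])
  have ev: "\<forall>\<^sub>F A in finite_subsets_at_top F. finite A \<and> A \<subseteq> F \<and> x \<in> A"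
    using x by (auto simp: eventually_finite_subsets_at_top intro!: exI[of _ "{x}"])
  have "?S \<le> ?c"
    using S[unfolded has_sum_def]
    by (rule tendsto_upperbound) (use below ev in \<open>auto elim!: eventually_mono\<close>)
  moreover have "((\<lambda>z. Q x z + - (Q x z * u z)) has_sum 0 + - ?S) F"
    using total S by (intro has_sum_add) (simp_all add: has_sum_uminus)
  then have "((\<lambda>z. Q x z * (1 - u z)) has_sum - ?S) F"
    by (simp add: algebra_simps)
  then have "- ?S \<le> - ?c"
    unfolding has_sum_def
    by (rule tendsto_upperbound) (use above ev in \<open>auto elim!: eventually_mono\<close>)
  ultimately show ?thesis using S by simp
qed

end

text \<open>
  For an empty past the Markov property is the Chapman-Kolmogorov equation, once the states of zero probability
  at time $s$ are treated separately.
\<close>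

lemma markov_chain_imp_semigroup:
  assumes chain: "markov_chain F M Z"
  defines "P \<equiv> transition_function M Z"
  shows "\<lbrakk>0 \<le> t; x \<in> F; y \<in> F\<rbrakk> \<Longrightarrow> 0 \<le> P t x y"
    and "\<lbrakk>0 \<le> t; x \<in> F\<rbrakk> \<Longrightarrow> (P t x has_sum 1) F"
    and "\<lbrakk>0 \<le> s; 0 \<le> t; x \<in> F; z \<in> F\<rbrakk> \<Longrightarrow> ((\<lambda>y. P s x y * P t y z) has_sum P (s + t) x z) F"
proof -
  show nonneg: "0 \<le> P t x y" for t x y
    by (simp add: P_def transition_function_def)
  have split: "(\<integral>\<^sup>+y. emeasure (M x) {w \<in> space (M x). Z s w = y \<and> R w} \<partial>count_space F)
      = emeasure (M x) {w \<in> space (M x). R w}"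
    if "0 \<le> s" "x \<in> F" and R: "Measurable.pred (M x) R" for s x R
  proof -
    have meas: "Z s \<in> measurable (M x) (count_space F)"
      using chain that by (auto simp: markov_chain_def)
    have val: "Z s w \<in> F" if "w \<in> space (M x)" for w
      using measurable_space[OF meas that] by simp
    have "emeasure (M x) (\<Union>y\<in>F. {w \<in> space (M x). Z s w = y \<and> R w})
        = (\<integral>\<^sup>+y. emeasure (M x) {w \<in> space (M x). Z s w = y \<and> R w} \<partial>count_space F)"
    proof (rule emeasure_UN_countable)
      fix y assume "y \<in> F"
      then show "{w \<in> space (M x). Z s w = y \<and> R w} \<in> sets (M x)"
        using meas R by measurable
    qed (auto simp: disjoint_family_on_def)
    moreover have "(\<Union>y\<in>F. {w \<in> space (M x). Z s w = y \<and> R w}) = {w \<in> space (M x). R w}"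
      using val by auto
    ultimately show ?thesis by simp
  qed
  show "(P t x has_sum 1) F" if "0 \<le> t" "x \<in> F" for t x
  proof -
    interpret prob_space "M x" using chain that by (auto simp: markov_chain_def)
    have "(\<integral>\<^sup>+y. ennreal (P t x y) \<partial>count_space F) = 1"
      using split[OF that, of "\<lambda>_. True"]
      by (simp add: P_def transition_function_def emeasure_eq_measure prob_space)
    then show ?thesis
      using nonneg by (subst has_sum_iff_nn_integral) auto
  qed
  show "((\<lambda>y. P s x y * P t y z) has_sum P (s + t) x z) F"
    if st: "0 \<le> s" "0 \<le> t" and xz: "x \<in> F" "z \<in> F" for s t x z
  proof -
    interpret prob_space "M x" using chain xz by (auto simp: markov_chain_def)
    have meas: "Z r \<in> measurable (M x) (count_space F)" if "0 \<le> r" for r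
      using chain xz that by (auto simp: markov_chain_def)
    have joint: "\<P>(w in M x. Z s w = y \<and> Z (s + t) w = z) = P s x y * P t y z" if y: "y \<in> F" for y
    proof (cases "\<P>(w in M x. Z s w = y) > 0")
      case True
      have "\<P>(w in M x. Z (s + t) w = z \<bar> Z s w = y \<and> (\<forall>(r, c)\<in>set h. Z r w = c)) = P t y z"
        if "\<forall>(r, c)\<in>set h. 0 \<le> r \<and> r \<le> s"
          "\<P>(w in M x. Z s w = y \<and> (\<forall>(r, c)\<in>set h. Z r w = c)) > 0" for h
        using chain st xz y that unfolding markov_chain_def P_def by blast
      from this[of "[]"] have "\<P>(w in M x. Z (s + t) w = z \<bar> Z s w = y) = P t y z"
        using True by simp
      then show ?thesis
        using True by (simp add: cond_prob_def P_def transition_function_def field_simps conj_commute)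
    next
      case False
      then have zero: "\<P>(w in M x. Z s w = y) = 0"
        using measure_nonneg[of "M x" "{w \<in> space (M x). Z s w = y}"] by linarith
      have "\<P>(w in M x. Z s w = y \<and> Z (s + t) w = z) \<le> \<P>(w in M x. Z s w = y)"
        using meas[OF st(1)] y by (intro finite_measure_mono) (auto intro!: pred_sets1[of "count_space F"])
      with zero have "\<P>(w in M x. Z s w = y \<and> Z (s + t) w = z) = 0"
        by (simp add: order.antisym)
      then show ?thesis
        using zero by (simp add: P_def transition_function_def)
    qed
    have "{w \<in> space (M x). Z (s + t) w = z} = Z (s + t) -` {z} \<inter> space (M x)"
      by auto
    then have "Measurable.pred (M x) (\<lambda>w. Z (s + t) w = z)"
      using measurable_sets[OF meas[of "s + t"], of "{z}"] st xz by (simp add: pred_def)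
    then have "(\<integral>\<^sup>+y. ennreal (P s x y * P t y z) \<partial>count_space F) = ennreal (P (s + t) x z)"
      using split[OF st(1) xz(1), of "\<lambda>w. Z (s + t) w = z"]
      by (auto simp: joint emeasure_eq_measure P_def transition_function_def cong: nn_integral_cong_simp)
    then show ?thesis
      using nonneg by (subst has_sum_iff_nn_integral) auto
  qed
qed

section \<open>Potentials of nonnegative kernels\<close>

definition kernel_apply :: "('a \<Rightarrow> 'a \<Rightarrow> ennreal) \<Rightarrow> ('a \<Rightarrow> ennreal) \<Rightarrow> 'a \<Rightarrow> ennreal" where
  "kernel_apply k \<phi> x = (\<integral>\<^sup>+z. k x z * \<phi> z \<partial>count_space UNIV)"

definition potential :: "('a \<Rightarrow> 'a \<Rightarrow> ennreal) \<Rightarrow> ('a \<Rightarrow> ennreal) \<Rightarrow> 'a \<Rightarrow> ennreal" where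
  "potential k \<phi> x = (\<Sum>m. (kernel_apply k ^^ m) \<phi> x)"

definition pairing :: "('a \<Rightarrow> ennreal) \<Rightarrow> ('a \<Rightarrow> ennreal) \<Rightarrow> ennreal" where
  "pairing \<mu> \<phi> = (\<integral>\<^sup>+x. \<mu> x * \<phi> x \<partial>count_space UNIV)"

definition push :: "('a \<Rightarrow> 'a \<Rightarrow> ennreal) \<Rightarrow> ('a \<Rightarrow> ennreal) \<Rightarrow> 'a \<Rightarrow> ennreal" where
  "push k \<mu> z = (\<integral>\<^sup>+x. \<mu> x * k x z \<partial>count_space UNIV)"

lemma kernel_apply_mono: "(\<And>z. \<phi> z \<le> \<psi> z) \<Longrightarrow> kernel_apply k \<phi> x \<le> kernel_apply k \<psi> x"
  by (simp add: kernel_apply_def nn_integral_mono mult_left_mono)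

lemma pairing_add: "pairing (\<lambda>x. \<mu> x + \<nu> x) \<phi> = pairing \<mu> \<phi> + pairing \<nu> \<phi>"
  by (simp add: pairing_def distrib_right nn_integral_add)

lemma pairing_push:
  fixes k :: "'a :: countable \<Rightarrow> 'a \<Rightarrow> ennreal"
  shows "pairing (push k \<mu>) \<phi> = pairing \<mu> (kernel_apply k \<phi>)"
proof -
  have "pairing (push k \<mu>) \<phi> = (\<integral>\<^sup>+z. \<integral>\<^sup>+x. \<mu> x * k x z * \<phi> z \<partial>count_space UNIV \<partial>count_space UNIV)"
    unfolding pairing_def push_def by (intro nn_integral_cong nn_integral_multc[symmetric]) auto
  also have "\<dots> = (\<integral>\<^sup>+x. \<integral>\<^sup>+z. \<mu> x * k x z * \<phi> z \<partial>count_space UNIV \<partial>count_space UNIV)"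
    by (rule nn_integral_count_space_nn_integral) auto
  also have "\<dots> = pairing \<mu> (kernel_apply k \<phi>)"
    unfolding pairing_def kernel_apply_def mult.assoc by (intro nn_integral_cong nn_integral_cmult) auto
  finally show ?thesis .
qed

lemma pairing_push_power:
  fixes k :: "'a :: countable \<Rightarrow> 'a \<Rightarrow> ennreal"
  shows "pairing \<mu> ((kernel_apply k ^^ m) \<phi>) = pairing ((push k ^^ m) \<mu>) \<phi>"
proof (induction m arbitrary: \<mu>)
  case (Suc m)
  show ?case
    by (subst funpow_Suc_right) (simp add: pairing_push[symmetric] Suc.IH)
qed simp

lemma kernel_apply_sums: "kernel_apply k (\<lambda>z. \<Sum>m. \<phi> m z) x = (\<Sum>m. kernel_apply k (\<phi> m) x)"
  unfolding kernel_apply_def ennreal_suminf_cmult[symmetric] by (intro nn_integral_suminf) auto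

lemma pairing_sums: "pairing \<mu> (\<lambda>x. \<Sum>m. \<phi> m x) = (\<Sum>m. pairing \<mu> (\<phi> m))"
  unfolding pairing_def ennreal_suminf_cmult[symmetric] by (intro nn_integral_suminf) auto

lemma sums_pairing: "pairing (\<lambda>x. \<Sum>m. \<mu> m x) \<phi> = (\<Sum>m. pairing (\<mu> m) \<phi>)"
  unfolding pairing_def ennreal_suminf_multc[symmetric] by (intro nn_integral_suminf) auto

lemma potential_eq: "potential k \<phi> x = \<phi> x + kernel_apply k (potential k \<phi>) x"
proof -
  have "kernel_apply k (potential k \<phi>) x = (\<Sum>m. (kernel_apply k ^^ Suc m) \<phi> x)"
    by (simp add: kernel_apply_sums potential_def[abs_def])
  then show ?thesis
    using suminf_offset[of "\<lambda>m. (kernel_apply k ^^ m) \<phi> x" 1] by (simp add: potential_def add.commute)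
qed

lemma potential_partial_sum_Suc:
  "(\<Sum>m<Suc N. (kernel_apply k ^^ m) \<phi> x)
    = \<phi> x + kernel_apply k (\<lambda>z. \<Sum>m<N. (kernel_apply k ^^ m) \<phi> z) x"
proof -
  have "kernel_apply k (\<lambda>z. \<Sum>m<N. (kernel_apply k ^^ m) \<phi> z) x = (\<Sum>m<N. (kernel_apply k ^^ Suc m) \<phi> x)"
    by (simp add: kernel_apply_def sum_distrib_left nn_integral_sum)
  then show ?thesis
    by (simp add: sum.lessThan_Suc_shift del: sum.lessThan_Suc)
qed

text \<open>
  The partial sums of the potential are obtained from $0$ by iterating $w \mapsto \phi + k w$, so every
  supersolution stays above them.
\<close>

lemma potential_least:
  assumes "\<And>x. \<phi> x + kernel_apply k w x \<le> w x"
  shows "potential k \<phi> x \<le> w x"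
proof -
  have "(\<Sum>m<N. (kernel_apply k ^^ m) \<phi> x) \<le> w x" for N
  proof (induction N arbitrary: x)
    case (Suc N)
    have "(\<Sum>m<Suc N. (kernel_apply k ^^ m) \<phi> x) \<le> \<phi> x + kernel_apply k w x"
      unfolding potential_partial_sum_Suc
      by (intro add_left_mono kernel_apply_mono Suc.IH)
    also have "\<dots> \<le> w x" by (rule assms)
    finally show ?case .
  qed simp
  then show ?thesis
    by (simp add: potential_def suminf_le_const)
qed

lemma pairing_potential:
  fixes k :: "'a :: countable \<Rightarrow> 'a \<Rightarrow> ennreal"
  shows "pairing \<mu> (potential k \<phi>) = (\<Sum>m. pairing \<mu> ((kernel_apply k ^^ m) \<phi>))"
  by (simp add: pairing_sums potential_def[abs_def])

lemma pairing_occupation: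
  fixes k :: "'a :: countable \<Rightarrow> 'a \<Rightarrow> ennreal"
  shows "pairing \<mu> (potential k \<phi>) = pairing (\<lambda>z. \<Sum>m. (push k ^^ m) \<mu> z) \<phi>"
  by (simp add: pairing_potential pairing_push_power sums_pairing)

text \<open>
  The measure $\nu = \sum_m \mu_0 k^m$ always lies below $\mu$, because $\mu - \nu$ is what is left of $\mu$ after
  infinitely many steps. Along the functions $k^j \kappa$ the two measures have the same finite integral, so
  they coincide wherever one of these functions is positive, that is wherever the potential of $\kappa$ does
  not vanish.
\<close>

lemma invariant_measure_eq_occupation:
  fixes k :: "'a :: countable \<Rightarrow> 'a \<Rightarrow> ennreal"
  assumes invariant: "\<And>z. \<mu> z = \<mu>\<^sub>0 z + push k \<mu> z"
    and mass: "pairing \<mu> \<kappa> = pairing \<mu>\<^sub>0 (potential k \<kappa>)" "pairing \<mu> \<kappa> < \<infinity>"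
    and recurrent: "\<And>z. \<mu> z \<noteq> 0 \<Longrightarrow> potential k \<kappa> z \<noteq> 0"
  shows "pairing \<mu> \<phi> = pairing \<mu>\<^sub>0 (potential k \<phi>)"
proof -
  define \<nu> where "\<nu> z = (\<Sum>m. (push k ^^ m) \<mu>\<^sub>0 z)" for z
  have step: "pairing \<mu> \<psi> = pairing \<mu>\<^sub>0 \<psi> + pairing \<mu> (kernel_apply k \<psi>)" for \<psi>
    using pairing_add[of \<mu>\<^sub>0 "push k \<mu>" \<psi>] by (simp add: pairing_push invariant[symmetric])
  have iterate: "pairing \<mu> \<psi> = (\<Sum>m<N. pairing \<mu>\<^sub>0 ((kernel_apply k ^^ m) \<psi>)) + pairing \<mu> ((kernel_apply k ^^ N) \<psi>)" for N \<psi>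
  proof (induction N)
    case (Suc N)
    then show ?case
      using step[of "(kernel_apply k ^^ N) \<psi>"] by (simp add: add.assoc)
  qed simp
  have \<nu>: "pairing \<mu>\<^sub>0 (potential k \<psi>) = pairing \<nu> \<psi>" for \<psi>
    by (simp add: pairing_occupation \<nu>_def[abs_def])
  have ge: "pairing \<nu> \<psi> \<le> pairing \<mu> \<psi>" for \<psi>
    unfolding \<nu>[symmetric] pairing_potential
  proof (rule suminf_le_const)
    show "(\<Sum>m<N. pairing \<mu>\<^sub>0 ((kernel_apply k ^^ m) \<psi>)) \<le> pairing \<mu> \<psi>" for N
      by (subst iterate[where N = N and \<psi> = \<psi>]) simp
  qed simp
  have le: "\<nu> z \<le> \<mu> z" for z
  proof -
    have point: "pairing \<rho> (indicator {z}) = \<rho> z" for \<rho> :: "'a \<Rightarrow> ennreal"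
      unfolding pairing_def by (subst nn_integral_count_space'[of "{z}"]) auto
    show ?thesis using ge[of "indicator {z}"] by (simp add: point)
  qed
  have eq: "pairing \<mu> ((kernel_apply k ^^ j) \<kappa>) = pairing \<nu> ((kernel_apply k ^^ j) \<kappa>)"
    and fin: "pairing \<mu> ((kernel_apply k ^^ j) \<kappa>) < \<infinity>" for j
  proof -
    let ?s = "\<Sum>m<j. pairing \<mu>\<^sub>0 ((kernel_apply k ^^ m) \<kappa>)"
    have it: "pairing \<mu> \<kappa> = ?s + pairing \<mu> ((kernel_apply k ^^ j) \<kappa>)"
      by (rule iterate)
    have "pairing \<mu> \<kappa> = (\<Sum>m. pairing \<mu>\<^sub>0 ((kernel_apply k ^^ m) \<kappa>))"
      using mass(1) by (simp add: pairing_potential)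
    also have "\<dots> = (\<Sum>m. pairing \<mu>\<^sub>0 ((kernel_apply k ^^ (m + j)) \<kappa>)) + ?s"
      by (rule suminf_offset) auto
    also have "(\<Sum>m. pairing \<mu>\<^sub>0 ((kernel_apply k ^^ (m + j)) \<kappa>)) = pairing \<nu> ((kernel_apply k ^^ j) \<kappa>)"
      by (simp add: \<nu>[symmetric] pairing_potential funpow_add)
    finally have "?s + pairing \<mu> ((kernel_apply k ^^ j) \<kappa>) = ?s + pairing \<nu> ((kernel_apply k ^^ j) \<kappa>)"
      using it by (simp add: add.commute)
    moreover have "?s < \<infinity>"
      using mass(2) unfolding it by (auto simp: less_top[symmetric])
    ultimately show "pairing \<mu> ((kernel_apply k ^^ j) \<kappa>) = pairing \<nu> ((kernel_apply k ^^ j) \<kappa>)"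
      by (metis ennreal_add_left_cancel less_irrefl)
    show "pairing \<mu> ((kernel_apply k ^^ j) \<kappa>) < \<infinity>"
      using mass(2) unfolding it by (auto simp: less_top[symmetric])
  qed
  have "\<mu> z = \<nu> z" for z
  proof (cases "\<mu> z = 0")
    case False
    have "\<exists>j. (kernel_apply k ^^ j) \<kappa> z \<noteq> 0"
    proof (rule ccontr)
      assume "\<not> ?thesis"
      then show False using recurrent[OF False] by (simp add: potential_def)
    qed
    then obtain j where j: "(kernel_apply k ^^ j) \<kappa> z \<noteq> 0" ..
    \<comment> \<open>Equal finite integrals of ordered measures leave no room where the integrand is positive.\<close>
    let ?\<psi> = "(kernel_apply k ^^ j) \<kappa>"
    have fin\<nu>: "pairing \<nu> ?\<psi> \<noteq> \<infinity>"
      using fin[of j] eq[of j] by simp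
    have "(\<integral>\<^sup>+x. \<mu> x * ?\<psi> x - \<nu> x * ?\<psi> x \<partial>count_space UNIV) = pairing \<mu> ?\<psi> - pairing \<nu> ?\<psi>"
      unfolding pairing_def using fin\<nu> le by (intro nn_integral_diff) (auto simp: pairing_def intro!: mult_right_mono)
    also have "\<dots> = 0" using fin\<nu> eq[of j] by simp
    finally have "\<mu> z * ?\<psi> z - \<nu> z * ?\<psi> z = 0"
      by (simp add: nn_integral_0_iff_AE AE_count_space)
    moreover have "\<mu> z * ?\<psi> z \<le> pairing \<mu> ?\<psi>"
      unfolding pairing_def by (rule nn_integral_ge_point) simp
    then have top: "\<mu> z * ?\<psi> z < \<infinity>"
      using fin[of j] by (rule le_less_trans)
    ultimately have "\<mu> z * ?\<psi> z \<le> \<nu> z * ?\<psi> z"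
      by (simp add: ennreal_minus_eq_0)
    then have "\<mu> z * ?\<psi> z = \<nu> z * ?\<psi> z"
      using mult_right_mono[OF le[of z]] by (intro antisym) auto
    moreover have "?\<psi> z \<noteq> \<infinity>"
      using top False by (auto simp: ennreal_mult_top)
    ultimately show ?thesis
      using j by (metis ennreal_mult_cancel_left infinity_ennreal_def mult.commute)
  qed (use le[of z] in simp)
  then have "\<mu> = \<nu>" by blast
  then show ?thesis by (simp add: \<nu>)
qed

section \<open>Hitting costs and the Poisson equation\<close>

locale conservative_rates =
  fixes F :: "'a :: countable set" and Q :: "'a \<Rightarrow> 'a \<Rightarrow> real"
  assumes off_diagonal: "\<lbrakk>x \<in> F; z \<in> F; x \<noteq> z\<rbrakk> \<Longrightarrow> 0 \<le> Q x z"
    and row_sum: "x \<in> F \<Longrightarrow> (Q x has_sum 0) F"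
begin

definition exit_rate :: "'a \<Rightarrow> real" where
  "exit_rate x = - Q x x"

lemma has_sum_off_diagonal:
  assumes "x \<in> F"
  shows "((\<lambda>z. Q x z * \<phi> z) has_sum s) F
    \<longleftrightarrow> ((\<lambda>z. Q x z * \<phi> z) has_sum (s + exit_rate x * \<phi> x)) (F - {x})"
proof -
  have "((\<lambda>z. Q x z * \<phi> z) has_sum s) (insert x (F - {x}))
    \<longleftrightarrow> ((\<lambda>z. Q x z * \<phi> z) has_sum (s + exit_rate x * \<phi> x)) (F - {x})"
  proof
    assume "((\<lambda>z. Q x z * \<phi> z) has_sum (s + exit_rate x * \<phi> x)) (F - {x})"
    from has_sum_insert[OF _ this, of x] show "((\<lambda>z. Q x z * \<phi> z) has_sum s) (insert x (F - {x}))"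
      by (simp add: exit_rate_def)
  next
    assume "((\<lambda>z. Q x z * \<phi> z) has_sum s) (insert x (F - {x}))"
    moreover have "((\<lambda>z. Q x z * \<phi> z) has_sum Q x x * \<phi> x) {x}"
      using has_sum_finite[of "{x}" "\<lambda>z. Q x z * \<phi> z"] by simp
    ultimately have "((\<lambda>z. Q x z * \<phi> z) has_sum (s - Q x x * \<phi> x)) (insert x (F - {x}) - {x})"
      by (rule has_sum_Diff) auto
    then show "((\<lambda>z. Q x z * \<phi> z) has_sum (s + exit_rate x * \<phi> x)) (F - {x})"
      by (simp add: exit_rate_def)
  qed
  then show ?thesis using assms by (simp add: insert_absorb)
qed

lemma exit_rate_has_sum: "x \<in> F \<Longrightarrow> (Q x has_sum exit_rate x) (F - {x})"
  using has_sum_off_diagonal[of x "\<lambda>_. 1" 0] row_sum by simp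

lemma exit_rate_nonneg: "x \<in> F \<Longrightarrow> 0 \<le> exit_rate x"
  using exit_rate_has_sum off_diagonal by (rule_tac has_sum_nonneg) auto

text \<open>
  Moving the diagonal entry, the only negative one, to the other side turns statements on $Q \phi$ into
  statements on an integral of a nonnegative function.
\<close>

lemma has_sum_iff_nn_integral_off_diagonal:
  assumes x: "x \<in> F" and \<phi>: "\<And>z. z \<in> F \<Longrightarrow> 0 \<le> \<phi> z" and s: "0 \<le> s + exit_rate x * \<phi> x"
  shows "((\<lambda>z. Q x z * \<phi> z) has_sum s) F
    \<longleftrightarrow> (\<integral>\<^sup>+z. ennreal (Q x z) * ennreal (\<phi> z) \<partial>count_space (F - {x})) = ennreal (s + exit_rate x * \<phi> x)"
proof -
  have "(\<integral>\<^sup>+z. ennreal (Q x z) * ennreal (\<phi> z) \<partial>count_space (F - {x}))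
      = (\<integral>\<^sup>+z. ennreal (Q x z * \<phi> z) \<partial>count_space (F - {x}))"
    using off_diagonal x \<phi> by (intro nn_integral_cong) (auto simp: ennreal_mult)
  then show ?thesis
    unfolding has_sum_off_diagonal[OF x]
    using off_diagonal x \<phi> s by (subst has_sum_iff_nn_integral) auto
qed

text \<open>
  Since $p$ is bounded and $W$ has finite sublevel sets, $p - \epsilon W$ attains a positive maximum as soon as
  it is positive somewhere. This happens off $y$, at a state where $Q (p - \epsilon W) = - \epsilon \, Q W > 0$,
  while $Q$ applied to a function is at most zero at a positive maximum.
\<close>

lemma maximum_principle:
  assumes p: "\<And>x. x \<in> F \<Longrightarrow> p x \<le> 1" "p y \<le> 0"
      "\<And>x. x \<in> F - {y} \<Longrightarrow> ((\<lambda>z. Q x z * p z) has_sum 0) F"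
    and W: "\<And>x. x \<in> F \<Longrightarrow> 0 \<le> W x" "\<And>c. finite {x \<in> F. W x \<le> c}"
      "\<And>x. x \<in> F - {y} \<Longrightarrow> (\<lambda>z. Q x z * W z) summable_on F"
      "\<And>x. x \<in> F - {y} \<Longrightarrow> (\<Sum>\<^sub>\<infinity>z\<in>F. Q x z * W z) < 0"
    and x: "x \<in> F"
  shows "p x \<le> 0"
proof (rule ccontr)
  assume "\<not> p x \<le> 0"
  then have px: "0 < p x" by simp
  \<comment> \<open>Small enough for the penalty at the given state to stay below half of its value there.\<close>
  define \<epsilon> where "\<epsilon> = p x / (2 * (W x + 1))"
  have \<epsilon>: "0 < \<epsilon>" using px W(1)[OF x] by (simp add: \<epsilon>_def)
  have "\<epsilon> * W x \<le> \<epsilon> * (W x + 1)" using \<epsilon> by simp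
  also have "\<epsilon> * (W x + 1) = p x / 2" using W(1)[OF x] by (simp add: \<epsilon>_def field_simps)
  finally have gap: "0 < p x - \<epsilon> * W x" using px by simp
  define d where "d z = p z - \<epsilon> * W z" for z
  have fin: "finite {z \<in> F. 0 < d z}"
  proof (rule finite_subset[OF _ W(2)[of "1 / \<epsilon>"]])
    show "{z \<in> F. 0 < d z} \<subseteq> {z \<in> F. W z \<le> 1 / \<epsilon>}"
      using p(1) \<epsilon> by (auto simp: d_def field_simps) (smt (verit))
  qed
  have ne: "x \<in> {z \<in> F. 0 < d z}" using gap x by (simp add: d_def)
  obtain m where m: "m \<in> {z \<in> F. 0 < d z}" "\<And>z. z \<in> {z \<in> F. 0 < d z} \<Longrightarrow> d z \<le> d m"
  proof -
    have "Max (d ` {z \<in> F. 0 < d z}) \<in> d ` {z \<in> F. 0 < d z}"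
      using fin ne by (intro Max_in) auto
    then obtain m where m: "m \<in> {z \<in> F. 0 < d z}" "d m = Max (d ` {z \<in> F. 0 < d z})"
      by (metis (no_types, lifting) imageE)
    show ?thesis
      by (rule that[OF m(1)]) (use fin m(2) in auto)
  qed
  have max: "d z \<le> d m" if "z \<in> F" for z
    using m that by (cases "0 < d z") auto
  have "m \<noteq> y"
    using m(1) p(2) W(1)[of m] \<epsilon> by (auto simp: d_def) (smt (verit) mult_nonneg_nonneg)
  then have mF: "m \<in> F - {y}" "m \<in> F" using m by auto
  have "((\<lambda>z. \<epsilon> * (Q m z * W z) + d m * Q m z + - (Q m z * p z)) has_sum
      \<epsilon> * (\<Sum>\<^sub>\<infinity>z\<in>F. Q m z * W z) + d m * 0 + - 0) F"
    using mF by (intro has_sum_add has_sum_cmult_right has_sum_infsum W(3) row_sum) (auto simp: has_sum_uminus p(3))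
  then have "((\<lambda>z. Q m z * (d m - d z)) has_sum \<epsilon> * (\<Sum>\<^sub>\<infinity>z\<in>F. Q m z * W z)) F"
    by (simp add: d_def algebra_simps)
  then have "0 \<le> \<epsilon> * (\<Sum>\<^sub>\<infinity>z\<in>F. Q m z * W z)"
  proof (rule has_sum_nonneg)
    fix z assume "z \<in> F"
    then show "0 \<le> Q m z * (d m - d z)"
      using max off_diagonal[of m z] mF by (cases "z = m") auto
  qed
  moreover have "\<epsilon> * (\<Sum>\<^sub>\<infinity>z\<in>F. Q m z * W z) < 0"
    using W(4)[OF mF(1)] \<epsilon> by (simp add: mult_pos_neg)
  ultimately show False by simp
qed

end

locale rates_killed_at = conservative_rates +
  fixes y :: 'a
  assumes y: "y \<in> F" and exit_rate_pos: "x \<in> F - {y} \<Longrightarrow> 0 < exit_rate x"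
begin

definition jump_kernel :: "'a \<Rightarrow> 'a \<Rightarrow> ennreal" where
  "jump_kernel x z = (if x \<in> F - {y} \<and> z \<in> F - {y} - {x} then ennreal (Q x z / exit_rate x) else 0)"

text \<open>
  The cost expected during one visit, the mean length of which is the inverse of the exit rate.
\<close>

definition sojourn :: "('a \<Rightarrow> real) \<Rightarrow> 'a \<Rightarrow> ennreal" where
  "sojourn g x = (if x \<in> F - {y} then ennreal (g x / exit_rate x) else 0)"

text \<open>
  The expected cost, at rate $g$, before the minimal chain with rates $Q$ enters $y$: a sum over the steps of
  the embedded jump chain killed at $y$. It is zero at $y$.
\<close>

definition hitting_cost :: "('a \<Rightarrow> real) \<Rightarrow> 'a \<Rightarrow> ennreal" where
  "hitting_cost g = potential jump_kernel (sojourn g)"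

lemma hitting_cost_eq: "hitting_cost g x = sojourn g x + kernel_apply jump_kernel (hitting_cost g) x"
  unfolding hitting_cost_def by (rule potential_eq)

lemma hitting_cost_killed: "x \<notin> F - {y} \<Longrightarrow> hitting_cost g x = 0"
  by (subst hitting_cost_eq) (auto simp: sojourn_def jump_kernel_def kernel_apply_def)

lemma kernel_apply_jump_kernel:
  assumes x: "x \<in> F - {y}"
  shows "kernel_apply jump_kernel \<phi> x
    = ennreal (1 / exit_rate x) * (\<integral>\<^sup>+z. ennreal (Q x z) * \<phi> z \<partial>count_space (F - {y} - {x}))"
proof -
  have "kernel_apply jump_kernel \<phi> x
      = (\<integral>\<^sup>+z. ennreal (1 / exit_rate x) * (ennreal (Q x z) * \<phi> z) * indicator (F - {y} - {x}) z \<partial>count_space UNIV)"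
    unfolding kernel_apply_def
  proof (rule nn_integral_cong)
    fix z
    show "jump_kernel x z * \<phi> z = ennreal (1 / exit_rate x) * (ennreal (Q x z) * \<phi> z) * indicator (F - {y} - {x}) z"
    proof (cases "z \<in> F - {y} - {x}")
      case True
      then have "ennreal (Q x z / exit_rate x) = ennreal (1 / exit_rate x) * ennreal (Q x z)"
        using x exit_rate_pos[OF x] off_diagonal[of x z] by (subst ennreal_mult[symmetric]) auto
      then show ?thesis using True x by (simp add: jump_kernel_def mult.assoc)
    qed (use x in \<open>auto simp: jump_kernel_def\<close>)
  qed
  also have "\<dots> = (\<integral>\<^sup>+z. ennreal (1 / exit_rate x) * (ennreal (Q x z) * \<phi> z) \<partial>count_space (F - {y} - {x}))"
    by (simp add: nn_integral_count_space_indicator)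
  also have "\<dots> = ennreal (1 / exit_rate x) * (\<integral>\<^sup>+z. ennreal (Q x z) * \<phi> z \<partial>count_space (F - {y} - {x}))"
    by (intro nn_integral_cmult) auto
  finally show ?thesis .
qed

lemma hitting_cost_le:
  assumes g: "\<And>x. x \<in> F - {y} \<Longrightarrow> 0 \<le> g x" and w: "\<And>x. x \<in> F \<Longrightarrow> 0 \<le> w x"
    and drift: "\<And>x. x \<in> F - {y} \<Longrightarrow> (\<lambda>z. Q x z * w z) summable_on F"
      "\<And>x. x \<in> F - {y} \<Longrightarrow> (\<Sum>\<^sub>\<infinity>z\<in>F. Q x z * w z) \<le> - g x"
  shows "hitting_cost g x \<le> ennreal (w x)"
proof -
  define w' where "w' x = (if x \<in> F - {y} then ennreal (w x) else 0)" for x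
  have "hitting_cost g x \<le> w' x"
    unfolding hitting_cost_def
  proof (rule potential_least)
    fix x show "sojourn g x + kernel_apply jump_kernel w' x \<le> w' x"
    proof (cases "x \<in> F - {y}")
      case x: True
      note q = exit_rate_pos[OF x]
      let ?s = "\<Sum>\<^sub>\<infinity>z\<in>F. Q x z * w z"
      have s: "((\<lambda>z. Q x z * w z) has_sum ?s) F"
        using drift(1)[OF x] by (rule has_sum_infsum)
      have s0: "0 \<le> ?s + exit_rate x * w x"
        using x off_diagonal w by (intro has_sum_nonneg[OF iffD1[OF has_sum_off_diagonal s]]) auto
      have "(\<integral>\<^sup>+z. ennreal (Q x z) * w' z \<partial>count_space (F - {y} - {x}))
          = (\<integral>\<^sup>+z. ennreal (Q x z) * w' z * indicator (F - {y} - {x}) z \<partial>count_space UNIV)"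
        by (simp add: nn_integral_count_space_indicator)
      also have "\<dots> \<le> (\<integral>\<^sup>+z. ennreal (Q x z) * ennreal (w z) * indicator (F - {x}) z \<partial>count_space UNIV)"
        by (intro nn_integral_mono) (auto simp: w'_def split: split_indicator)
      also have "\<dots> = (\<integral>\<^sup>+z. ennreal (Q x z) * ennreal (w z) \<partial>count_space (F - {x}))"
        by (simp add: nn_integral_count_space_indicator)
      also have "\<dots> = ennreal (?s + exit_rate x * w x)"
        using has_sum_iff_nn_integral_off_diagonal[of x w ?s] w s0 s x by auto
      finally have "kernel_apply jump_kernel w' x \<le> ennreal (1 / exit_rate x) * ennreal (?s + exit_rate x * w x)"
        unfolding kernel_apply_jump_kernel[OF x] by (rule mult_left_mono) simp
      also have "\<dots> = ennreal ((?s + exit_rate x * w x) / exit_rate x)"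
        using s0 q by (simp add: ennreal_mult[symmetric])
      finally have "sojourn g x + kernel_apply jump_kernel w' x
          \<le> ennreal (g x / exit_rate x) + ennreal ((?s + exit_rate x * w x) / exit_rate x)"
        using x by (simp add: sojourn_def add_left_mono)
      also have "\<dots> = ennreal (g x / exit_rate x + (?s + exit_rate x * w x) / exit_rate x)"
        using g[OF x] q s0 by simp
      also have "\<dots> \<le> ennreal (w x)"
        using drift(2)[OF x] q by (intro ennreal_leI) (simp add: field_simps)
      finally show ?thesis using x by (simp add: w'_def)
    next
      case False
      then show ?thesis by (auto simp: sojourn_def w'_def kernel_apply_def jump_kernel_def)
    qed
  qed
  also have "w' x \<le> ennreal (w x)" by (simp add: w'_def)
  finally show ?thesis .
qed

lemma hitting_cost_has_sum:
  assumes g: "\<And>x. x \<in> F - {y} \<Longrightarrow> 0 \<le> g x" and finite: "\<And>x. hitting_cost g x < \<infinity>" and x: "x \<in> F - {y}"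
  shows "((\<lambda>z. Q x z * enn2real (hitting_cost g z)) has_sum - g x) F"
proof -
  let ?H = "\<lambda>z. enn2real (hitting_cost g z)"
  note q = exit_rate_pos[OF x]
  have H: "ennreal (?H z) = hitting_cost g z" for z using finite[of z] by simp
  let ?I = "\<integral>\<^sup>+z. ennreal (Q x z) * ennreal (?H z) \<partial>count_space (F - {x})"
  have "(\<integral>\<^sup>+z. ennreal (Q x z) * hitting_cost g z \<partial>count_space (F - {y} - {x})) = ?I"
    unfolding H by (intro nn_integral_count_space_eq) (auto simp: hitting_cost_killed)
  then have eq: "ennreal (?H x) = ennreal (g x / exit_rate x) + ennreal (1 / exit_rate x) * ?I"
    unfolding H using hitting_cost_eq[of g x] x by (simp add: sojourn_def kernel_apply_jump_kernel)
  have "?I < \<infinity>"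
  proof (rule ccontr)
    assume "\<not> ?I < \<infinity>"
    then have "?I = \<infinity>" by (metis infinity_ennreal_def top.not_eq_extremum)
    then show False using eq q by (simp add: ennreal_mult_top)
  qed
  then obtain i where i: "0 \<le> i" "?I = ennreal i" by (cases ?I) auto
  have "ennreal (?H x) = ennreal ((g x + i) / exit_rate x)"
    using eq i q g[OF x] by (simp add: ennreal_mult[symmetric] ennreal_plus[symmetric] add_divide_distrib del: ennreal_plus)
  then have "?H x = (g x + i) / exit_rate x"
    using i q g[OF x] by (subst (asm) ennreal_inj) auto
  then have "i = - g x + exit_rate x * ?H x" using q by (simp add: field_simps)
  then show ?thesis
    using i x by (subst has_sum_iff_nn_integral_off_diagonal) auto
qed

text \<open>
  With cost rate $Q(x; y)$ the hitting cost is the probability $r$ that $y$ is entered after finitely many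
  jumps. The function that is $1 - r$ off $y$ and $0$ at $y$ is bounded and satisfies $Q p = 0$ off $y$, and the
  maximum principle makes it vanish. Without $W$ this may fail: an explosive chain can escape from $y$ in finite
  time.
\<close>

lemma absorption:
  assumes W: "\<And>x. x \<in> F \<Longrightarrow> 0 \<le> W x" "\<And>c. finite {x \<in> F. W x \<le> c}"
      "\<And>x. x \<in> F - {y} \<Longrightarrow> (\<lambda>z. Q x z * W z) summable_on F"
      "\<And>x. x \<in> F - {y} \<Longrightarrow> (\<Sum>\<^sub>\<infinity>z\<in>F. Q x z * W z) < 0"
    and x: "x \<in> F - {y}"
  shows "hitting_cost (\<lambda>x. Q x y) x = 1"
proof -
  let ?g = "\<lambda>x. Q x y"
  have g: "0 \<le> ?g x" if "x \<in> F - {y}" for x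
    using off_diagonal[of x y] that y by auto
  have single: "((\<lambda>z. Q x z * of_bool (z = y)) has_sum Q x y) F" for x
    using y by (intro has_sum_finite_neutralI[of "{y}"]) auto
  have le: "hitting_cost ?g z \<le> ennreal (1 - of_bool (z = y))" for z
  proof (rule hitting_cost_le)
    fix x assume x: "x \<in> F - {y}"
    have "((\<lambda>z. Q x z + - (Q x z * of_bool (z = y))) has_sum 0 + - Q x y) F"
      using x by (intro has_sum_add row_sum) (auto simp: has_sum_uminus single)
    then have s: "((\<lambda>z. Q x z * (1 - of_bool (z = y))) has_sum - Q x y) F"
      by (simp add: algebra_simps)
    then show "(\<lambda>z. Q x z * (1 - of_bool (z = y))) summable_on F" "(\<Sum>\<^sub>\<infinity>z\<in>F. Q x z * (1 - of_bool (z = y))) \<le> - Q x y"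
      by (auto simp: has_sum_imp_summable infsumI)
  qed (use g in auto)
  have fin: "hitting_cost ?g z < \<infinity>" for z
    using le[of z] by (rule le_less_trans) simp
  \<comment> \<open>The probability of never entering the killed state, set to zero at that state itself.\<close>
  define p where "p z = 1 - of_bool (z = y) - enn2real (hitting_cost ?g z)" for z
  have "p x \<le> 0"
  proof (rule maximum_principle[of p y W])
    show "p y \<le> 0" by (simp add: p_def)
    show "p z \<le> 1" for z
      using hitting_cost_killed[of y] by (simp add: p_def of_bool_def)
    fix x assume x: "x \<in> F - {y}"
    have "((\<lambda>z. Q x z + - (Q x z * of_bool (z = y)) + - (Q x z * enn2real (hitting_cost ?g z)))
        has_sum 0 + - Q x y + - (- Q x y)) F"
      using x hitting_cost_has_sum[OF g fin x]
      by (intro has_sum_add row_sum) (auto simp: has_sum_uminus single)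
    then show "((\<lambda>z. Q x z * p z) has_sum 0) F"
      by (simp add: p_def algebra_simps)
  next
    show "x \<in> F" using x by simp
  qed (fact W)+
  then have "1 \<le> enn2real (hitting_cost ?g x)" using x by (simp add: p_def)
  then have "1 \<le> hitting_cost ?g x"
    using fin[of x] ennreal_leI[of 1 "enn2real (hitting_cost ?g x)"] by simp
  moreover have "hitting_cost ?g x \<le> 1" using le[of x] x by simp
  ultimately show ?thesis by simp
qed

text \<open>
  The balance equations say that $\mu(z) = \pi(z) q(z)$, with $q(z)$ the exit rate, is invariant under the
  embedded jump chain off $y$ with source $\pi(y) Q(y; z)$. The mass $\pi(y) q(y)$ that leaves $y$ equals the mass
  that returns to it, and with certain absorption this is what \<open>invariant_measure_eq_occupation\<close>
  requires.
\<close>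

lemma kac_formula:
  assumes \<pi>: "\<And>z. z \<in> F \<Longrightarrow> 0 \<le> \<pi> z" "\<And>z. z \<in> F \<Longrightarrow> ((\<lambda>x. \<pi> x * Q x z) has_sum 0) F"
    and absorbed: "\<And>x. x \<in> F - {y} \<Longrightarrow> hitting_cost (\<lambda>x. Q x y) x = 1"
    and g: "\<And>z. z \<in> F \<Longrightarrow> 0 \<le> g z"
  shows "(\<integral>\<^sup>+z. ennreal (\<pi> z * g z) \<partial>count_space F)
    = ennreal (\<pi> y) * (ennreal (g y) + (\<integral>\<^sup>+z. ennreal (Q y z) * hitting_cost g z \<partial>count_space (F - {y})))"
proof -
  define \<mu> where "\<mu> z = (if z \<in> F - {y} then ennreal (\<pi> z * exit_rate z) else 0)" for z
  define \<mu>\<^sub>0 where "\<mu>\<^sub>0 z = (if z \<in> F - {y} then ennreal (\<pi> y * Q y z) else 0)" for z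
  have q: "0 < exit_rate x" if "x \<in> F - {y}" for x using exit_rate_pos[OF that] .
  have inflow: "(\<integral>\<^sup>+x. ennreal (\<pi> x * Q x z) \<partial>count_space (F - {z})) = ennreal (\<pi> z * exit_rate z)" if z: "z \<in> F" for z
  proof -
    have "((\<lambda>x. \<pi> x * Q x z) has_sum \<pi> z * Q z z) {z}"
      using has_sum_finite[of "{z}" "\<lambda>x. \<pi> x * Q x z"] by simp
    then have "((\<lambda>x. \<pi> x * Q x z) has_sum 0 - \<pi> z * Q z z) (F - {z})"
      using z by (intro has_sum_Diff \<pi>(2)) auto
    then have "((\<lambda>x. \<pi> x * Q x z) has_sum \<pi> z * exit_rate z) (F - {z})"
      by (simp add: exit_rate_def)
    then show ?thesis
      using z \<pi>(1) off_diagonal exit_rate_nonneg by (subst (asm) has_sum_iff_nn_integral) auto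
  qed
  have flow: "\<mu> x * jump_kernel x z = ennreal (\<pi> x * Q x z) * indicator (F - {z} - {y}) x" if z: "z \<in> F - {y}" for x z
  proof (cases "x \<in> F - {z} - {y}")
    case True
    then have "0 < exit_rate x" "0 \<le> \<pi> x" "0 \<le> Q x z" using q[of x] \<pi>(1) off_diagonal z by auto
    then have "ennreal (\<pi> x * exit_rate x) * ennreal (Q x z / exit_rate x) = ennreal (\<pi> x * Q x z)"
      by (simp add: ennreal_mult[symmetric])
    then show ?thesis using True z by (auto simp: \<mu>_def jump_kernel_def)
  qed (use z in \<open>auto simp: \<mu>_def jump_kernel_def\<close>)
  have invariant: "\<mu> z = \<mu>\<^sub>0 z + push jump_kernel \<mu> z" for z
  proof (cases "z \<in> F - {y}")
    case z: True
    have "push jump_kernel \<mu> z = (\<integral>\<^sup>+x. ennreal (\<pi> x * Q x z) * indicator (F - {z} - {y}) x \<partial>count_space UNIV)"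
      by (simp add: push_def flow[OF z])
    then have "\<mu>\<^sub>0 z + push jump_kernel \<mu> z
        = (\<integral>\<^sup>+x. \<mu>\<^sub>0 z * indicator {y} x \<partial>count_space UNIV)
          + (\<integral>\<^sup>+x. ennreal (\<pi> x * Q x z) * indicator (F - {z} - {y}) x \<partial>count_space UNIV)"
      by (subst nn_integral_count_space'[of "{y}"]) auto
    also have "\<dots> = (\<integral>\<^sup>+x. \<mu>\<^sub>0 z * indicator {y} x + ennreal (\<pi> x * Q x z) * indicator (F - {z} - {y}) x \<partial>count_space UNIV)"
      by (intro nn_integral_add[symmetric]) auto
    also have "\<dots> = (\<integral>\<^sup>+x. ennreal (\<pi> x * Q x z) * indicator (F - {z}) x \<partial>count_space UNIV)"
      using z y by (intro nn_integral_cong) (auto simp: \<mu>\<^sub>0_def split: split_indicator)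
    also have "\<dots> = \<mu> z"
      using inflow[of z] z by (simp add: nn_integral_count_space_indicator \<mu>_def)
    finally show ?thesis by simp
  next
    case False
    then have "jump_kernel x z = 0" for x by (auto simp: jump_kernel_def)
    with False show ?thesis by (auto simp: \<mu>_def \<mu>\<^sub>0_def push_def)
  qed
  have pair\<mu>: "pairing \<mu> (sojourn h) = (\<integral>\<^sup>+z. ennreal (\<pi> z * h z) \<partial>count_space (F - {y}))"
    if h: "\<And>z. z \<in> F - {y} \<Longrightarrow> 0 \<le> h z" for h
  proof -
    have "\<mu> z * sojourn h z = ennreal (\<pi> z * h z) * indicator (F - {y}) z" for z
    proof (cases "z \<in> F - {y}")
      case True
      then show ?thesis using q[OF True] h \<pi>(1) by (auto simp: \<mu>_def sojourn_def ennreal_mult[symmetric])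
    qed (auto simp: \<mu>_def sojourn_def)
    then show ?thesis by (simp add: pairing_def nn_integral_count_space_indicator)
  qed
  have pair\<mu>\<^sub>0: "pairing \<mu>\<^sub>0 \<phi> = ennreal (\<pi> y) * (\<integral>\<^sup>+z. ennreal (Q y z) * \<phi> z \<partial>count_space (F - {y}))" for \<phi>
  proof -
    have "\<mu>\<^sub>0 z * \<phi> z = ennreal (\<pi> y) * (ennreal (Q y z) * \<phi> z) * indicator (F - {y}) z" for z
      using \<pi>(1)[OF y] off_diagonal[of y z] y
      by (auto simp: \<mu>\<^sub>0_def ennreal_mult mult.assoc split: split_indicator)
    then have "pairing \<mu>\<^sub>0 \<phi> = (\<integral>\<^sup>+z. ennreal (\<pi> y) * (ennreal (Q y z) * \<phi> z) \<partial>count_space (F - {y}))"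
      by (simp add: pairing_def nn_integral_count_space_indicator)
    then show ?thesis by (simp add: nn_integral_cmult)
  qed
  have main: "pairing \<mu> \<phi> = pairing \<mu>\<^sub>0 (potential jump_kernel \<phi>)" for \<phi>
  proof (rule invariant_measure_eq_occupation[OF invariant])
    let ?\<kappa> = "sojourn (\<lambda>x. Q x y)"
    have \<kappa>: "pairing \<mu> ?\<kappa> = ennreal (\<pi> y * exit_rate y)"
      using inflow[OF y] y by (subst pair\<mu>) (auto simp: off_diagonal)
    have "(\<integral>\<^sup>+z. ennreal (Q y z) * potential jump_kernel ?\<kappa> z \<partial>count_space (F - {y}))
        = (\<integral>\<^sup>+z. ennreal (Q y z) \<partial>count_space (F - {y}))"
      using absorbed by (intro nn_integral_cong) (auto simp: hitting_cost_def)
    also have "\<dots> = ennreal (exit_rate y)"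
      using exit_rate_has_sum[OF y] off_diagonal exit_rate_nonneg y
      by (subst (asm) has_sum_iff_nn_integral) auto
    finally show "pairing \<mu> ?\<kappa> = pairing \<mu>\<^sub>0 (potential jump_kernel ?\<kappa>)"
      unfolding \<kappa> pair\<mu>\<^sub>0 using \<pi>(1)[OF y] exit_rate_nonneg[OF y] by (simp add: ennreal_mult)
    show "pairing \<mu> ?\<kappa> < \<infinity>" by (simp add: \<kappa>)
    show "potential jump_kernel ?\<kappa> z \<noteq> 0" if "\<mu> z \<noteq> 0" for z
      using absorbed[of z] that by (auto simp: \<mu>_def hitting_cost_def split: if_splits)
  qed
  have "(\<integral>\<^sup>+z. ennreal (\<pi> z * g z) \<partial>count_space F)
      = (\<integral>\<^sup>+z. ennreal (\<pi> z * g z) * indicator {y} z + ennreal (\<pi> z * g z) * indicator (F - {y}) z \<partial>count_space F)"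
    using y by (intro nn_integral_cong) (auto split: split_indicator)
  also have "\<dots> = (\<integral>\<^sup>+z. ennreal (\<pi> z * g z) * indicator {y} z \<partial>count_space F)
      + (\<integral>\<^sup>+z. ennreal (\<pi> z * g z) * indicator (F - {y}) z \<partial>count_space F)"
    by (intro nn_integral_add) auto
  also have "(\<integral>\<^sup>+z. ennreal (\<pi> z * g z) * indicator {y} z \<partial>count_space F) = ennreal (\<pi> y * g y)"
    using y by (subst nn_integral_count_space'[of "{y}"]) auto
  also have "(\<integral>\<^sup>+z. ennreal (\<pi> z * g z) * indicator (F - {y}) z \<partial>count_space F)
      = (\<integral>\<^sup>+z. ennreal (\<pi> z * g z) \<partial>count_space (F - {y}))"
    by (simp add: nn_integral_count_space_indicator mult.assoc) (intro nn_integral_cong, auto split: split_indicator)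
  also have "\<dots> = ennreal (\<pi> y) * (\<integral>\<^sup>+z. ennreal (Q y z) * hitting_cost g z \<partial>count_space (F - {y}))"
    using g pair\<mu>[of g] by (simp add: main pair\<mu>\<^sub>0 hitting_cost_def)
  finally show ?thesis
    using \<pi>(1)[OF y] g[OF y] by (simp add: ennreal_mult distrib_left)
qed

text \<open>
  The solution is $h = H_{g^+} - H_{g^-} - s H_e$ with $s = \pi g$. Off $y$ the equation holds by construction of
  the hitting costs; at $y$ it amounts to Kac's formula for $g^+$, $g^-$ and $e$, divided by $\pi(y)$. As each of
  the three hitting costs lies between $0$ and $w$, $|h| \le w + |s| w$.
\<close>

lemma poisson_solution:
  assumes f: "\<And>x. x \<in> F \<Longrightarrow> 1 \<le> f x" and w: "\<And>x. x \<in> F \<Longrightarrow> 0 \<le> w x"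
    and drift: "\<And>x. x \<in> F \<Longrightarrow> (\<lambda>z. Q x z * w z) summable_on F"
      "\<And>x. x \<in> F - {y} \<Longrightarrow> (\<Sum>\<^sub>\<infinity>z\<in>F. Q x z * w z) \<le> - f x"
    and \<pi>: "\<And>z. z \<in> F \<Longrightarrow> 0 \<le> \<pi> z" "\<And>z. z \<in> F \<Longrightarrow> ((\<lambda>x. \<pi> x * Q x z) has_sum 0) F" "(\<pi> has_sum 1) F"
    and absorbed: "\<And>x. x \<in> F - {y} \<Longrightarrow> hitting_cost (\<lambda>x. Q x y) x = 1"
    and g: "\<And>x. x \<in> F \<Longrightarrow> \<bar>g x\<bar> \<le> f x"
  obtains h s where "((\<lambda>x. \<pi> x * g x) has_sum s) F" "(\<lambda>x. \<pi> x * \<bar>g x\<bar>) summable_on F"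
    "\<And>x. x \<in> F \<Longrightarrow> ((\<lambda>z. Q x z * h z) has_sum s - g x) F"
    "\<And>x. x \<in> F \<Longrightarrow> \<bar>h x\<bar> \<le> (1 + (\<Sum>\<^sub>\<infinity>z\<in>F. \<pi> z * \<bar>g z\<bar>)) * w x"
proof -
  define H where "H G z = enn2real (hitting_cost G z)" for G z
  define A where "A G = (\<Sum>\<^sub>\<infinity>z\<in>F. Q y z * H G z)" for G
  have le: "hitting_cost G x \<le> ennreal (w x)" if "\<And>x. x \<in> F \<Longrightarrow> 0 \<le> G x" "\<And>x. x \<in> F \<Longrightarrow> G x \<le> f x" for G x
  proof (rule hitting_cost_le)
    fix x assume x: "x \<in> F - {y}"
    show "(\<Sum>\<^sub>\<infinity>z\<in>F. Q x z * w z) \<le> - G x" using drift(2)[OF x] that(2)[of x] x by simp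
  qed (use that w drift in auto)
  have fin: "hitting_cost G x < \<infinity>" if "\<And>x. x \<in> F \<Longrightarrow> 0 \<le> G x" "\<And>x. x \<in> F \<Longrightarrow> G x \<le> f x" for G x
    using le_less_trans[OF le[OF that] ennreal_less_top, of x] by simp
  have bound: "0 \<le> H G x" "x \<in> F \<Longrightarrow> H G x \<le> w x"
    if "\<And>x. x \<in> F \<Longrightarrow> 0 \<le> G x" "\<And>x. x \<in> F \<Longrightarrow> G x \<le> f x" for G x
    using enn2real_mono[OF le[OF that, of x]] w[of x] by (auto simp: H_def)
  have Hy: "H G y = 0" for G by (simp add: H_def hitting_cost_killed)
  have off: "((\<lambda>z. Q x z * H G z) has_sum - G x) F"
    if "\<And>x. x \<in> F \<Longrightarrow> 0 \<le> G x" "\<And>x. x \<in> F \<Longrightarrow> G x \<le> f x" "x \<in> F - {y}" for G x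
    using hitting_cost_has_sum[of G x] fin[OF that(1,2)] that by (auto simp: H_def)
  have at_y: "((\<lambda>z. Q y z * H G z) has_sum A G) F"
    and kac: "((\<lambda>x. \<pi> x * G x) has_sum \<pi> y * (G y + A G)) F" and A0: "0 \<le> A G"
    if G: "\<And>x. x \<in> F \<Longrightarrow> 0 \<le> G x" "\<And>x. x \<in> F \<Longrightarrow> G x \<le> f x" for G
  proof -
    note b = bound[OF G]
    have "(\<lambda>z. Q y z * w z) summable_on (F - {y})"
      using drift(1)[OF y] by (rule summable_on_subset_banach) auto
    then have "(\<lambda>z. Q y z * H G z) summable_on (F - {y})"
      by (rule summable_on_comparison_test) (use b off_diagonal y in \<open>auto intro!: mult_left_mono\<close>)
    then obtain i where i: "((\<lambda>z. Q y z * H G z) has_sum i) (F - {y})" by (auto simp: summable_on_def)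
    then have iF: "((\<lambda>z. Q y z * H G z) has_sum i) F"
      using has_sum_off_diagonal[OF y, of "H G" i] by (simp add: Hy)
    then have iA: "i = A G" by (simp add: A_def infsumI)
    show "((\<lambda>z. Q y z * H G z) has_sum A G) F" using iF iA by simp
    have i0: "0 \<le> i" using i by (rule has_sum_nonneg) (use b off_diagonal y in auto)
    then show "0 \<le> A G" using iA by simp
    have "(\<integral>\<^sup>+z. ennreal (Q y z) * hitting_cost G z \<partial>count_space (F - {y}))
        = (\<integral>\<^sup>+z. ennreal (Q y z) * ennreal (H G z) \<partial>count_space (F - {y}))"
      using fin[OF G] by (intro nn_integral_cong) (simp add: H_def)
    also have "\<dots> = ennreal (A G)"
      using has_sum_iff_nn_integral_off_diagonal[OF y, of "H G" i] iF i0 b iA by (simp add: Hy)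
    finally have "(\<integral>\<^sup>+z. ennreal (\<pi> z * G z) \<partial>count_space F) = ennreal (\<pi> y * (G y + A G))"
      using kac_formula[OF \<pi>(1,2) absorbed, of G] G y \<pi>(1)[OF y] i0 iA by (simp add: ennreal_mult)
    then show "((\<lambda>x. \<pi> x * G x) has_sum \<pi> y * (G y + A G)) F"
      using \<pi>(1) G y i0 iA by (subst has_sum_iff_nn_integral) auto
  qed
  define g1 where "g1 x = max 0 (g x)" for x
  define g2 where "g2 x = max 0 (- g x)" for x
  define e where "e = (\<lambda>x::'a. 1::real)"
  have g1: "0 \<le> g1 x" "x \<in> F \<Longrightarrow> g1 x \<le> f x" and g2: "0 \<le> g2 x" "x \<in> F \<Longrightarrow> g2 x \<le> f x"
    and e: "0 \<le> e x" "x \<in> F \<Longrightarrow> e x \<le> f x" for x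
    using g[of x] f[of x] by (auto simp: g1_def g2_def e_def)
  have g12: "g x = g1 x - g2 x" "\<bar>g x\<bar> = g1 x + g2 x" for x by (auto simp: g1_def g2_def)
  define s where "s = \<pi> y * (g1 y + A g1) - \<pi> y * (g2 y + A g2)"
  define t where "t = \<pi> y * (g1 y + A g1) + \<pi> y * (g2 y + A g2)"
  have "((\<lambda>x. \<pi> x * g1 x + - (\<pi> x * g2 x)) has_sum \<pi> y * (g1 y + A g1) + - (\<pi> y * (g2 y + A g2))) F"
    by (intro has_sum_add kac g1) (auto simp: has_sum_uminus intro!: kac g2)
  then have s: "((\<lambda>x. \<pi> x * g x) has_sum s) F" by (simp add: g12 s_def algebra_simps)
  have "((\<lambda>x. \<pi> x * g1 x + \<pi> x * g2 x) has_sum t) F"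
    unfolding t_def by (intro has_sum_add kac g1 g2)
  then have t: "((\<lambda>x. \<pi> x * \<bar>g x\<bar>) has_sum t) F" by (simp add: g12(2) distrib_left)
  have st: "\<bar>s\<bar> \<le> t"
    using g1(1)[of y] g2(1)[of y] A0[of g1] A0[of g2] g1 g2 \<pi>(1)[OF y] by (auto simp: s_def t_def abs_le_iff intro!: mult_nonneg_nonneg)
  have "1 = \<pi> y * (1 + A e)"
    using kac[OF e] \<pi>(3) has_sum_unique by (fastforce simp: e_def)
  then have A: "\<pi> y * A e = 1 - \<pi> y" and \<pi>y: "\<pi> y \<noteq> 0" by (auto simp: algebra_simps)
  define h where "h x = H g1 x - H g2 x - s * H e x" for x
  show ?thesis
  proof (rule that[OF s])
    show "(\<lambda>x. \<pi> x * \<bar>g x\<bar>) summable_on F" using t by (rule has_sum_imp_summable)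
  next
    fix x assume x: "x \<in> F"
    have comb: "((\<lambda>z. Q x z * h z) has_sum a1 - a2 - s * a3) F"
      if "((\<lambda>z. Q x z * H g1 z) has_sum a1) F" "((\<lambda>z. Q x z * H g2 z) has_sum a2) F"
        "((\<lambda>z. Q x z * H e z) has_sum a3) F" for a1 a2 a3
    proof -
      have "((\<lambda>z. Q x z * H g1 z + - (Q x z * H g2 z) + (- s) * (Q x z * H e z)) has_sum a1 + - a2 + (- s) * a3) F"
        using that by (intro has_sum_add has_sum_cmult_right) (auto simp: has_sum_uminus)
      then show ?thesis by (simp add: h_def algebra_simps)
    qed
    show "((\<lambda>z. Q x z * h z) has_sum s - g x) F"
    proof (cases "x = y")
      case True
      have "\<pi> y * (A g1 - A g2 - s * A e) = s - \<pi> y * g y - s * (\<pi> y * A e)"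
        by (simp add: s_def g12 algebra_simps)
      also have "\<dots> = \<pi> y * (s - g y)" unfolding A by (simp add: algebra_simps)
      finally have "A g1 - A g2 - s * A e = s - g y" using \<pi>y by simp
      then show ?thesis using comb[of "A g1" "A g2" "A e"] at_y g1 g2 e True by simp
    next
      case False
      then have "x \<in> F - {y}" using x by simp
      then show ?thesis
        using comb[OF off[OF g1] off[OF g2] off[OF e]] by (simp add: g12 e_def algebra_simps)
    qed
    have "\<bar>h x\<bar> \<le> \<bar>H g1 x - H g2 x\<bar> + \<bar>s\<bar> * \<bar>H e x\<bar>"
      unfolding h_def by (metis abs_mult abs_triangle_ineq4)
    also have "\<dots> \<le> w x + t * w x"
      using bound(1)[OF g1, of x] bound(1)[OF g2, of x] bound(1)[OF e, of x] bound(2)[OF g1 x] bound(2)[OF g2 x] bound(2)[OF e x] st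
      by (intro add_mono mult_mono) auto
    finally show "\<bar>h x\<bar> \<le> (1 + (\<Sum>\<^sub>\<infinity>z\<in>F. \<pi> z * \<bar>g z\<bar>)) * w x"
      using infsumI[OF t] by (simp add: distrib_right)
  qed
qed

end

section \<open>Tails of the upward jumps\<close>

lemma states_upto_finite: "finite (states_upto S n)"
  by (rule finite_subset[of _ "Sigma {..n} (\<lambda>k. {..S k})"]) (auto simp: states_upto_def)

text \<open>
  The offset \<open>d\<close> covers both the sums over absolute levels and those over the number of levels jumped.
\<close>

lemma block_series_eq_nn_integral:
  "(\<Sum>\<^sub>\<infinity>m\<in>{l + 1..}. block_times S Q k (d + m) (u m) i)
    = (\<integral>\<^sup>+z. ennreal (Q (k, i) z) * u (fst z - d) (snd z) \<partial>count_space {z \<in> states S. d + l < fst z})"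
proof -
  define G where "G z = ennreal (Q (k, i) z) * u (fst z - d) (snd z) * indicator {z \<in> states S. d + l < fst z} z" for z
  have G: "(\<integral>\<^sup>+j. G (m, j) \<partial>count_space UNIV)
      = block_times S Q k m (u (m - d)) i * indicator {d + l + 1..} m" for m
  proof -
    have "(\<integral>\<^sup>+j. G (m, j) \<partial>count_space UNIV) = (\<Sum>j\<le>S m. G (m, j))"
      by (intro nn_integral_count_space') (auto simp: G_def states_def)
    then show ?thesis
      by (cases "d + l < m") (auto simp: G_def block_times_def states_def)
  qed
  have bij: "bij_betw (\<lambda>m. d + m) {l + 1..} {d + l + 1..}"
    by (rule bij_betw_byWitness[where f' = "\<lambda>m. m - d"]) auto
  have "(\<Sum>\<^sub>\<infinity>m\<in>{l + 1..}. block_times S Q k (d + m) (u m) i)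
      = (\<integral>\<^sup>+m. block_times S Q k (d + m) (u (d + m - d)) i \<partial>count_space {l + 1..})"
    by (simp add: nn_integral_count_space_eq_infsum)
  also have "\<dots> = (\<integral>\<^sup>+m. block_times S Q k m (u (m - d)) i \<partial>count_space {d + l + 1..})"
    using nn_integral_bij_count_space[OF bij, of "\<lambda>m. block_times S Q k m (u (m - d)) i"] by simp
  also have "\<dots> = (\<integral>\<^sup>+m. \<integral>\<^sup>+j. G (m, j) \<partial>count_space UNIV \<partial>count_space UNIV)"
    unfolding G by (simp add: nn_integral_count_space_indicator)
  also have "\<dots> = (\<integral>\<^sup>+z. G z \<partial>count_space UNIV)"
    by (rule nn_integral_fst_count_space)
  finally show ?thesis by (simp add: G_def nn_integral_count_space_indicator)
qed

locale controlled_tails = conservative_rates "states S" Q for S :: "nat \<Rightarrow> nat" and Q +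
  fixes T V :: "real \<Rightarrow> real" and a :: "nat \<Rightarrow> real" and r\<^sub>1 :: real
  assumes T: "nondecreasing_log_subadditive T" and V: "nondecreasing_log_subadditive V"
    and T_unbounded: "filterlim T at_top at_top"
    and phases: "\<And>k. 1 \<le> k \<Longrightarrow> S k = S 1"
    and a_pos: "\<And>i. i \<le> S 1 \<Longrightarrow> 0 < a i"
    and r\<^sub>1: "0 < r\<^sub>1" "r1_sup S Q T V a \<le> ennreal r\<^sub>1"
begin

definition a_min :: real where "a_min = (MIN i\<in>{..S 1}. a i)"

lemma a_min_pos: "0 < a_min"
  unfolding a_min_def using a_pos by (subst Min_gr_iff) auto

lemma a_min_le: "i \<le> S 1 \<Longrightarrow> a_min \<le> a i"
  unfolding a_min_def by (intro Min_le) auto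

lemma T_ge_1: "1 \<le> T (real k)" and V_ge_1: "1 \<le> V (real k)"
  using T V by (auto simp: nondecreasing_log_subadditive_def)

lemma T_add: "T (real (k + l)) \<le> T (real k) * T (real l)" and V_add: "V (real (k + l)) \<le> V (real k) * V (real l)"
  using T V by (auto simp: nondecreasing_log_subadditive_def)

lemma T_mono: "k \<le> l \<Longrightarrow> T (real k) \<le> T (real l)" and V_mono: "k \<le> l \<Longrightarrow> V (real k) \<le> V (real l)"
  using T V by (auto simp: nondecreasing_log_subadditive_def intro: mono_onD)

lemma tail_le:
  assumes i: "i \<le> S k"
  shows "ennreal (T (real l)) * (\<integral>\<^sup>+z. ennreal (Q (k, i) z) * ennreal (V (real (fst z - k)) * a (snd z))
    \<partial>count_space {z \<in> states S. k + l < fst z}) \<le> ennreal r\<^sub>1"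
proof -
  let ?B = "\<lambda>i. \<Sum>\<^sub>\<infinity>m\<in>{l + 1..}. block_times S Q k (k + m) (\<lambda>j. ennreal (V (real m) * a j)) i"
  have "ennreal (T (real l)) * ?B i \<le> ennreal (T (real l)) * (MAX i\<in>{..S k}. ?B i)"
    using i by (intro mult_left_mono Max_ge) auto
  also have "\<dots> \<le> r1_sup S Q T V a"
    unfolding r1_sup_def by (rule SUP_upper2[of "(k, l)"]) auto
  also have "\<dots> \<le> ennreal r\<^sub>1" by (rule r\<^sub>1)
  also have "?B i = (\<integral>\<^sup>+z. ennreal (Q (k, i) z) * ennreal (V (real (fst z - k)) * a (snd z))
      \<partial>count_space {z \<in> states S. k + l < fst z})"
    by (rule block_series_eq_nn_integral)
  finally show ?thesis .
qed

lemma phase_le: "z \<in> states S \<Longrightarrow> 1 \<le> fst z \<Longrightarrow> snd z \<le> S 1"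
  using phases[of "fst z"] by (auto simp: states_def)

text \<open>
  A jump from level $k \le n$ to a level beyond $n$ goes up by more than $n - k$ levels, so that log-subadditivity
  leaves exactly the tail that $r_1$ controls.
\<close>

lemma outflow_le:
  assumes i: "i \<le> S k" and kn: "k \<le> n"
    and v: "\<And>m j. 1 \<le> m \<Longrightarrow> j \<le> S 1 \<Longrightarrow> v (m, j) = V (real m) * a j"
  shows "ennreal (T (real n)) * (\<integral>\<^sup>+z. ennreal (Q (k, i) z) * ennreal (v z) \<partial>count_space {z \<in> states S. n < fst z})
    \<le> ennreal (T (real k) * V (real k) * r\<^sub>1)"
proof -
  define l where "l = n - k"
  have n: "n = k + l" using kn by (simp add: l_def)
  let ?C = "count_space {z \<in> states S. n < fst z}"
  let ?I = "\<integral>\<^sup>+z. ennreal (Q (k, i) z) * ennreal (V (real (fst z - k)) * a (snd z)) \<partial>?C"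
  have pos: "0 \<le> T (real k)" "0 \<le> V (real k)" for k using T_ge_1[of k] V_ge_1[of k] by auto
  have "(\<integral>\<^sup>+z. ennreal (Q (k, i) z) * ennreal (v z) \<partial>?C)
      \<le> (\<integral>\<^sup>+z. ennreal (V (real k)) * (ennreal (Q (k, i) z) * ennreal (V (real (fst z - k)) * a (snd z))) \<partial>?C)"
  proof (rule nn_integral_mono)
    fix z assume "z \<in> space ?C"
    then have z: "z \<in> states S" "n < fst z" "snd z \<le> S 1" using phase_le[of z] by auto
    have "v z = V (real (k + (fst z - k))) * a (snd z)"
      using v[of "fst z" "snd z"] z n by simp
    also have "\<dots> \<le> (V (real k) * V (real (fst z - k))) * a (snd z)"
      using a_pos[OF z(3)] by (intro mult_right_mono V_add) auto
    finally have "ennreal (v z) \<le> ennreal (V (real k)) * ennreal (V (real (fst z - k)) * a (snd z))"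
      using pos a_pos[OF z(3)] by (simp add: ennreal_mult[symmetric] ennreal_leI mult.assoc)
    then have "ennreal (Q (k, i) z) * ennreal (v z)
        \<le> ennreal (Q (k, i) z) * (ennreal (V (real k)) * ennreal (V (real (fst z - k)) * a (snd z)))"
      by (rule mult_left_mono) simp
    then show "ennreal (Q (k, i) z) * ennreal (v z)
        \<le> ennreal (V (real k)) * (ennreal (Q (k, i) z) * ennreal (V (real (fst z - k)) * a (snd z)))"
      by (simp add: mult.left_commute)
  qed
  also have "\<dots> = ennreal (V (real k)) * ?I" by (rule nn_integral_cmult) simp
  finally have "ennreal (T (real n)) * (\<integral>\<^sup>+z. ennreal (Q (k, i) z) * ennreal (v z) \<partial>?C)
      \<le> ennreal (T (real k) * T (real l)) * (ennreal (V (real k)) * ?I)"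
    using T_add[of k l] by (intro mult_mono ennreal_leI) (auto simp: n)
  also have "\<dots> = ennreal (T (real k) * V (real k)) * (ennreal (T (real l)) * ?I)"
    using pos by (simp add: ennreal_mult mult_ac)
  also have "\<dots> \<le> ennreal (T (real k) * V (real k)) * ennreal r\<^sub>1"
    using tail_le[OF i, of l] unfolding n by (rule mult_left_mono) simp
  also have "\<dots> = ennreal (T (real k) * V (real k) * r\<^sub>1)"
    using pos r\<^sub>1 by (simp add: ennreal_mult)
  finally show ?thesis .
qed

lemma outflow_rate_le:
  assumes v: "\<And>m j. 1 \<le> m \<Longrightarrow> j \<le> S 1 \<Longrightarrow> v (m, j) = V (real m) * a j"
  shows "(\<integral>\<^sup>+z. ennreal (Q x z) \<partial>count_space {z \<in> states S. n < fst z})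
    \<le> ennreal (inverse a_min / V (real (n + 1))) * (\<integral>\<^sup>+z. ennreal (Q x z) * ennreal (v z) \<partial>count_space {z \<in> states S. n < fst z})"
proof -
  let ?C = "count_space {z \<in> states S. n < fst z}"
  let ?c = "inverse a_min / V (real (n + 1))"
  have c: "0 \<le> ?c" using a_min_pos V_ge_1[of "n + 1"] by simp
  have "(\<integral>\<^sup>+z. ennreal (Q x z) \<partial>?C) \<le> (\<integral>\<^sup>+z. ennreal ?c * (ennreal (Q x z) * ennreal (v z)) \<partial>?C)"
  proof (rule nn_integral_mono)
    fix z assume "z \<in> space ?C"
    then have z: "z \<in> states S" "n < fst z" "snd z \<le> S 1" using phase_le[of z] by auto
    have "V (real (n + 1)) * a_min \<le> V (real (fst z)) * a (snd z)"
      using z a_min_le[OF z(3)] a_min_pos V_mono[of "n + 1" "fst z"] V_ge_1[of "n + 1"] by (intro mult_mono) auto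
    also have "\<dots> = v z" using v[of "fst z" "snd z"] z by simp
    finally have "1 \<le> ?c * v z"
      using a_min_pos V_ge_1[of "n + 1"] by (simp add: field_simps)
    then have "1 \<le> ennreal ?c * ennreal (v z)"
      using c ennreal_leI[of 1 "?c * v z"] by (simp only: ennreal_mult' ennreal_1)
    then have "ennreal (Q x z) * 1 \<le> ennreal (Q x z) * (ennreal ?c * ennreal (v z))"
      by (rule mult_left_mono) simp
    then show "ennreal (Q x z) \<le> ennreal ?c * (ennreal (Q x z) * ennreal (v z))"
      by (simp add: mult.left_commute)
  qed
  also have "\<dots> = ennreal ?c * (\<integral>\<^sup>+z. ennreal (Q x z) * ennreal (v z) \<partial>?C)"
    by (rule nn_integral_cmult) simp
  finally show ?thesis .
qed

lemma tail_rate_le: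
  assumes i: "i \<le> S k"
  shows "(\<integral>\<^sup>+z. ennreal (Q (k, i) z) \<partial>count_space {z \<in> states S. k + l < fst z})
    \<le> ennreal (r\<^sub>1 / (a_min * T (real l)))"
proof -
  let ?C = "count_space {z \<in> states S. k + l < fst z}"
  let ?I = "\<integral>\<^sup>+z. ennreal (Q (k, i) z) \<partial>?C"
  have T0: "0 < T (real l)" using T_ge_1[of l] by simp
  have "ennreal a_min * ?I = (\<integral>\<^sup>+z. ennreal a_min * ennreal (Q (k, i) z) \<partial>?C)"
    by (rule nn_integral_cmult[symmetric]) simp
  also have "\<dots> \<le> (\<integral>\<^sup>+z. ennreal (Q (k, i) z) * ennreal (V (real (fst z - k)) * a (snd z)) \<partial>?C)"
  proof (rule nn_integral_mono)
    fix z assume "z \<in> space ?C"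
    then have z: "z \<in> states S" "k + l < fst z" "snd z \<le> S 1" using phase_le[of z] by auto
    have "1 * a_min \<le> V (real (fst z - k)) * a (snd z)"
      using a_min_le[OF z(3)] a_min_pos V_ge_1[of "fst z - k"] by (intro mult_mono) auto
    then show "ennreal a_min * ennreal (Q (k, i) z) \<le> ennreal (Q (k, i) z) * ennreal (V (real (fst z - k)) * a (snd z))"
      by (subst mult.commute) (intro mult_left_mono ennreal_leI, auto)
  qed
  finally have "ennreal (T (real l)) * (ennreal a_min * ?I) \<le> ennreal r\<^sub>1"
    using tail_le[OF i, of l] by (meson mult_left_mono order_trans zero_le)
  then have "ennreal (inverse (a_min * T (real l))) * (ennreal (T (real l)) * (ennreal a_min * ?I))
      \<le> ennreal (inverse (a_min * T (real l))) * ennreal r\<^sub>1"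
    by (rule mult_left_mono) simp
  moreover have "ennreal (inverse (a_min * T (real l))) * (ennreal (T (real l)) * (ennreal a_min * ?I)) = ?I"
  proof -
    have "ennreal (inverse (a_min * T (real l))) * (ennreal (T (real l)) * ennreal a_min)
        = ennreal (inverse (a_min * T (real l)) * (T (real l) * a_min))"
      using T0 a_min_pos by (simp only: ennreal_mult less_imp_le mult_nonneg_nonneg inverse_nonnegative_iff_nonnegative)
    also have "inverse (a_min * T (real l)) * (T (real l) * a_min) = 1"
      using T0 a_min_pos by (simp add: field_simps)
    finally have "ennreal (inverse (a_min * T (real l))) * (ennreal (T (real l)) * ennreal a_min) * ?I = ?I"
      by simp
    then show ?thesis by (simp only: mult.assoc)
  qed
  moreover have "ennreal (inverse (a_min * T (real l))) * ennreal r\<^sub>1 = ennreal (r\<^sub>1 / (a_min * T (real l)))"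
    using T0 a_min_pos r\<^sub>1 by (simp add: ennreal_mult[symmetric] field_simps)
  ultimately show ?thesis by simp
qed

text \<open>
  Turns the sum in \<open>log_drift_le\<close> into a telescoping one: $\ln t \le t - 1$ gives a difference of
  reciprocals weighted by $T(l + 1)$, and log-subadditivity replaces this weight by $T(l) \, T(1)$.
\<close>

lemma ln_increment_le:
  "(ln (T (real (Suc l))) - ln (T (real l))) / T (real l) \<le> T 1 * (1 / T (real l) - 1 / T (real (Suc l)))"
proof -
  have t: "1 \<le> T (real l)" "1 \<le> T (real (Suc l))" by (rule T_ge_1)+
  have "ln (T (real (Suc l))) - ln (T (real l)) = ln (T (real (Suc l)) / T (real l))"
    using t by (simp add: ln_div)
  also have "\<dots> \<le> T (real (Suc l)) / T (real l) - 1"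
    using t by (intro ln_le_minus_one) auto
  also have "\<dots> = T (real (Suc l)) * (1 / T (real l) - 1 / T (real (Suc l)))"
    using t by (simp add: field_simps)
  also have "\<dots> \<le> (T (real l) * T 1) * (1 / T (real l) - 1 / T (real (Suc l)))"
    using t T_add[of l 1] T_mono[of l "Suc l"] by (intro mult_right_mono) (auto simp: field_simps)
  finally show ?thesis
    using t by (simp add: divide_le_eq mult_ac)
qed

text \<open>
  Summation by parts writes the left-hand side as $\ln T(0)$ times the whole tail plus a sum of
  $\ln T(l + 1) - \ln T(l)$ times the rate of jumping up by more than $l$ levels. The latter rate is at most
  $r_1 / (\underline a \, T(l))$.
\<close>

lemma log_drift_le:
  assumes i: "i \<le> S k"
  shows "(\<integral>\<^sup>+z. ennreal (Q (k, i) z) * ennreal (ln (T (real (fst z - k)))) \<partial>count_space {z \<in> states S. k < fst z})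
    \<le> ennreal (r\<^sub>1 / a_min * (ln (T 0) + T 1))"
proof -
  let ?A = "{z \<in> states S. k < fst z}"
  define d where "d l = ln (T (real (Suc l))) - ln (T (real l))" for l
  have d: "0 \<le> d l" for l
    unfolding d_def using T_mono[of l "Suc l"] T_ge_1[of l] by simp
  have c: "0 \<le> r\<^sub>1 / a_min" using r\<^sub>1 a_min_pos by simp
  have lnT0: "0 \<le> ln (T 0)" "1 \<le> T 0" "1 \<le> T 1" using T_ge_1[of 0] T_ge_1[of 1] by auto
  have split: "ennreal (ln (T (real m))) = ennreal (ln (T 0)) + (\<Sum>l. ennreal (d l) * indicator {..<m} l)" for m
  proof -
    have "(\<Sum>l. ennreal (d l) * indicator {..<m} l) = (\<Sum>l<m. ennreal (d l))"
      by (subst suminf_finite[of "{..<m}"]) auto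
    also have "\<dots> = ennreal (\<Sum>l<m. d l)" using d by simp
    also have "(\<Sum>l<m. d l) = ln (T (real m)) - ln (T 0)"
      unfolding d_def using sum_lessThan_telescope[of "\<lambda>l. ln (T (real l))" m] by simp
    finally show ?thesis
      using lnT0 T_mono[of 0 m] by (simp add: ennreal_plus[symmetric] del: ennreal_plus)
  qed
  have tail: "(\<integral>\<^sup>+z. ennreal (Q (k, i) z) * indicator {..<fst z - k} l \<partial>count_space ?A) \<le> ennreal (r\<^sub>1 / (a_min * T (real l)))" for l
  proof -
    have "(\<integral>\<^sup>+z. ennreal (Q (k, i) z) * indicator {..<fst z - k} l \<partial>count_space ?A)
        = (\<integral>\<^sup>+z. ennreal (Q (k, i) z) * indicator {..<fst z - k} l \<partial>count_space {z \<in> states S. k + l < fst z})"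
      by (intro nn_integral_count_space_eq) (auto split: split_indicator)
    also have "\<dots> = (\<integral>\<^sup>+z. ennreal (Q (k, i) z) \<partial>count_space {z \<in> states S. k + l < fst z})"
      by (intro nn_integral_cong) auto
    finally show ?thesis using tail_rate_le[OF i] by simp
  qed
  have sum_le: "(\<Sum>l. ennreal (d l) * ennreal (r\<^sub>1 / (a_min * T (real l)))) \<le> ennreal (r\<^sub>1 / a_min * T 1)"
  proof (rule suminf_le_const)
    fix N
    have "(\<Sum>l<N. ennreal (d l) * ennreal (r\<^sub>1 / (a_min * T (real l)))) = ennreal (\<Sum>l<N. d l * (r\<^sub>1 / (a_min * T (real l))))"
    proof -
      have "0 \<le> r\<^sub>1 / (a_min * T (real l))" for l using T_ge_1[of l] r\<^sub>1 a_min_pos by simp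
      then show ?thesis
        using d by (simp only: ennreal_mult[symmetric] sum_ennreal mult_nonneg_nonneg)
    qed
    also have "(\<Sum>l<N. d l * (r\<^sub>1 / (a_min * T (real l)))) = r\<^sub>1 / a_min * (\<Sum>l<N. d l / T (real l))"
      by (simp add: sum_distrib_left mult_ac)
    finally have eq: "(\<Sum>l<N. ennreal (d l) * ennreal (r\<^sub>1 / (a_min * T (real l)))) = ennreal (r\<^sub>1 / a_min * (\<Sum>l<N. d l / T (real l)))" .
    have "(\<Sum>l<N. d l / T (real l)) \<le> (\<Sum>l<N. T 1 * (1 / T (real l) - 1 / T (real (Suc l))))"
      unfolding d_def by (intro sum_mono ln_increment_le)
    also have "\<dots> = T 1 * (\<Sum>l<N. 1 / T (real l) - 1 / T (real (Suc l)))"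
      by (simp only: sum_distrib_left)
    also have "\<dots> = T 1 * (1 / T 0 - 1 / T (real N))"
      using sum_lessThan_telescope'[of "\<lambda>l. 1 / T (real l)" N] by (simp del: of_nat_Suc)
    also have "\<dots> \<le> T 1 * 1"
    proof -
      have "1 / T 0 \<le> 1" "0 \<le> 1 / T (real N)" using lnT0 T_ge_1[of N] by auto
      then have "1 / T 0 - 1 / T (real N) \<le> 1" by linarith
      then show ?thesis using lnT0 by (intro mult_left_mono) linarith+
    qed
    finally have "r\<^sub>1 / a_min * (\<Sum>l<N. d l / T (real l)) \<le> r\<^sub>1 / a_min * T 1"
      using c by (intro mult_left_mono) auto
    with eq show "(\<Sum>l<N. ennreal (d l) * ennreal (r\<^sub>1 / (a_min * T (real l)))) \<le> ennreal (r\<^sub>1 / a_min * T 1)"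
      by (simp add: ennreal_leI)
  qed simp
  have "(\<integral>\<^sup>+z. ennreal (Q (k, i) z) * ennreal (ln (T (real (fst z - k)))) \<partial>count_space ?A)
      = (\<integral>\<^sup>+z. ennreal (ln (T 0)) * ennreal (Q (k, i) z)
          + (\<Sum>l. ennreal (d l) * (ennreal (Q (k, i) z) * indicator {..<fst z - k} l)) \<partial>count_space ?A)"
  proof (rule nn_integral_cong)
    fix z
    let ?q = "ennreal (Q (k, i) z)" and ?ind = "indicator {..<fst z - k} :: nat \<Rightarrow> ennreal"
    have "?q * (\<Sum>l. ennreal (d l) * ?ind l) = (\<Sum>l. ?q * (ennreal (d l) * ?ind l))"
      by (rule ennreal_suminf_cmult[symmetric])
    also have "\<dots> = (\<Sum>l. ennreal (d l) * (?q * ?ind l))"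
      by (simp only: mult.left_commute)
    finally show "?q * ennreal (ln (T (real (fst z - k))))
        = ennreal (ln (T 0)) * ?q + (\<Sum>l. ennreal (d l) * (?q * ?ind l))"
      unfolding split[of "fst z - k"] distrib_left by (simp only: mult.commute)
  qed
  also have "\<dots> = ennreal (ln (T 0)) * (\<integral>\<^sup>+z. ennreal (Q (k, i) z) \<partial>count_space ?A)
      + (\<Sum>l. ennreal (d l) * (\<integral>\<^sup>+z. ennreal (Q (k, i) z) * indicator {..<fst z - k} l \<partial>count_space ?A))"
    by (subst nn_integral_add, simp, simp, subst nn_integral_suminf, simp, simp only: nn_integral_cmult borel_measurable_count_space)
  also have "\<dots> \<le> ennreal (ln (T 0)) * ennreal (r\<^sub>1 / a_min) + (\<Sum>l. ennreal (d l) * ennreal (r\<^sub>1 / (a_min * T (real l))))"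
  proof (intro add_mono mult_left_mono suminf_le tail)
    have "(\<integral>\<^sup>+z. ennreal (Q (k, i) z) \<partial>count_space ?A) \<le> ennreal (r\<^sub>1 / (a_min * T (real 0)))"
      using tail_rate_le[OF i, of 0] by simp
    also have "\<dots> \<le> ennreal (r\<^sub>1 / a_min)"
      using lnT0 r\<^sub>1 a_min_pos by (intro ennreal_leI divide_left_mono) auto
    finally show "(\<integral>\<^sup>+z. ennreal (Q (k, i) z) \<partial>count_space ?A) \<le> ennreal (r\<^sub>1 / a_min)" .
  qed auto
  also have "\<dots> \<le> ennreal (ln (T 0)) * ennreal (r\<^sub>1 / a_min) + ennreal (r\<^sub>1 / a_min * T 1)"
    using sum_le by (rule add_left_mono)
  also have "\<dots> = ennreal (ln (T 0) * (r\<^sub>1 / a_min) + r\<^sub>1 / a_min * T 1)"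
  proof -
    have "0 \<le> ln (T 0) * (r\<^sub>1 / a_min)" "0 \<le> r\<^sub>1 / a_min * T 1"
      using lnT0 by (intro mult_nonneg_nonneg c, linarith)+
    then show ?thesis
      by (simp only: ennreal_mult[OF lnT0(1) c, symmetric] ennreal_plus)
  qed
  also have "ln (T 0) * (r\<^sub>1 / a_min) + r\<^sub>1 / a_min * T 1 = r\<^sub>1 / a_min * (ln (T 0) + T 1)"
    by (simp add: algebra_simps)
  finally show ?thesis .
qed

text \<open>
  By log-subadditivity $\ln T$ grows by at most $\ln T(m)$ in an upward jump of $m$ levels, and it does not grow
  in the other jumps.
\<close>

lemma log_level_drift:
  assumes x: "x \<in> states S"
  shows "(\<lambda>z. Q x z * ln (T (real (fst z)))) summable_on states S"
    and "(\<Sum>\<^sub>\<infinity>z\<in>states S. Q x z * ln (T (real (fst z)))) \<le> r\<^sub>1 / a_min * (ln (T 0) + T 1)"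
proof -
  obtain k i where ki: "x = (k, i)" "i \<le> S k" using x by (auto simp: states_def)
  let ?F = "states S" and ?L = "\<lambda>z. ln (T (real (fst z)))"
  let ?B = "r\<^sub>1 / a_min * (ln (T 0) + T 1)"
  have L0: "0 \<le> ?L z" for z :: state using T_ge_1[of "fst z"] by simp
  have B0: "0 \<le> ?B"
    using r\<^sub>1 a_min_pos T_ge_1[of 0] T_ge_1[of 1] by (intro mult_nonneg_nonneg) auto
  let ?I = "\<integral>\<^sup>+z. ennreal (Q x z) * ennreal (?L z) \<partial>count_space (?F - {x})"
  have "?I \<le> (\<integral>\<^sup>+z. ennreal (?L x) * ennreal (Q x z)
      + ennreal (Q x z) * ennreal (ln (T (real (fst z - k)))) * indicator {z. k < fst z} z \<partial>count_space (?F - {x}))"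
  proof (rule nn_integral_mono)
    fix z :: state
    have "?L z \<le> ?L x + ln (T (real (fst z - k)))" if "k < fst z"
    proof -
      have "T (real (fst z)) \<le> T (real k) * T (real (fst z - k))"
        using T_add[of k "fst z - k"] that by simp
      then have "ln (T (real (fst z))) \<le> ln (T (real k) * T (real (fst z - k)))"
        using T_ge_1[of "fst z"] by simp
      then show ?thesis using T_ge_1[of k] T_ge_1[of "fst z - k"] ki by (simp add: ln_mult)
    qed
    moreover have "?L z \<le> ?L x" if "\<not> k < fst z"
      using that ki T_mono[of "fst z" k] T_ge_1[of "fst z"] by simp
    ultimately have "ennreal (?L z) \<le> ennreal (?L x) + ennreal (ln (T (real (fst z - k)))) * indicator {z. k < fst z} z"
      using L0 T_ge_1[of "fst z - k"] by (auto simp: ennreal_plus[symmetric] ennreal_leI simp del: ennreal_plus split: split_indicator)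
    then have "ennreal (Q x z) * ennreal (?L z)
        \<le> ennreal (Q x z) * (ennreal (?L x) + ennreal (ln (T (real (fst z - k)))) * indicator {z. k < fst z} z)"
      by (rule mult_left_mono) simp
    then show "ennreal (Q x z) * ennreal (?L z) \<le> ennreal (?L x) * ennreal (Q x z)
        + ennreal (Q x z) * ennreal (ln (T (real (fst z - k)))) * indicator {z. k < fst z} z"
      by (simp add: distrib_left mult_ac)
  qed
  also have "\<dots> = ennreal (?L x) * (\<integral>\<^sup>+z. ennreal (Q x z) \<partial>count_space (?F - {x}))
      + (\<integral>\<^sup>+z. ennreal (Q x z) * ennreal (ln (T (real (fst z - k)))) * indicator {z. k < fst z} z \<partial>count_space (?F - {x}))"
    by (simp add: nn_integral_add nn_integral_cmult)
  also have "(\<integral>\<^sup>+z. ennreal (Q x z) \<partial>count_space (?F - {x})) = ennreal (exit_rate x)"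
    using exit_rate_has_sum[OF x] off_diagonal[OF x] exit_rate_nonneg[OF x] x
    by (subst (asm) has_sum_iff_nn_integral) auto
  also have "(\<integral>\<^sup>+z. ennreal (Q x z) * ennreal (ln (T (real (fst z - k)))) * indicator {z. k < fst z} z \<partial>count_space (?F - {x}))
      = (\<integral>\<^sup>+z. ennreal (Q x z) * ennreal (ln (T (real (fst z - k)))) * indicator {z. k < fst z} z \<partial>count_space {z \<in> ?F. k < fst z})"
    by (intro nn_integral_count_space_eq) (auto simp: ki split: split_indicator)
  also have "\<dots> = (\<integral>\<^sup>+z. ennreal (Q (k, i) z) * ennreal (ln (T (real (fst z - k)))) \<partial>count_space {z \<in> ?F. k < fst z})"
    by (intro nn_integral_cong) (auto simp: ki)
  also have "ennreal (?L x) * ennreal (exit_rate x) + \<dots> \<le> ennreal (?L x) * ennreal (exit_rate x) + ennreal ?B"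
    by (intro add_left_mono log_drift_le ki(2))
  also have "\<dots> = ennreal (exit_rate x * ?L x + ?B)"
    using L0[of x] exit_rate_nonneg[OF x] B0 by (simp add: ennreal_mult[symmetric] mult.commute)
  finally have le: "?I \<le> ennreal (exit_rate x * ?L x + ?B)" .
  then obtain r where r: "0 \<le> r" "?I = ennreal r"
    by (cases ?I) (auto simp: top_unique)
  have "0 \<le> exit_rate x * ?L x + ?B"
    using L0[of x] exit_rate_nonneg[OF x] B0 by (simp add: add_nonneg_nonneg)
  then have rB: "r \<le> exit_rate x * ?L x + ?B" using le r by simp
  have "((\<lambda>z. Q x z * ?L z) has_sum (r - exit_rate x * ?L x)) ?F"
    using r x L0 by (subst has_sum_iff_nn_integral_off_diagonal) auto
  then show "(\<lambda>z. Q x z * ?L z) summable_on ?F" "(\<Sum>\<^sub>\<infinity>z\<in>?F. Q x z * ?L z) \<le> ?B"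
    using rB by (auto simp: has_sum_imp_summable infsumI)
qed

lemma log_level_sublevel_finite:
  "finite {x \<in> states S. ln (T (real (fst x))) \<le> c}"
proof -
  have "\<forall>\<^sub>F k in sequentially. exp c < T (real k)"
    using filterlim_compose[OF T_unbounded filterlim_real_sequentially]
    by (auto simp: filterlim_at_top_dense)
  then obtain N where N: "\<And>k. N \<le> k \<Longrightarrow> exp c < T (real k)"
    by (auto simp: eventually_sequentially)
  have "{x \<in> states S. ln (T (real (fst x))) \<le> c} \<subseteq> states_upto S N"
  proof
    fix x assume x: "x \<in> {x \<in> states S. ln (T (real (fst x))) \<le> c}"
    then have "T (real (fst x)) \<le> exp c"
      using T_ge_1[of "fst x"] exp_le_cancel_iff[of "ln (T (real (fst x)))" c] by simp
    then have "fst x < N" using N[of "fst x"] by (cases "N \<le> fst x") auto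
    then show "x \<in> states_upto S N" using x by (auto simp: states_def states_upto_def)
  qed
  then show ?thesis by (rule finite_subset) (rule states_upto_finite)
qed

end

section \<open>The stationary distribution of the truncation\<close>

definition cap_level :: "nat \<Rightarrow> state \<Rightarrow> state" where
  "cap_level n z = (min (fst z) n, snd z)"

lemma has_sum_finite_sum:
  fixes f :: "'i \<Rightarrow> 'a \<Rightarrow> real"
  assumes "\<And>i. i \<in> I \<Longrightarrow> (f i has_sum s i) A"
  shows "((\<lambda>x. \<Sum>i\<in>I. f i x) has_sum (\<Sum>i\<in>I. s i)) A"
  using assms
proof (induction I rule: infinite_finite_induct)
  case (insert i I)
  then show ?case by (simp add: has_sum_add)
qed auto

lemma ennreal_abs_has_sum_le:
  fixes f :: "'a :: countable \<Rightarrow> real"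
  assumes "(f has_sum s) A"
  shows "ennreal \<bar>s\<bar> \<le> (\<integral>\<^sup>+x. ennreal \<bar>f x\<bar> \<partial>count_space A)"
proof -
  have "f summable_on A" using assms by (rule has_sum_imp_summable)
  then have sum: "(\<lambda>x. norm (f x)) summable_on A"
    using summable_on_iff_abs_summable_on_real by blast
  then obtain t where t: "((\<lambda>x. norm (f x)) has_sum t) A"
    by (auto simp: summable_on_def)
  have t0: "0 \<le> t" using t by (rule has_sum_nonneg) auto
  have "\<bar>s\<bar> \<le> t" using norm_infsum_le[OF assms t] by simp
  moreover have "(\<integral>\<^sup>+x. ennreal \<bar>f x\<bar> \<partial>count_space A) = ennreal t"
    using t t0 by (subst (asm) has_sum_iff_nn_integral) auto
  ultimately show ?thesis by (simp add: ennreal_leI)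
qed

text \<open>
  The last assumption provides for each target $y$ a function like the resolvent. It serves to exclude
  closed sets of states inside a level above $n$, where the truncation keeps only the diagonal block of $Q$.
\<close>

locale lc_truncated = conservative_rates "states S" Q for S :: "nat \<Rightarrow> nat" and Q +
  fixes n :: nat and p :: "state \<Rightarrow> real"
  assumes n: "1 \<le> n" and phases: "\<And>k. 1 \<le> k \<Longrightarrow> S k = S 1"
    and stationary: "stationary_distribution (states S) (lc_truncation n Q) p"
    and probe: "\<And>y. y \<in> states S \<Longrightarrow> \<exists>u b. 0 < b \<and> (\<forall>x\<in>states S. 0 < u x \<and> u x \<le> 1)
      \<and> (\<forall>x\<in>states S. ((\<lambda>z. Q x z * u z) has_sum b * (u x - of_bool (x = y))) (states S))"
begin

abbreviation "F \<equiv> states S"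
abbreviation "F\<^sub>n \<equiv> states_upto S n"

lemma states_upto_facts: "finite F\<^sub>n" "F\<^sub>n \<subseteq> F" "x \<in> F - F\<^sub>n \<longleftrightarrow> x \<in> F \<and> n < fst x" "x \<in> F\<^sub>n \<longleftrightarrow> x \<in> F \<and> fst x \<le> n"
  using states_upto_finite[of S n] by (auto simp: states_def states_upto_def split: prod.splits)

lemma p_nonneg: "x \<in> F \<Longrightarrow> 0 \<le> p x"
  using stationary by (auto simp: stationary_distribution_def)

text \<open>
  On a level above $n$ the truncation only has the block $Q(l; l)$, so $p(l) \, Q(l; l) = 0$. Summing the columns
  shows that $p$ charges only states that never leave the level. For a target $y$ outside the level, $Q u = b u$
  on such states, hence $0 = p(l) \, Q(l; l) \, u = b \, p(l) \, u$, and $u > 0$ forces $p$ to vanish.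
\<close>

lemma stationary_above_zero:
  assumes x: "x \<in> F" "n < fst x"
  shows "p x = 0"
proof -
  define l where "l = fst x"
  define L where "L = Pair l ` {..S l}"
  have L: "finite L" "L \<subseteq> F" "z \<in> L \<longleftrightarrow> z \<in> F \<and> fst z = l" for z
    by (auto simp: L_def states_def image_iff split: prod.splits)
  have balance: "(\<Sum>x\<in>L. p x * Q x z) = 0" if z: "z \<in> L" for z
  proof -
    have "((\<lambda>x. p x * lc_truncation n Q x z) has_sum 0) F"
      using stationary z L(2) by (auto simp: stationary_distribution_def)
    moreover have "((\<lambda>x. p x * lc_truncation n Q x z) has_sum (\<Sum>x\<in>L. p x * Q x z)) F"
      using z L x
      by (intro has_sum_finite_neutralI[of L]) (auto simp: lc_truncation_def l_def split: prod.splits intro!: sum.cong)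
    ultimately show ?thesis using has_sum_unique by blast
  qed
  define R where "R x = (\<Sum>z\<in>L. Q x z)" for x
  have out: "((\<lambda>z. Q x z) has_sum - R x) (F - L)" if "x \<in> L" for x
    using has_sum_Diff[OF row_sum[of x] has_sum_finite[OF L(1), of "Q x"] L(2)] that L(2) by (auto simp: R_def)
  have R: "R x \<le> 0" if "x \<in> L" for x
    using has_sum_nonneg[OF out[OF that]] off_diagonal[of x] that L(2) by force
  have "(\<Sum>x\<in>L. p x * - R x) = - (\<Sum>z\<in>L. \<Sum>x\<in>L. p x * Q x z)"
    unfolding R_def by (subst sum.swap) (simp add: sum_distrib_left sum_negf)
  also have "\<dots> = 0" using balance by simp
  finally have sum0: "(\<Sum>x\<in>L. p x * - R x) = 0" .
  have "0 \<le> p x * - R x" if "x \<in> L" for x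
    using that p_nonneg[of x] L(2) R[of x] by (intro mult_nonneg_nonneg) auto
  then have pR: "p x * - R x = 0" if "x \<in> L" for x
    using sum_nonneg_eq_0_iff[OF L(1), of "\<lambda>x. p x * - R x"] sum0 that by blast
  have closed: "Q x z = 0" if "x \<in> L" "p x \<noteq> 0" "z \<in> F - L" for x z
  proof -
    have "R x = 0" using pR[OF that(1)] that(2) by simp
    then have sum0: "(Q x has_sum 0) (F - L)" using out[OF that(1)] by simp
    have nonneg: "0 \<le> Q x w" if "w \<in> F - L" for w
      using off_diagonal[of x w] \<open>x \<in> L\<close> that L(2) by auto
    have "(\<Sum>w\<in>{z}. Q x w) \<le> 0"
      using that(3) nonneg by (intro finite_sum_le_has_sum[OF sum0]) auto
    with nonneg[OF that(3)] show ?thesis by simp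
  qed
  have "(0, 0) \<in> F" by (simp add: states_def)
  \<comment> \<open>Any target on a level up to n would do; state (0, 0) always exists.\<close>
  from probe[OF this] obtain u b where b: "0 < b" and u: "\<And>x. x \<in> F \<Longrightarrow> 0 < u x"
    and eq: "\<And>x. x \<in> F \<Longrightarrow> ((\<lambda>z. Q x z * u z) has_sum b * (u x - of_bool (x = (0, 0)))) F"
    by blast
  have row: "p x * (\<Sum>z\<in>L. Q x z * u z) = p x * (b * u x)" if "x \<in> L" for x
  proof (cases "p x = 0")
    case False
    have fin: "((\<lambda>z. Q x z * u z) has_sum (\<Sum>z\<in>L. Q x z * u z)) F"
      using L closed[OF that False] by (intro has_sum_finite_neutralI[of L]) auto
    have "x \<noteq> (0, 0)" "x \<in> F" using that L(2) L(3)[of x] x by (auto simp: l_def)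
    then show ?thesis
      using has_sum_unique[OF fin eq[of x]] by simp
  qed simp
  have "(\<Sum>x\<in>L. p x * (b * u x)) = (\<Sum>x\<in>L. p x * (\<Sum>z\<in>L. Q x z * u z))"
    by (intro sum.cong refl row[symmetric])
  also have "\<dots> = (\<Sum>z\<in>L. (\<Sum>x\<in>L. p x * Q x z) * u z)"
    by (simp add: sum_distrib_left sum_distrib_right mult.assoc) (rule sum.swap)
  also have "\<dots> = 0" using balance by simp
  finally have sum0': "(\<Sum>x\<in>L. p x * (b * u x)) = 0" .
  have "0 \<le> p x * (b * u x)" if "x \<in> L" for x
    using that p_nonneg[of x] L(2) u[of x] b by (intro mult_nonneg_nonneg) auto
  then have zero: "p z * (b * u z) = 0" if "z \<in> L" for z
    using sum_nonneg_eq_0_iff[OF L(1), of "\<lambda>x. p x * (b * u x)"] sum0' that by blast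
  have "x \<in> L" using x L(3)[of x] by (simp add: l_def)
  from zero[OF this] show ?thesis using b u[OF x(1)] by simp
qed

lemma p_sum: "(\<Sum>x\<in>F\<^sub>n. p x) = 1"
proof -
  have "(p has_sum (\<Sum>x\<in>F\<^sub>n. p x)) F"
    using states_upto_facts stationary_above_zero by (intro has_sum_finite_neutralI[of F\<^sub>n]) auto
  moreover have "(p has_sum 1) F" using stationary by (simp add: stationary_distribution_def)
  ultimately show ?thesis using has_sum_unique by blast
qed

lemma cap_level_mem: "z \<in> F \<Longrightarrow> cap_level n z \<in> F\<^sub>n"
  using phases[of "fst z"] phases[of n] n
  by (cases "fst z \<le> n") (auto simp: cap_level_def states_def states_upto_def min_def split: prod.splits)

lemma truncated_rate_has_sum:
  assumes x: "x \<in> F\<^sub>n" and y: "y \<in> F\<^sub>n"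
  shows "((\<lambda>z. Q x z * of_bool (cap_level n z = y)) has_sum lc_truncation n Q x y) F"
proof -
  obtain k i where x_eq: "x = (k, i)" by (cases x)
  obtain l j where y_eq: "y = (l, j)" by (cases y)
  have k: "k \<le> n" "x \<in> F" and l: "l \<le> n" "j \<le> S l" using x y states_upto_facts(2) by (auto simp: states_upto_def x_eq y_eq)
  show ?thesis
  proof (cases "l < n")
    case True
    then show ?thesis
      using y states_upto_facts(2) by (intro has_sum_finite_neutralI[of "{y}"])
        (auto simp: cap_level_def x_eq y_eq lc_truncation_def)
  next
    case False
    then have l: "l = n" "j \<le> S n" using l by auto
    let ?M = "{m. n < m \<and> m \<noteq> k}"
    have above: "(m, j) \<in> F" if "n < m" for m
      using that l n phases[of m] phases[of n] by (auto simp: states_def)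
    have inj: "inj_on (\<lambda>m. (m, j)) ?M" by (auto simp: inj_on_def)
    have "Q x summable_on F"
      using has_sum_imp_summable[OF row_sum] k by blast
    then have "Q x summable_on (\<lambda>m. (m, j)) ` ?M"
      by (rule summable_on_subset_banach) (auto intro: above)
    then have "(\<lambda>m. Q x (m, j)) summable_on ?M"
      using summable_on_reindex[OF inj, of "Q x"] by (simp add: o_def)
    then have "((\<lambda>m. Q x (m, j)) has_sum (\<Sum>\<^sub>\<infinity>m\<in>?M. Q x (m, j))) ?M"
      by (rule has_sum_infsum)
    then have "(Q x has_sum (\<Sum>\<^sub>\<infinity>m\<in>?M. Q x (m, j))) ((\<lambda>m. (m, j)) ` ?M)"
      using has_sum_reindex[OF inj, of "Q x"] by (simp add: o_def)
    then have "(Q x has_sum (Q x (n, j) + (\<Sum>\<^sub>\<infinity>m\<in>?M. Q x (m, j)))) (insert (n, j) ((\<lambda>m. (m, j)) ` ?M))"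
      by (rule has_sum_insert[rotated]) auto
    also have "Q x (n, j) + (\<Sum>\<^sub>\<infinity>m\<in>?M. Q x (m, j)) = lc_truncation n Q x y"
      using l by (simp add: x_eq y_eq lc_truncation_def)
    finally show ?thesis
      using k l above y states_upto_facts(2)
      by (subst has_sum_cong_neutral[where S = F and T = "insert (n, j) ((\<lambda>m. (m, j)) ` ?M)" and g = "Q x"])
        (auto simp: cap_level_def y_eq x_eq min_def split: if_splits)
  qed
qed

text \<open>
  The truncation sends a jump beyond level $n$ to level $n$ in the same phase. Started on the first $n + 1$ levels,
  its generator thus acts on $\phi$ as $Q$ acts on $\phi$ composed with \<open>cap_level\<close>.
\<close>

lemma capped_has_sum:
  assumes x: "x \<in> F\<^sub>n"
  shows "((\<lambda>z. Q x z * \<phi> (cap_level n z)) has_sum (\<Sum>y\<in>F\<^sub>n. lc_truncation n Q x y * \<phi> y)) F"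
proof -
  have sum: "((\<lambda>z. \<Sum>y\<in>F\<^sub>n. \<phi> y * (Q x z * of_bool (cap_level n z = y))) has_sum (\<Sum>y\<in>F\<^sub>n. \<phi> y * lc_truncation n Q x y)) F"
    by (intro has_sum_finite_sum has_sum_cmult_right truncated_rate_has_sum x)
  have eq: "(\<Sum>y\<in>F\<^sub>n. \<phi> y * (Q x z * of_bool (cap_level n z = y))) = Q x z * \<phi> (cap_level n z)" if "z \<in> F" for z
    using cap_level_mem[OF that] states_upto_facts(1) by (subst sum.remove[of _ "cap_level n z"]) (auto intro!: sum.neutral)
  have "(\<Sum>y\<in>F\<^sub>n. \<phi> y * lc_truncation n Q x y) = (\<Sum>y\<in>F\<^sub>n. lc_truncation n Q x y * \<phi> y)"
    by (simp only: mult.commute)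
  with sum has_sum_cong[of F, OF eq] show ?thesis by simp
qed

lemma capped_balance:
  assumes \<phi>: "\<And>x. x \<in> F\<^sub>n \<Longrightarrow> ((\<lambda>z. Q x z * \<phi> (cap_level n z)) has_sum c x) F"
  shows "(\<Sum>x\<in>F\<^sub>n. p x * c x) = 0"
proof -
  have bal: "(\<Sum>x\<in>F\<^sub>n. p x * lc_truncation n Q x y) = 0" if y: "y \<in> F\<^sub>n" for y
  proof -
    have "((\<lambda>x. p x * lc_truncation n Q x y) has_sum (\<Sum>x\<in>F\<^sub>n. p x * lc_truncation n Q x y)) F"
      using states_upto_facts stationary_above_zero by (intro has_sum_finite_neutralI[of F\<^sub>n]) auto
    moreover have "((\<lambda>x. p x * lc_truncation n Q x y) has_sum 0) F"
      using stationary y states_upto_facts(2) by (auto simp: stationary_distribution_def)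
    ultimately show ?thesis using has_sum_unique by blast
  qed
  have "c x = (\<Sum>y\<in>F\<^sub>n. lc_truncation n Q x y * \<phi> y)" if "x \<in> F\<^sub>n" for x
    using \<phi>[OF that] capped_has_sum[OF that, of \<phi>] by (rule has_sum_unique)
  then have "(\<Sum>x\<in>F\<^sub>n. p x * c x) = (\<Sum>x\<in>F\<^sub>n. \<Sum>y\<in>F\<^sub>n. p x * lc_truncation n Q x y * \<phi> y)"
    by (simp add: sum_distrib_left mult.assoc)
  also have "\<dots> = (\<Sum>y\<in>F\<^sub>n. (\<Sum>x\<in>F\<^sub>n. p x * lc_truncation n Q x y) * \<phi> y)"
    by (subst sum.swap) (simp add: sum_distrib_right)
  also have "\<dots> = 0" using bal by simp
  finally show ?thesis .
qed

text \<open>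
  Because $p$ annihilates its generator, $p \, Q h = p \, Q (h - h \circ \rho)$ with $\rho$ the capping map, and the
  difference vanishes up to level $n$.
\<close>

lemma perturbation_bound:
  assumes h: "\<And>x. x \<in> F\<^sub>n \<Longrightarrow> ((\<lambda>z. Q x z * h z) has_sum r x) F"
  shows "ennreal \<bar>\<Sum>x\<in>F\<^sub>n. p x * r x\<bar> \<le> (\<Sum>x\<in>F\<^sub>n. ennreal (p x) *
    (\<integral>\<^sup>+z. ennreal (Q x z) * ennreal (\<bar>h z\<bar> + \<bar>h (n, snd z)\<bar>) \<partial>count_space {z \<in> F. n < fst z}))"
proof -
  define c where "c x = (\<Sum>y\<in>F\<^sub>n. lc_truncation n Q x y * h y)" for x
  have c: "((\<lambda>z. Q x z * h (cap_level n z)) has_sum c x) F" if "x \<in> F\<^sub>n" for x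
    unfolding c_def using that by (rule capped_has_sum)
  have "\<bar>\<Sum>x\<in>F\<^sub>n. p x * r x\<bar> = \<bar>\<Sum>x\<in>F\<^sub>n. p x * (r x - c x)\<bar>"
    using capped_balance[OF c] by (simp add: right_diff_distrib sum_subtractf)
  also have "\<dots> \<le> (\<Sum>x\<in>F\<^sub>n. p x * \<bar>r x - c x\<bar>)"
    using states_upto_facts(2) p_nonneg by (intro order_trans[OF sum_abs] sum_mono) (auto simp: abs_mult)
  finally have "ennreal \<bar>\<Sum>x\<in>F\<^sub>n. p x * r x\<bar> \<le> ennreal (\<Sum>x\<in>F\<^sub>n. p x * \<bar>r x - c x\<bar>)"
    by (rule ennreal_leI)
  also have "\<dots> = (\<Sum>x\<in>F\<^sub>n. ennreal (p x) * ennreal \<bar>r x - c x\<bar>)"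
    using states_upto_facts(2) p_nonneg by (subst sum_ennreal[symmetric]) (auto simp: ennreal_mult subset_iff intro!: sum.cong)
  also have "\<dots> \<le> (\<Sum>x\<in>F\<^sub>n. ennreal (p x) *
      (\<integral>\<^sup>+z. ennreal (Q x z) * ennreal (\<bar>h z\<bar> + \<bar>h (n, snd z)\<bar>) \<partial>count_space {z \<in> F. n < fst z}))"
  proof (intro sum_mono mult_left_mono)
    fix x assume x: "x \<in> F\<^sub>n"
    have "((\<lambda>z. Q x z * h z + - (Q x z * h (cap_level n z))) has_sum r x + - c x) F"
      using h[OF x] c[OF x] by (intro has_sum_add) (auto simp: has_sum_uminus)
    then have "ennreal \<bar>r x + - c x\<bar> \<le> (\<integral>\<^sup>+z. ennreal \<bar>Q x z * h z + - (Q x z * h (cap_level n z))\<bar> \<partial>count_space F)"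
      by (rule ennreal_abs_has_sum_le)
    also have "\<dots> = (\<integral>\<^sup>+z. ennreal \<bar>Q x z * h z + - (Q x z * h (cap_level n z))\<bar> \<partial>count_space {z \<in> F. n < fst z})"
      by (intro nn_integral_count_space_eq) (auto simp: cap_level_def min_def)
    also have "\<dots> \<le> (\<integral>\<^sup>+z. ennreal (Q x z) * ennreal (\<bar>h z\<bar> + \<bar>h (n, snd z)\<bar>) \<partial>count_space {z \<in> F. n < fst z})"
    proof (rule nn_integral_mono)
      fix z assume "z \<in> space (count_space {z \<in> F. n < fst z})"
      then have z: "z \<in> F" "n < fst z" by auto
      then have cap: "cap_level n z = (n, snd z)" by (simp add: cap_level_def)
      have "x \<in> F" "x \<noteq> z" using x z states_upto_facts(4)[of x] by auto
      then have q: "0 \<le> Q x z" using z by (intro off_diagonal)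
      have "\<bar>Q x z * h z + - (Q x z * h (cap_level n z))\<bar> = Q x z * \<bar>h z - h (n, snd z)\<bar>"
        using q unfolding cap by (simp add: abs_mult right_diff_distrib[symmetric])
      also have "\<dots> \<le> Q x z * (\<bar>h z\<bar> + \<bar>h (n, snd z)\<bar>)"
        using q by (intro mult_left_mono abs_triangle_ineq4)
      finally show "ennreal \<bar>Q x z * h z + - (Q x z * h (cap_level n z))\<bar> \<le> ennreal (Q x z) * ennreal (\<bar>h z\<bar> + \<bar>h (n, snd z)\<bar>)"
        unfolding ennreal_mult'[OF q, symmetric] by (rule ennreal_leI)
    qed
    finally have "ennreal \<bar>r x + - c x\<bar> \<le> (\<integral>\<^sup>+z. ennreal (Q x z) * ennreal (\<bar>h z\<bar> + \<bar>h (n, snd z)\<bar>) \<partial>count_space {z \<in> F. n < fst z})" .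
    then show "ennreal \<bar>r x - c x\<bar> \<le> (\<integral>\<^sup>+z. ennreal (Q x z) * ennreal (\<bar>h z\<bar> + \<bar>h (n, snd z)\<bar>) \<partial>count_space {z \<in> F. n < fst z})"
      by simp
  qed simp
  finally show ?thesis .
qed

lemma levelwise_le_cap:
  assumes v: "levelwise_nondecreasing S v" and z: "z \<in> F" "n < fst z"
  shows "v (n, snd z) \<le> v z"
proof -
  have "v (n, j) \<le> v (n + d, j)" if "j \<le> S 1" for d j
  proof (induction d)
    case (Suc d)
    have "v (n + d, j) \<le> v (n + d + 1, j)"
      using v that n phases[of "n + d"] by (simp add: levelwise_nondecreasing_def)
    with Suc show ?case by simp
  qed simp
  from this[of "snd z" "fst z - n"] show ?thesis
    using z phases[of "fst z"] n by (auto simp: states_def)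
qed

text \<open>
  Capping can only lower a level-wise nondecreasing $v$, so the drift of $v$ under the truncation is at most the
  drift under $Q$.
\<close>

lemma truncated_drift:
  assumes v: "levelwise_nondecreasing S v"
    and drift: "\<And>x. x \<in> F \<Longrightarrow> (\<lambda>z. Q x z * v z) summable_on F"
      "\<And>x. x \<in> F \<Longrightarrow> (\<Sum>\<^sub>\<infinity>z\<in>F. Q x z * v z) \<le> - f x + b"
  shows "(\<Sum>x\<in>F\<^sub>n. p x * f x) \<le> b"
proof -
  define c where "c x = (\<Sum>y\<in>F\<^sub>n. lc_truncation n Q x y * v y)" for x
  have c: "((\<lambda>z. Q x z * v (cap_level n z)) has_sum c x) F" if "x \<in> F\<^sub>n" for x
    unfolding c_def using that by (rule capped_has_sum)
  have le: "c x \<le> - f x + b" if x: "x \<in> F\<^sub>n" for x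
  proof -
    have xF: "x \<in> F" using x states_upto_facts(2) by auto
    have "c x \<le> (\<Sum>\<^sub>\<infinity>z\<in>F. Q x z * v z)"
      using c[OF x] has_sum_infsum[OF drift(1)[OF xF]]
    proof (rule has_sum_mono)
      fix z assume z: "z \<in> F"
      show "Q x z * v (cap_level n z) \<le> Q x z * v z"
      proof (cases "n < fst z")
        case True
        then have "x \<noteq> z" using x states_upto_facts(4)[of x] by auto
        then show ?thesis
          using levelwise_le_cap[OF v z True] off_diagonal[of x z] xF z True
          by (auto simp: cap_level_def intro!: mult_left_mono)
      qed (simp add: cap_level_def)
    qed
    with drift(2)[OF xF] show ?thesis by simp
  qed
  have "0 = (\<Sum>x\<in>F\<^sub>n. p x * c x)" using capped_balance[OF c] by simp
  also have "\<dots> \<le> (\<Sum>x\<in>F\<^sub>n. p x * (- f x + b))"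
    using le p_nonneg states_upto_facts(2) by (intro sum_mono mult_left_mono) auto
  also have "\<dots> = b * (\<Sum>x\<in>F\<^sub>n. p x) - (\<Sum>x\<in>F\<^sub>n. p x * f x)"
    by (simp add: algebra_simps sum.distrib sum_distrib_left sum_subtractf)
  finally show ?thesis by (simp add: p_sum)
qed

end

section \<open>The error bounds\<close>

text \<open>
  Half of the supremum is certainly exceeded. This factor is the $2$ in the constant $2 b / (\beta \overline\phi_K)$.
\<close>

lemma phi_bar_witness:
  assumes semigroup: "generated_semigroup (states S) P Q" and \<beta>: "0 < \<beta>"
  obtains y where "y \<in> states S" "0 < phi_bar S \<beta> P K"
    "\<And>x. x \<in> states_upto S K \<Longrightarrow> phi_bar S \<beta> P K / 2 \<le> resolvent \<beta> P x y"
proof -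
  interpret generated_semigroup "states S" P Q by fact
  define m where "m y = Min ((\<lambda>x. resolvent \<beta> P x y) ` states_upto S K)" for y
  have fin: "finite ((\<lambda>x. resolvent \<beta> P x y) ` states_upto S K)" and ne: "states_upto S K \<noteq> {}" for y
    using states_upto_finite[of S K] by (auto simp: states_upto_def)
  have sub: "x \<in> states S" if "x \<in> states_upto S K" for x
    using that by (auto simp: states_def states_upto_def)
  have m: "0 < m y" "m y \<le> 1" if y: "y \<in> states S" for y
  proof -
    interpret discounted_semigroup "states S" P Q \<beta> y
      by unfold_locales (use \<beta> y in auto)
    show "0 < m y"
      unfolding m_def using fin ne resolvent_pos sub by (subst Min_gr_iff) auto
    obtain x where "x \<in> states_upto S K" using ne by auto
    then show "m y \<le> 1"
      unfolding m_def using fin resolvent_le_1[OF sub, of x] by (intro Min.coboundedI[THEN order_trans]) auto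
  qed
  have phi: "phi_bar S \<beta> P K = (SUP y\<in>states S. m y)"
    by (simp add: phi_bar_def m_def)
  have bdd: "bdd_above (m ` states S)" using m(2) by (intro bdd_aboveI2)
  have zero: "(0, 0) \<in> states S" by (simp add: states_def)
  have pos: "0 < phi_bar S \<beta> P K"
    using m(1)[OF zero] cSUP_upper[OF zero bdd] by (simp add: phi)
  then have "phi_bar S \<beta> P K / 2 < (SUP y\<in>states S. m y)"
    by (simp add: phi[symmetric])
  then obtain y where y: "y \<in> states S" "phi_bar S \<beta> P K / 2 < m y"
    using less_cSUP_iff[OF _ bdd] zero by blast
  show ?thesis
  proof (rule that[OF y(1) pos])
    fix x assume "x \<in> states_upto S K"
    then have "m y \<le> resolvent \<beta> P x y"
      unfolding m_def using fin by (intro Min_le) auto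
    then show "phi_bar S \<beta> P K / 2 \<le> resolvent \<beta> P x y" using y(2) by simp
  qed
qed

lemma row_times_col_eq_nn_integral:
  "row_times_col F p g = (\<integral>\<^sup>+x. ennreal (p x) * ennreal (g x) \<partial>count_space F)"
  by (simp add: row_times_col_def nn_integral_count_space_eq_infsum)

lemma sum_states_upto: "(\<Sum>k\<le>n. \<Sum>i\<le>S k. X (k, i)) = (\<Sum>x\<in>states_upto S n. X x)"
proof -
  have "states_upto S n = Sigma {..n} (\<lambda>k. {..S k})" by (auto simp: states_upto_def)
  then show ?thesis by (simp add: sum.Sigma case_prod_unfold)
qed

lemma err_eq:
  "err S Q v c p n = 2 * (\<Sum>x\<in>states_upto S n. ennreal (p x) *
    (\<integral>\<^sup>+z. ennreal (Q x z) * (ennreal (v z) + ennreal (v (n, snd z)) + 2 * c) \<partial>count_space {z \<in> states S. n < fst z}))"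
  unfolding err_def sum_states_upto[symmetric]
  using block_series_eq_nn_integral[of S Q _ 0 "\<lambda>m j. ennreal (v (m, j)) + ennreal (v (n, j)) + 2 * c" _ n] by simp

lemma err_plus_eq:
  "err_plus S Q v c p n = 4 * (\<Sum>x\<in>states_upto S n. ennreal (p x) *
    (\<integral>\<^sup>+z. ennreal (Q x z) * (ennreal (v z) + c) \<partial>count_space {z \<in> states S. n < fst z}))"
  unfolding err_plus_def sum_states_upto[symmetric]
  using block_series_eq_nn_integral[of S Q _ 0 "\<lambda>m j. ennreal (v (m, j)) + c" _ n] by simp

lemma half_times_double: "(a / 2) * (2 * x) = a * (x :: ennreal)"
proof -
  have "inverse (2 :: ennreal) * 2 = 1"
    using ennreal_inverse_mult[of 2] ennreal_divide_self[of 2] by (simp add: divide_ennreal_def mult.commute)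
  then show ?thesis by (simp add: divide_ennreal_def mult.assoc) (metis mult.assoc mult.left_neutral)
qed

text \<open>
  Combines the Poisson equation for the killed state of \<open>phi_bar_witness\<close> with the perturbation bound; the
  solution satisfies $|h| \le (1 + \pi g) (v + c)$. Finiteness of $\pi g$ comes from the Poisson equation for $g$
  itself.
\<close>

lemma truncation_error:
  assumes semigroup: "generated_semigroup (states S) P Q"
    and tails: "controlled_tails S Q T V a r\<^sub>1"
    and truncated: "lc_truncated S Q n p"
    and \<pi>: "stationary_distribution (states S) Q \<pi>" and \<beta>: "0 < \<beta>"
    and b: "0 < b" and v: "\<And>x. x \<in> states S \<Longrightarrow> 0 \<le> v x" and f: "\<And>x. x \<in> states S \<Longrightarrow> 1 \<le> f x"
    and drift: "drift_condition (states S) Q v f b (states_upto S K)"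
    and g: "\<And>x. x \<in> states S \<Longrightarrow> 0 \<le> g x" "\<And>x. x \<in> states S \<Longrightarrow> g x \<le> f x"
  defines "c \<equiv> err_const (states S) \<pi> v b \<beta> (phi_bar S \<beta> P K)"
  shows "row_times_col (states S) (\<lambda>x. \<bar>\<pi> x - p x\<bar>) g \<le> (row_times_col (states S) \<pi> g + 1) / 2 * err S Q v c p n"
    and "row_times_col (states S) \<pi> g < \<infinity>"
proof -
  let ?F = "states S" and ?C = "count_space {z \<in> states S. n < fst z}"
  interpret G: generated_semigroup ?F P Q by fact
  interpret controlled_tails S Q T V a r\<^sub>1 by fact
  interpret L: lc_truncated S Q n p by fact
  obtain y where y: "y \<in> ?F" and phi: "0 < phi_bar S \<beta> P K"
    and u_ge: "\<And>x. x \<in> states_upto S K \<Longrightarrow> phi_bar S \<beta> P K / 2 \<le> resolvent \<beta> P x y"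
    using phi_bar_witness[OF semigroup \<beta>] by blast
  interpret D: discounted_semigroup ?F P Q \<beta> y
    by unfold_locales (use \<beta> y in auto)
  define u where "u x = resolvent \<beta> P x y" for x
  have u: "0 < u x" "u x \<le> 1" "((\<lambda>z. Q x z * u z) has_sum \<beta> * (u x - of_bool (x = y))) ?F" if "x \<in> ?F" for x
    using D.resolvent_pos[OF that] D.resolvent_le_1[OF that] D.resolvent_equation[OF that] by (simp_all add: u_def)
  \<comment> \<open>The multiple of 1 - u whose drift absorbs b on the first K + 1 levels, where u is at least half of the
    supremum.\<close>
  define c' where "c' = 2 * b / (\<beta> * phi_bar S \<beta> P K)"
  have c': "0 < c'" using b \<beta> phi by (simp add: c'_def)
  define w where "w x = v x + c' * (1 - u x)" for x
  have w: "v x \<le> w x" "w x \<le> v x + c'" "0 \<le> w x" if "x \<in> ?F" for x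
  proof -
    have "0 \<le> c' * (1 - u x)" "c' * (1 - u x) \<le> c'"
      using c' u[OF that] by (auto intro!: mult_left_le)
    then show "v x \<le> w x" "w x \<le> v x + c'" "0 \<le> w x" using v[OF that] by (auto simp: w_def)
  qed
  have w_sum: "((\<lambda>z. Q x z * w z) has_sum (\<Sum>\<^sub>\<infinity>z\<in>?F. Q x z * v z) - c' * (\<beta> * (u x - of_bool (x = y)))) ?F"
    if x: "x \<in> ?F" for x
  proof -
    have "((\<lambda>z. Q x z * v z + (c' * Q x z + (- c') * (Q x z * u z))) has_sum
        (\<Sum>\<^sub>\<infinity>z\<in>?F. Q x z * v z) + (c' * 0 + (- c') * (\<beta> * (u x - of_bool (x = y))))) ?F"
      using drift x by (intro has_sum_add has_sum_cmult_right has_sum_infsum row_sum u) (auto simp: drift_condition_def)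
    then show ?thesis by (simp add: w_def algebra_simps)
  qed
  have w_drift: "(\<Sum>\<^sub>\<infinity>z\<in>?F. Q x z * w z) \<le> - f x" if x: "x \<in> ?F - {y}" for x
  proof -
    have "(\<Sum>\<^sub>\<infinity>z\<in>?F. Q x z * w z) = (\<Sum>\<^sub>\<infinity>z\<in>?F. Q x z * v z) - c' * (\<beta> * u x)"
      using infsumI[OF w_sum[of x]] x by simp
    also have "(\<Sum>\<^sub>\<infinity>z\<in>?F. Q x z * v z) \<le> - f x + b * indicator (states_upto S K) x"
      using drift x by (simp add: drift_condition_def)
    also have "b * indicator (states_upto S K) x \<le> c' * (\<beta> * u x)"
    proof (cases "x \<in> states_upto S K")
      case True
      have "b = c' * (\<beta> * (phi_bar S \<beta> P K / 2))"
        using \<beta> phi by (simp add: c'_def field_simps)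
      also have "\<dots> \<le> c' * (\<beta> * u x)"
        using u_ge[OF True] c' \<beta> by (intro mult_left_mono) (auto simp: u_def)
      finally show ?thesis using True by simp
    next
      case False
      have "0 \<le> c' * (\<beta> * u x)" using c' \<beta> u(1)[of x] x by simp
      then show ?thesis using False by simp
    qed
    finally show ?thesis by simp
  qed
  have exit_pos: "0 < exit_rate x" if x: "x \<in> ?F - {y}" for x
  proof -
    have "((\<lambda>z. Q x z * u z) has_sum \<beta> * u x + exit_rate x * u x) (?F - {x})"
      using has_sum_off_diagonal[of x u "\<beta> * u x"] u(3)[of x] x by simp
    then have "\<beta> * u x + exit_rate x * u x \<le> exit_rate x"
      using exit_rate_has_sum[of x]
      by (rule has_sum_mono) (use x u off_diagonal[of x] in \<open>auto intro!: mult_left_le\<close>)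
    moreover have "0 < \<beta> * u x" "0 \<le> exit_rate x * u x" using \<beta> u(1)[of x] exit_rate_nonneg[of x] x by auto
    ultimately show ?thesis by linarith
  qed
  interpret R: rates_killed_at ?F Q y
    by unfold_locales (use y exit_pos in auto)
  define B where "B = r\<^sub>1 / a_min * (ln (T 0) + T 1)"
  have B: "0 \<le> B"
    unfolding B_def using r\<^sub>1 a_min_pos T_ge_1[of 0] T_ge_1[of 1] by (intro mult_nonneg_nonneg) auto
  \<comment> \<open>The second summand has drift at most -(B + 1), which outweighs the drift B of the first.\<close>
  define W where "W x = ln (T (real (fst x))) + (B + 1) * w x" for x
  have W_sum: "((\<lambda>z. Q x z * W z) has_sum (\<Sum>\<^sub>\<infinity>z\<in>?F. Q x z * ln (T (real (fst z)))) + (B + 1) * (\<Sum>\<^sub>\<infinity>z\<in>?F. Q x z * w z)) ?F"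
    if x: "x \<in> ?F" for x
  proof -
    have "((\<lambda>z. Q x z * ln (T (real (fst z))) + (B + 1) * (Q x z * w z)) has_sum
      (\<Sum>\<^sub>\<infinity>z\<in>?F. Q x z * ln (T (real (fst z)))) + (B + 1) * (\<Sum>\<^sub>\<infinity>z\<in>?F. Q x z * w z)) ?F"
      by (intro has_sum_add has_sum_cmult_right has_sum_infsum log_level_drift x has_sum_imp_summable[OF w_sum[OF x]])
    then show ?thesis by (simp add: W_def algebra_simps)
  qed
  have absorbed: "R.hitting_cost (\<lambda>x. Q x y) x = 1" if "x \<in> ?F - {y}" for x
  proof (rule R.absorption[OF _ _ _ _ that])
    have ln0: "0 \<le> ln (T (real k))" for k using T_ge_1[of k] by simp
    show "0 \<le> W x" if "x \<in> ?F" for x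
      unfolding W_def using B w(3)[OF that] ln0 by simp
    show "finite {x \<in> ?F. W x \<le> c}" for c
    proof (rule finite_subset[OF _ log_level_sublevel_finite])
      show "{x \<in> ?F. W x \<le> c} \<subseteq> {x \<in> ?F. ln (T (real (fst x))) \<le> c}"
      proof safe
        fix k i assume "(k, i) \<in> ?F" "W (k, i) \<le> c"
        moreover have "0 \<le> (B + 1) * w (k, i)" using B w(3)[OF \<open>(k, i) \<in> ?F\<close>] by simp
        ultimately show "ln (T (real (fst (k, i)))) \<le> c" by (simp add: W_def)
      qed
    qed
    fix x assume x: "x \<in> ?F - {y}"
    then have xF: "x \<in> ?F" by simp
    show "(\<lambda>z. Q x z * W z) summable_on ?F" using W_sum[OF xF] by (rule has_sum_imp_summable)
    have "(B + 1) * (\<Sum>\<^sub>\<infinity>z\<in>?F. Q x z * w z) \<le> (B + 1) * - 1"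
      using w_drift[OF x] f[OF xF] B by (intro mult_left_mono) auto
    also have "(B + 1) * - 1 = - B - 1" by simp
    finally have "(B + 1) * (\<Sum>\<^sub>\<infinity>z\<in>?F. Q x z * w z) \<le> - B - 1" .
    moreover have "(\<Sum>\<^sub>\<infinity>z\<in>?F. Q x z * ln (T (real (fst z)))) \<le> B"
      using log_level_drift(2)[OF xF] by (simp only: B_def)
    ultimately show "(\<Sum>\<^sub>\<infinity>z\<in>?F. Q x z * W z) < 0"
      unfolding infsumI[OF W_sum[OF xF]] by linarith
  qed
  have \<pi>': "0 \<le> \<pi> x" "((\<lambda>z. \<pi> z * Q z x) has_sum 0) ?F" "(\<pi> has_sum 1) ?F" if "x \<in> ?F" for x
    using \<pi> that by (auto simp: stationary_distribution_def)
  note poisson = R.poisson_solution[OF f w(3) has_sum_imp_summable[OF w_sum] w_drift \<pi>'(1,2) \<pi>'(3)[OF y] absorbed]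
  have "(\<lambda>x. \<pi> x * \<bar>g x\<bar>) summable_on ?F"
    by (rule poisson[of g]) (use g in auto)
  then have \<pi>g: "(\<lambda>x. \<pi> x * g x) summable_on ?F"
    using g by (simp cong: summable_on_cong)
  have row: "row_times_col ?F \<pi> g = ennreal (\<Sum>\<^sub>\<infinity>x\<in>?F. \<pi> x * g x)"
  proof -
    have "row_times_col ?F \<pi> g = (\<integral>\<^sup>+x. ennreal (\<pi> x * g x) \<partial>count_space ?F)"
      unfolding row_times_col_eq_nn_integral using g \<pi>' by (intro nn_integral_cong) (auto simp: ennreal_mult)
    also have "\<dots> = ennreal (\<Sum>\<^sub>\<infinity>x\<in>?F. \<pi> x * g x)"
      using has_sum_infsum[OF \<pi>g] g \<pi>' by (subst (asm) has_sum_iff_nn_integral) (auto intro!: infsum_nonneg)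
    finally show ?thesis .
  qed
  then show "row_times_col ?F \<pi> g < \<infinity>" by simp
  \<comment> \<open>With this sign the error becomes a difference of two expectations.\<close>
  define s\<^sub>g where "s\<^sub>g x = sgn (p x - \<pi> x) * g x" for x
  have sg: "\<bar>s\<^sub>g x\<bar> \<le> g x" if "x \<in> ?F" for x
    using g(1)[OF that] by (auto simp: s\<^sub>g_def abs_mult sgn_if)
  have sgf: "\<bar>s\<^sub>g x\<bar> \<le> f x" if "x \<in> ?F" for x using sg[OF that] g(2)[OF that] by simp
  obtain h s where s: "((\<lambda>x. \<pi> x * s\<^sub>g x) has_sum s) ?F" "(\<lambda>x. \<pi> x * \<bar>s\<^sub>g x\<bar>) summable_on ?F"
    and h: "\<And>x. x \<in> ?F \<Longrightarrow> ((\<lambda>z. Q x z * h z) has_sum s - s\<^sub>g x) ?F"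
    and h_le: "\<And>x. x \<in> ?F \<Longrightarrow> \<bar>h x\<bar> \<le> (1 + (\<Sum>\<^sub>\<infinity>z\<in>?F. \<pi> z * \<bar>s\<^sub>g z\<bar>)) * w x"
    by (rule poisson[of s\<^sub>g]) (use sgf in blast)+
  define t where "t = (\<Sum>\<^sub>\<infinity>x\<in>?F. \<pi> x * g x)"
  have t: "(\<Sum>\<^sub>\<infinity>z\<in>?F. \<pi> z * \<bar>s\<^sub>g z\<bar>) \<le> t"
    unfolding t_def using sg \<pi>' by (intro infsum_mono s(2) \<pi>g mult_left_mono) auto
  have t0: "0 \<le> t" unfolding t_def using g \<pi>' by (intro infsum_nonneg) auto
  have hw: "\<bar>h x\<bar> \<le> (1 + t) * (v x + c')" if "x \<in> ?F" for x
    using h_le[OF that] w[OF that] t t0 by (elim order_trans) (intro mult_mono, auto)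
  let ?D = "(\<Sum>x\<in>states_upto S n. p x * s\<^sub>g x) - s"
  have ps: "((\<lambda>x. p x * s\<^sub>g x) has_sum (\<Sum>x\<in>states_upto S n. p x * s\<^sub>g x)) ?F"
    using L.states_upto_facts L.stationary_above_zero by (intro has_sum_finite_neutralI[of "states_upto S n"]) auto
  have "((\<lambda>x. p x * s\<^sub>g x + - (\<pi> x * s\<^sub>g x)) has_sum (\<Sum>x\<in>states_upto S n. p x * s\<^sub>g x) + - s) ?F"
    using ps s(1) by (intro has_sum_add) (auto simp: has_sum_uminus)
  moreover have "p x * s\<^sub>g x + - (\<pi> x * s\<^sub>g x) = \<bar>\<pi> x - p x\<bar> * g x" for x
    by (auto simp: s\<^sub>g_def sgn_if algebra_simps)
  ultimately have D: "((\<lambda>x. \<bar>\<pi> x - p x\<bar> * g x) has_sum ?D) ?F" by simp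
  have D0: "0 \<le> ?D" using D by (rule has_sum_nonneg) (use g in auto)
  have "row_times_col ?F (\<lambda>x. \<bar>\<pi> x - p x\<bar>) g = (\<integral>\<^sup>+x. ennreal (\<bar>\<pi> x - p x\<bar> * g x) \<partial>count_space ?F)"
    unfolding row_times_col_eq_nn_integral using g by (intro nn_integral_cong) (auto simp: ennreal_mult)
  also have "\<dots> = ennreal ?D"
    using D D0 g by (subst (asm) has_sum_iff_nn_integral) auto
  also have "?D = \<bar>\<Sum>x\<in>states_upto S n. p x * (s - s\<^sub>g x)\<bar>"
  proof -
    have "(\<Sum>x\<in>states_upto S n. p x * (s - s\<^sub>g x)) = s * (\<Sum>x\<in>states_upto S n. p x) - (\<Sum>x\<in>states_upto S n. p x * s\<^sub>g x)"
      by (simp add: algebra_simps sum_subtractf sum_distrib_left)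
    then show ?thesis using D0 by (simp add: L.p_sum)
  qed
  also have "ennreal \<bar>\<Sum>x\<in>states_upto S n. p x * (s - s\<^sub>g x)\<bar> \<le> (\<Sum>x\<in>states_upto S n. ennreal (p x) *
      (\<integral>\<^sup>+z. ennreal (Q x z) * ennreal (\<bar>h z\<bar> + \<bar>h (n, snd z)\<bar>) \<partial>?C))"
    using L.states_upto_facts(2) by (intro L.perturbation_bound h) auto
  also have "\<dots> \<le> (\<Sum>x\<in>states_upto S n. ennreal (p x) *
      (\<integral>\<^sup>+z. (row_times_col ?F \<pi> g + 1) * (ennreal (Q x z) * (ennreal (v z) + ennreal (v (n, snd z)) + 2 * c)) \<partial>?C))"
  proof (intro sum_mono mult_left_mono nn_integral_mono)
    fix x z assume "z \<in> space ?C"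
    then have z: "z \<in> ?F" "(n, snd z) \<in> ?F"
      using L.n L.phases[of n] L.phases[of "fst z"] by (auto simp: states_def)
    have "\<bar>h z\<bar> + \<bar>h (n, snd z)\<bar> \<le> (1 + t) * (v z + c') + (1 + t) * (v (n, snd z) + c')"
      by (intro add_mono hw z)
    also have "\<dots> = (t + 1) * (v z + v (n, snd z) + 2 * c')" by (simp add: algebra_simps)
    finally have "ennreal (\<bar>h z\<bar> + \<bar>h (n, snd z)\<bar>) \<le> ennreal ((t + 1) * (v z + v (n, snd z) + 2 * c'))"
      by (rule ennreal_leI)
    also have "\<dots> = (ennreal t + 1) * (ennreal (v z) + ennreal (v (n, snd z)) + 2 * ennreal c')"
      using t0 v[OF z(1)] v[OF z(2)] c' by (simp add: ennreal_mult)
    also have "\<dots> \<le> (row_times_col ?F \<pi> g + 1) * (ennreal (v z) + ennreal (v (n, snd z)) + 2 * c)"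
      unfolding row t_def[symmetric] c_def err_const_def c'_def[symmetric]
      by (intro mult_left_mono add_left_mono) auto
    finally have "ennreal (Q x z) * ennreal (\<bar>h z\<bar> + \<bar>h (n, snd z)\<bar>)
        \<le> ennreal (Q x z) * ((row_times_col ?F \<pi> g + 1) * (ennreal (v z) + ennreal (v (n, snd z)) + 2 * c))"
      by (rule mult_left_mono) simp
    then show "ennreal (Q x z) * ennreal (\<bar>h z\<bar> + \<bar>h (n, snd z)\<bar>)
        \<le> (row_times_col ?F \<pi> g + 1) * (ennreal (Q x z) * (ennreal (v z) + ennreal (v (n, snd z)) + 2 * c))"
      by (simp only: mult.left_commute)
  qed simp
  also have "\<dots> = (row_times_col ?F \<pi> g + 1) * (\<Sum>x\<in>states_upto S n. ennreal (p x) *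
      (\<integral>\<^sup>+z. ennreal (Q x z) * (ennreal (v z) + ennreal (v (n, snd z)) + 2 * c) \<partial>?C))"
    unfolding sum_distrib_left
    by (simp only: nn_integral_cmult borel_measurable_count_space) (simp only: mult.left_commute)
  also have "\<dots> = (row_times_col ?F \<pi> g + 1) / 2 * err S Q v c p n"
    by (simp only: err_eq half_times_double)
  finally show "row_times_col ?F (\<lambda>x. \<bar>\<pi> x - p x\<bar>) g \<le> (row_times_col ?F \<pi> g + 1) / 2 * err S Q v c p n" .
qed

lemma err_le_err_plus:
  assumes "lc_truncated S Q n p" and v: "levelwise_nondecreasing S v"
  shows "err S Q v c p n \<le> err_plus S Q v c p n"
proof -
  interpret lc_truncated S Q n p by fact
  let ?C = "count_space {z \<in> states S. n < fst z}"
  have "err S Q v c p n \<le> 2 * (\<Sum>x\<in>states_upto S n. ennreal (p x) * (\<integral>\<^sup>+z. 2 * (ennreal (Q x z) * (ennreal (v z) + c)) \<partial>?C))"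
    unfolding err_eq
  proof (intro mult_left_mono sum_mono nn_integral_mono)
    fix x z assume "z \<in> space ?C"
    then have "ennreal (v (n, snd z)) \<le> ennreal (v z)"
      using levelwise_le_cap[OF v, of z] by (intro ennreal_leI) auto
    then have "ennreal (v z) + ennreal (v (n, snd z)) + 2 * c \<le> ennreal (v z) + ennreal (v z) + 2 * c"
      by (intro add_mono order_refl)
    also have "\<dots> = 2 * (ennreal (v z) + c)" by (simp only: distrib_left mult_2)
    finally have "ennreal (Q x z) * (ennreal (v z) + ennreal (v (n, snd z)) + 2 * c) \<le> ennreal (Q x z) * (2 * (ennreal (v z) + c))"
      by (rule mult_left_mono) simp
    then show "ennreal (Q x z) * (ennreal (v z) + ennreal (v (n, snd z)) + 2 * c) \<le> 2 * (ennreal (Q x z) * (ennreal (v z) + c))"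
      by (simp only: mult.left_commute)
  qed auto
  also have "\<dots> = 2 * (2 * (\<Sum>x\<in>states_upto S n. ennreal (p x) * (\<integral>\<^sup>+z. ennreal (Q x z) * (ennreal (v z) + c) \<partial>?C)))"
    by (simp only: sum_distrib_left nn_integral_cmult borel_measurable_count_space mult.left_commute)
  also have "\<dots> = err_plus S Q v c p n"
    unfolding err_plus_eq mult.assoc[symmetric] by simp
  finally show ?thesis .
qed

text \<open>
  The flux of $v$ out of the first $n + 1$ levels is bounded by \<open>outflow_le\<close> and the second drift condition.
  The constant $c$ multiplies the flux of mass, which is smaller by the factor $\underline a^{-1} / V(n + 1)$ since $v$ is at
  least $\underline a \, V(n + 1)$ beyond level $n$.
\<close>

lemma err_plus_le:
  assumes tails: "controlled_tails S Q T V a r\<^sub>1" and truncated: "lc_truncated S Q n p"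
    and v: "\<And>m j. 1 \<le> m \<Longrightarrow> j \<le> S 1 \<Longrightarrow> v (m, j) = V (real m) * a j"
    and f': "\<And>x. x \<in> states S \<Longrightarrow> 1 \<le> f' x" and r\<^sub>0: "0 < r\<^sub>0" "r0_sup S T V f' \<le> ennreal r\<^sub>0"
    and pf: "(\<Sum>x\<in>states_upto S n. p x * f' x) \<le> b'"
  shows "err_plus S Q v c p n \<le> ennreal (4 * r\<^sub>0 * r\<^sub>1 * b' / T (real n)) *
      (1 + ennreal (inverse (MIN i\<in>{..S 1}. a i) / V (real (n + 1))) * c)"
proof -
  interpret controlled_tails S Q T V a r\<^sub>1 by fact
  interpret L: lc_truncated S Q n p by fact
  let ?C = "count_space {z \<in> states S. n < fst z}"
  define \<kappa> where "\<kappa> = ennreal (inverse a_min / V (real (n + 1)))"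
  define I where "I x = (\<integral>\<^sup>+z. ennreal (Q x z) * ennreal (v z) \<partial>?C)" for x
  have T0: "0 < T (real n)" using T_ge_1[of n] by simp
  have mass: "(\<integral>\<^sup>+z. ennreal (Q x z) * (ennreal (v z) + c) \<partial>?C) \<le> I x * (1 + \<kappa> * c)" for x
  proof -
    have "(\<integral>\<^sup>+z. ennreal (Q x z) * (ennreal (v z) + c) \<partial>?C) = I x + (\<integral>\<^sup>+z. ennreal (Q x z) \<partial>?C) * c"
      unfolding I_def distrib_left by (subst nn_integral_add) (simp_all add: nn_integral_multc)
    also have "\<dots> \<le> I x + (\<kappa> * I x) * c"
      unfolding I_def \<kappa>_def by (intro add_left_mono mult_right_mono outflow_rate_le v) auto
    also have "\<dots> = I x * (1 + \<kappa> * c)" by (simp only: distrib_left mult_1_right mult.assoc mult.left_commute)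
    finally show ?thesis .
  qed
  have TV: "T (real (fst x)) * V (real (fst x)) \<le> r\<^sub>0 * f' x" if x: "x \<in> states S" for x
  proof -
    have "ennreal (T (real (fst x)) * V (real (fst x)) / f' x) \<le> r0_sup S T V f'"
      unfolding r0_sup_def using x by (intro SUP_upper2[of x]) (auto split: prod.splits)
    also have "\<dots> \<le> ennreal r\<^sub>0" by (rule r\<^sub>0)
    finally have "T (real (fst x)) * V (real (fst x)) / f' x \<le> r\<^sub>0"
      using r\<^sub>0 by (simp add: ennreal_le_iff)
    then show ?thesis using f'[OF x] by (simp add: divide_le_eq)
  qed
  have flow: "ennreal (T (real n)) * I x \<le> ennreal (r\<^sub>0 * r\<^sub>1 * f' x)" if x: "x \<in> states_upto S n" for x
  proof -
    obtain k i where ki: "x = (k, i)" "k \<le> n" "i \<le> S k" using x by (auto simp: states_upto_def)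
    have "ennreal (T (real n)) * I x \<le> ennreal (T (real k) * V (real k) * r\<^sub>1)"
      unfolding I_def ki(1) using ki by (intro outflow_le v) auto
    also have "\<dots> \<le> ennreal (r\<^sub>0 * r\<^sub>1 * f' x)"
    proof (rule ennreal_leI)
      have "T (real k) * V (real k) * r\<^sub>1 \<le> (r\<^sub>0 * f' x) * r\<^sub>1"
        using TV[of x] ki r\<^sub>1 by (intro mult_right_mono) (auto simp: states_def)
      then show "T (real k) * V (real k) * r\<^sub>1 \<le> r\<^sub>0 * r\<^sub>1 * f' x" by (simp add: mult_ac)
    qed
    finally show ?thesis .
  qed
  have p0: "0 \<le> p x" and f0: "0 \<le> f' x" if "x \<in> states_upto S n" for x
  proof -
    have "x \<in> states S" using that L.states_upto_facts(2) by blast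
    then show "0 \<le> p x" "0 \<le> f' x" using L.p_nonneg[of x] f'[of x] by auto
  qed
  have "ennreal (T (real n)) * (\<Sum>x\<in>states_upto S n. ennreal (p x) * I x)
      = (\<Sum>x\<in>states_upto S n. ennreal (p x) * (ennreal (T (real n)) * I x))"
    by (simp only: sum_distrib_left mult.left_commute)
  also have "\<dots> \<le> (\<Sum>x\<in>states_upto S n. ennreal (p x) * ennreal (r\<^sub>0 * r\<^sub>1 * f' x))"
    by (intro sum_mono mult_left_mono flow) auto
  also have "\<dots> = (\<Sum>x\<in>states_upto S n. ennreal (p x * (r\<^sub>0 * r\<^sub>1 * f' x)))"
    using p0 f0 r\<^sub>0 r\<^sub>1 by (intro sum.cong refl ennreal_mult[symmetric]) auto
  also have "\<dots> = ennreal (\<Sum>x\<in>states_upto S n. p x * (r\<^sub>0 * r\<^sub>1 * f' x))"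
    using p0 f0 r\<^sub>0 r\<^sub>1 by (intro sum_ennreal) auto
  also have "\<dots> \<le> ennreal (r\<^sub>0 * r\<^sub>1 * b')"
  proof (rule ennreal_leI)
    have "(\<Sum>x\<in>states_upto S n. p x * (r\<^sub>0 * r\<^sub>1 * f' x)) = r\<^sub>0 * r\<^sub>1 * (\<Sum>x\<in>states_upto S n. p x * f' x)"
      by (simp add: sum_distrib_left mult_ac)
    also have "\<dots> \<le> r\<^sub>0 * r\<^sub>1 * b'"
      using pf r\<^sub>0 r\<^sub>1 by (intro mult_left_mono) auto
    finally show "(\<Sum>x\<in>states_upto S n. p x * (r\<^sub>0 * r\<^sub>1 * f' x)) \<le> r\<^sub>0 * r\<^sub>1 * b'" .
  qed
  finally have "ennreal (inverse (T (real n))) * (ennreal (T (real n)) * (\<Sum>x\<in>states_upto S n. ennreal (p x) * I x))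
      \<le> ennreal (inverse (T (real n))) * ennreal (r\<^sub>0 * r\<^sub>1 * b')"
    by (rule mult_left_mono) simp
  also have "ennreal (inverse (T (real n))) * (ennreal (T (real n)) * (\<Sum>x\<in>states_upto S n. ennreal (p x) * I x))
      = (\<Sum>x\<in>states_upto S n. ennreal (p x) * I x)"
  proof -
    have "ennreal (inverse (T (real n))) * ennreal (T (real n)) = 1"
      using T0 by (simp add: ennreal_mult[symmetric])
    then show ?thesis by (simp only: mult.assoc[symmetric] mult_1_left)
  qed
  finally have flux: "(\<Sum>x\<in>states_upto S n. ennreal (p x) * I x) \<le> ennreal (inverse (T (real n))) * ennreal (r\<^sub>0 * r\<^sub>1 * b')" .
  have "err_plus S Q v c p n \<le> 4 * (\<Sum>x\<in>states_upto S n. ennreal (p x) * (I x * (1 + \<kappa> * c)))"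
    unfolding err_plus_eq by (intro mult_left_mono sum_mono mass) auto
  also have "\<dots> = 4 * (\<Sum>x\<in>states_upto S n. ennreal (p x) * I x) * (1 + \<kappa> * c)"
    by (simp only: sum_distrib_right mult.assoc)
  also have "\<dots> \<le> 4 * (ennreal (inverse (T (real n))) * ennreal (r\<^sub>0 * r\<^sub>1 * b')) * (1 + \<kappa> * c)"
    by (intro mult_right_mono mult_left_mono flux) auto
  also have "4 * (ennreal (inverse (T (real n))) * ennreal (r\<^sub>0 * r\<^sub>1 * b')) = ennreal (4 * r\<^sub>0 * r\<^sub>1 * b' / T (real n))"
  proof -
    have "4 * (ennreal (inverse (T (real n))) * ennreal (r\<^sub>0 * r\<^sub>1 * b'))
        = ennreal (4 * (inverse (T (real n)) * (r\<^sub>0 * r\<^sub>1 * b')))"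
      using T0 by (simp only: ennreal_mult' ennreal_numeral less_imp_le inverse_nonnegative_iff_nonnegative zero_le_numeral)
    then show ?thesis by (simp add: field_simps)
  qed
  finally show ?thesis by (simp only: \<kappa>_def a_min_def)
qed

theorem theorem2p4:
  fixes S :: "nat \<Rightarrow> nat"
    and M :: "state \<Rightarrow> 'w measure" and Z :: "real \<Rightarrow> 'w \<Rightarrow> state"
    and Q :: "state \<Rightarrow> state \<Rightarrow> real"
    and \<pi> :: "state \<Rightarrow> real" and \<pi>t :: "nat \<Rightarrow> state \<Rightarrow> real"
    and v f v' f' :: "state \<Rightarrow> real" and b b' :: real and K K' :: nat
    and a :: "nat \<Rightarrow> real" and V T :: "real \<Rightarrow> real"
    and \<beta> r\<^sub>0 r\<^sub>1 :: real
  defines "F \<equiv> states S"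
    and "P \<equiv> transition_function M Z"
  defines "c \<equiv> err_const F \<pi> v b \<beta> (phi_bar S \<beta> P K)"
  defines "E \<equiv> \<lambda>n. err S Q v c (\<pi>t n) n"
    and "E\<^sub>p \<equiv> \<lambda>n. err_plus S Q v c (\<pi>t n) n"
  assumes phases: "\<forall>k\<ge>1. S k = S 1"
    and chain: "regular_jump_markov_chain F M Z" "ergodic F M Z"
    and generator: "is_generator F P Q" "conservative F Q"
    and stationary: "stationary_distribution F Q \<pi>"
    and truncation_class:
      "\<forall>n\<ge>1. \<exists>!C. C \<subseteq> states_upto S n \<and>
         communicating_class F (lc_truncation n Q) C \<and> closed_class F (lc_truncation n Q) C"
    and truncation_stationary: "\<forall>n\<ge>1. stationary_distribution F (lc_truncation n Q) (\<pi>t n)"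
    and drift: "b > 0" "\<forall>x\<in>F. v x \<ge> 0" "\<forall>x\<in>F. f x \<ge> 1"
      "drift_condition F Q v f b (states_upto S K)"
      "\<forall>x\<in>F - states_upto S 0. v x > 0" "levelwise_nondecreasing S v"
    and drift': "b' > 0" "\<forall>x\<in>F. v' x \<ge> 0" "\<forall>x\<in>F. f' x \<ge> 1"
      "levelwise_nondecreasing S v'"
      "drift_condition F Q v' f' b' (states_upto S K')"
    and a_pos: "\<forall>i\<le>S 1. a i > 0"
    and V: "nondecreasing_log_subadditive V"
    and T: "nondecreasing_log_subadditive T" "filterlim T at_top at_top"
    and v_eq: "\<forall>k\<ge>1. \<forall>i\<le>S 1. v (k, i) = V (real k) * a i"
    and finite_sups: "r0_sup S T V f' < \<infinity>" "r1_sup S Q T V a < \<infinity>"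
    and \<beta>: "\<beta> > 0"
    and r\<^sub>0: "r\<^sub>0 > 0" "r0_sup S T V f' \<le> ennreal r\<^sub>0"
    and r\<^sub>1: "r\<^sub>1 > 0" "r1_sup S Q T V a \<le> ennreal r\<^sub>1"
  shows "\<forall>n\<ge>1.
    (\<forall>g. (\<forall>x\<in>F. 0 \<le> g x \<and> g x \<le> f x) \<longrightarrow>
       row_times_col F (\<lambda>x. \<bar>\<pi> x - \<pi>t n x\<bar>) g \<le> (row_times_col F \<pi> g + 1) / 2 * E n) \<and>
    (SUP g\<in>{g. \<forall>x\<in>F. 1 \<le> g x \<and> g x \<le> f x}.
       row_times_col F (\<lambda>x. \<bar>\<pi> x - \<pi>t n x\<bar>) g / row_times_col F \<pi> g) \<le> E n \<and>
    E n \<le> E\<^sub>p n \<and>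
    E\<^sub>p n \<le> ennreal (4 * r\<^sub>0 * r\<^sub>1 * b' / T (real n)) *
      (1 + ennreal (inverse (MIN i\<in>{..S 1}. a i) / V (real (n + 1))) * c)"
proof -
  have mc: "markov_chain F M Z" and irreducible: "irreducible_chain F P"
    using chain by (simp_all add: P_def regular_jump_markov_chain_def ergodic_def)
  note transition = markov_chain_imp_semigroup[OF mc, folded P_def]
  interpret semigroup: generated_semigroup F P Q
    by (rule generated_semigroup.intro) (blast intro: transition generator irreducible)+
  have semigroup: "generated_semigroup (states S) P Q"
    using semigroup.generated_semigroup_axioms by (simp add: F_def)
  have rates: "conservative_rates (states S) Q"
    using semigroup.rate_nonneg generator(2) unfolding F_def conservative_def
    by (intro conservative_rates.intro) blast+
  then have tails: "controlled_tails S Q T V a r\<^sub>1"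
    using phases a_pos T V r\<^sub>1 unfolding controlled_tails_def controlled_tails_axioms_def by blast
  have probe: "\<exists>u b. 0 < b \<and> (\<forall>x\<in>states S. 0 < u x \<and> u x \<le> 1)
      \<and> (\<forall>x\<in>states S. ((\<lambda>z. Q x z * u z) has_sum b * (u x - of_bool (x = y))) (states S))"
    if "y \<in> states S" for y
  proof -
    interpret discounted_semigroup F P Q \<beta> y
      by unfold_locales (use \<beta> that in \<open>auto simp: F_def\<close>)
    show ?thesis
      using \<beta> resolvent_pos resolvent_le_1 resolvent_equation unfolding F_def
      by (intro exI[of _ "\<lambda>x. resolvent \<beta> P x y"] exI[of _ \<beta>]) blast
  qed
  show ?thesis
  proof (intro allI impI conjI)
    fix n :: nat assume n: "1 \<le> n"
    have truncated: "lc_truncated S Q n (\<pi>t n)"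
      using rates n phases truncation_stationary probe
      unfolding lc_truncated_def lc_truncated_axioms_def F_def by blast
    interpret L: lc_truncated S Q n "\<pi>t n" by fact
    have error: "row_times_col F (\<lambda>x. \<bar>\<pi> x - \<pi>t n x\<bar>) g \<le> (row_times_col F \<pi> g + 1) / 2 * E n"
      and finite: "row_times_col F \<pi> g < \<infinity>"
      if "\<forall>x\<in>F. 0 \<le> g x \<and> g x \<le> f x" for g
      using truncation_error[OF semigroup tails truncated, of \<pi> \<beta> b v f K g] stationary \<beta> drift that
      unfolding F_def c_def E_def by blast+
    show "row_times_col F (\<lambda>x. \<bar>\<pi> x - \<pi>t n x\<bar>) g \<le> (row_times_col F \<pi> g + 1) / 2 * E n"
      if "\<forall>x\<in>F. 0 \<le> g x \<and> g x \<le> f x" for g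
      using that by (rule error)
    show "(SUP g\<in>{g. \<forall>x\<in>F. 1 \<le> g x \<and> g x \<le> f x}.
       row_times_col F (\<lambda>x. \<bar>\<pi> x - \<pi>t n x\<bar>) g / row_times_col F \<pi> g) \<le> E n"
    proof (rule SUP_least)
      fix g assume "g \<in> {g. \<forall>x\<in>F. 1 \<le> g x \<and> g x \<le> f x}"
      then have g: "1 \<le> g x" "g x \<le> f x" "0 \<le> g x" if "x \<in> F" for x
        using that by (auto intro: order_trans[of 0 1])
      have "1 = (\<integral>\<^sup>+x. ennreal (\<pi> x) \<partial>count_space F)"
        using stationary by (auto simp: stationary_distribution_def has_sum_iff_nn_integral)
      also have "\<dots> \<le> row_times_col F \<pi> g"
        unfolding row_times_col_eq_nn_integral
      proof (rule nn_integral_mono)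
        fix x assume "x \<in> space (count_space F)"
        then have "ennreal 1 \<le> ennreal (g x)" using g by (intro ennreal_leI) auto
        then have "ennreal (\<pi> x) * 1 \<le> ennreal (\<pi> x) * ennreal (g x)"
          by (intro mult_left_mono) auto
        then show "ennreal (\<pi> x) \<le> ennreal (\<pi> x) * ennreal (g x)" by simp
      qed
      finally have one: "1 \<le> row_times_col F \<pi> g" .
      have "row_times_col F (\<lambda>x. \<bar>\<pi> x - \<pi>t n x\<bar>) g \<le> (row_times_col F \<pi> g + 1) / 2 * E n"
        using g by (intro error) auto
      also have "\<dots> \<le> (row_times_col F \<pi> g + row_times_col F \<pi> g) / 2 * E n"
        using one by (intro mult_right_mono divide_right_mono_ennreal add_left_mono) auto
      also have "(row_times_col F \<pi> g + row_times_col F \<pi> g) / 2 = row_times_col F \<pi> g"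
        using half_times_double[of 1 "row_times_col F \<pi> g"] by (simp add: mult_2 divide_ennreal_def mult.commute)
      finally have "row_times_col F (\<lambda>x. \<bar>\<pi> x - \<pi>t n x\<bar>) g \<le> row_times_col F \<pi> g * E n" .
      then show "row_times_col F (\<lambda>x. \<bar>\<pi> x - \<pi>t n x\<bar>) g / row_times_col F \<pi> g \<le> E n"
        using one by (intro divide_le_posI_ennreal) (auto intro: less_le_trans[of 0 1])
    qed
    show "E n \<le> E\<^sub>p n"
      unfolding E_def E\<^sub>p_def using truncated drift(6) by (rule err_le_err_plus)
    have "(\<Sum>x\<in>states_upto S n. \<pi>t n x * f' x) \<le> b'"
    proof (rule L.truncated_drift[OF drift'(4)])
      fix x assume x: "x \<in> states S"
      show "(\<lambda>z. Q x z * v' z) summable_on states S"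
        using drift'(5) x by (simp add: drift_condition_def F_def)
      have "(\<Sum>\<^sub>\<infinity>z\<in>states S. Q x z * v' z) \<le> - f' x + b' * indicator (states_upto S K') x"
        using drift'(5) x by (simp add: drift_condition_def F_def)
      also have "\<dots> \<le> - f' x + b'" using drift'(1) by (auto split: split_indicator)
      finally show "(\<Sum>\<^sub>\<infinity>z\<in>states S. Q x z * v' z) \<le> - f' x + b'" .
    qed
    then show "E\<^sub>p n \<le> ennreal (4 * r\<^sub>0 * r\<^sub>1 * b' / T (real n)) *
      (1 + ennreal (inverse (MIN i\<in>{..S 1}. a i) / V (real (n + 1))) * c)"
      unfolding E\<^sub>p_def using v_eq drift'(3) r\<^sub>0
      by (intro err_plus_le[OF tails truncated]) (auto simp: F_def)
  qed
qed

end
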